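(* There is a one-to-one correspondence, given by $\Phi\mapsto(\gamma_\mu(\Phi))_{\mu\ne\{e\}}$, between the set of all positive definite functions $\Phi:\mathbb{F}\to\mathcal{L}(\mathcal{H})$ with $\Phi(e)=I_{\mathcal{H}}$ and the set of sequences of contractions $(\gamma_\mu)_{\mu\in\hat{\mathbb{F}},\,\mu\neq\{e\}}$, where $\gamma_\mu:\boldsymbol{D}(\Phi|\Sigma_{\mu^-})\to\boldsymbol{R}(\Phi|\Sigma_{\mu^-})$. (Here $\Phi|\Sigma_{\mu}$ depends only on the $\gamma_{\mu'}$ with $\{e\}\prec\mu'\preceq\mu$, so the domain and range spaces of $\gamma_\mu$ are determined by the previously chosen contractions $\gamma_{\mu'}$, $\{e\}\prec\mu'\prec\mu$, and at step $\mu$ the contraction $\gamma_\mu$ may be chosen arbitrarily between these spaces.)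
   Context: $\mathcal{H}$ is a Hilbert space, $\mathcal{L}(\mathcal{H})$ its bounded operators. $\mathbb{F}$ is the free group with finitely many generators $a_1,\dots,a_m$; $\mathcal{A}=\{a_1,\dots,a_m\}$; $e$ is the unit; words are written in reduced form over $\mathcal{A}\cup\mathcal{A}^{-1}$ and $|s|$ is the reduced length of $s$. $\mathrm{CB}(s,t)$ denotes the longest common initial segment of the reduced words $s,t$. A total order $\preceq$ on $\mathbb{F}$ is called lexicographic if $s_1\preceq s_2$ whenever either $|s_1|<|s_2|$, or $|s_1|=|s_2|$ and, with $t=\mathrm{CB}(s_1,s_2)$ and $b_i$ the first letter of $t^{-1}s_i$, one has $b_1\preceq b_2$. Such an order is fixed. $\hat{\mathbb{F}}$ is the set of classes $\hat s=\{s,s^{-1}\}$, ordered by $\hat s\preceq\hat t$ iff $\min\{s,s^{-1}\}\preceq\min\{t,t^{-1}\}$; $\prec$ means $\preceq$ and $\ne$; $\mu^-$ is the predecessor of $\mu$ in $\hat{\mathbb{F}}$. For $\mu\in\hat{\mathbb{F}}$ put $\Sigma_\mu=\bigcup_{\mu'\preceq\mu}\mu'\subset\mathbb{F}$. $\Gamma_\mu$ is the graph with vertex set $\mathbb{F}$ in which distinct $s,t$ are adjacent iff $\widehat{s^{-1}t}\preceq\mu$. For $\Sigma=\Sigma^{-1}\subset\mathbb{F}$, a function $\phi:\Sigma\to\mathcal{L}(\mathcal{H})$ is positive definite if for all $s_1,\dots,s_k\in\mathbb{F}$ with $s_i^{-1}s_j\in\Sigma$ for all $i,j$, the operator matrix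 $[\phi(s_i^{-1}s_j)]_{i,j=1}^k$ is positive semidefinite. For a finite $S\subset\mathbb{F}$ with $s^{-1}t\in\Sigma$ for all $s,t\in S$, $A(\phi;S)=[\phi(s^{-1}t)]_{s,t\in S}$. Realizations: for a positive semidefinite block operator matrix $A=(A_{ij})_{i,j\in I}$ with entries in $\mathcal{L}(\mathcal{H})$, $\mathcal{R}(A)$ is the (essentially unique) Hilbert space with operators $\omega_i:\mathcal{H}\to\mathcal{R}(A)$ (isometries if $A_{ii}=I$) such that $A_{ij}=\omega_i^*\omega_j$ and the ranges $\omega_i\mathcal{H}$ span a dense subspace of $\mathcal{R}(A)$; it is $\{0\}$ if $I=\emptyset$. For $J\subset I$, $\mathcal{R}(A|J)$ (with $A|J$ the submatrix with rows and columns in $J$) is identified with the closed span of $\omega_i\mathcal{H}$, $i\in J$, in $\mathcal{R}(A)$. For $\mu\neq\{e\}$ write $\mu=\{s_\mu,s_\mu^{-1}\}$ with $s_\mu\preceq s_\mu^{-1}$, and let $C_\mu$ be the (unique, finite) maximal clique of $\Gamma_\mu$ containing $e$ and $s_\mu$; $\{e,s_\mu\}$ is the only edge of $C_\mu$ which is not an edge of $\Gamma_{\mu^-}$. For a positive definite $\psi$ on $\Sigma_{\mu^-}$ set $$\boldsymbol{D}(\psi)=\mathcal{R}(A(\psi;C_\mu\setminus\{s_\mu\}))\ominus\mathcal{R}(A(\psi;C_\mu\setminus\{e,s_\mu\})),$$ $$\boldsymbol{R}(\psi)=\mathcal{R}(A(\psi;C_\mu\setminus\{e\}))\ominus\mathcal{R}(A(\psi;C_\mu\setminus\{e,s_\mu\})).$$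 If $\Phi$ is a positive definite function on $\mathbb{F}$ (or on $\Sigma_\mu$), both spaces for $\psi=\Phi|\Sigma_{\mu^-}$ are viewed as subspaces of $\mathcal{R}(A(\Phi;C_\mu))$, and $\gamma_\mu(\Phi)=P_{\boldsymbol{R}(\psi)}|_{\boldsymbol{D}(\psi)}$ is the orthogonal projection onto $\boldsymbol{R}(\psi)$ restricted to $\boldsymbol{D}(\psi)$. *)

theory Defs
  imports "HOL-Analysis.Analysis" "HOL-Library.Sublist"
begin

section \<open>Complex Hilbert spaces\<close>

text \<open>The inner product is linear in the first and conjugate linear in the second argument; norm and
  topology are those of the underlying real Hilbert space.\<close>

class chilbert_space = real_inner + complete_space +
  fixes scaleC :: "complex \<Rightarrow> 'a \<Rightarrow> 'a"  (infixr "*\<^sub>C" 75)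
    and cinner :: "'a \<Rightarrow> 'a \<Rightarrow> complex"
  assumes scaleC_add_right: "c *\<^sub>C (x + y) = c *\<^sub>C x + c *\<^sub>C y"
    and scaleC_add_left: "(c + d) *\<^sub>C x = c *\<^sub>C x + d *\<^sub>C x"
    and scaleC_scaleC: "c *\<^sub>C d *\<^sub>C x = (c * d) *\<^sub>C x"
    and scaleR_scaleC: "scaleR r x = complex_of_real r *\<^sub>C x"
    and cinner_commute: "cinner x y = cnj (cinner y x)"
    and cinner_add_left: "cinner (x + y) z = cinner x z + cinner y z"
    and cinner_scaleC_left: "cinner (c *\<^sub>C x) y = c * cinner x y"
    and inner_eq_Re_cinner: "inner x y = Re (cinner x y)"

instantiation complex :: chilbert_space
begin
definition scaleC_complex :: "complex \<Rightarrow> complex \<Rightarrow> complex" where "scaleC_complex c x = c * x"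
definition cinner_complex :: "complex \<Rightarrow> complex \<Rightarrow> complex" where "cinner_complex x y = x * cnj y"
instance
  by standard
    (auto simp: scaleC_complex_def cinner_complex_def algebra_simps inner_complex_def scaleR_conv_of_real)
end

definition bounded_operator :: "('a::chilbert_space \<Rightarrow> 'b::chilbert_space) \<Rightarrow> bool" where
  "bounded_operator T \<longleftrightarrow> bounded_linear T \<and> (\<forall>c x. T (c *\<^sub>C x) = c *\<^sub>C T x)"

definition linear_between ::
  "'a::chilbert_space set \<Rightarrow> 'b::chilbert_space set \<Rightarrow> ('a \<Rightarrow> 'b) \<Rightarrow> bool" where
  "linear_between X Y T \<longleftrightarrow> T \<in> X \<rightarrow>\<^sub>E Y \<and>
     (\<forall>x\<in>X. \<forall>y\<in>X. T (x + y) = T x + T y) \<and> (\<forall>c. \<forall>x\<in>X. T (c *\<^sub>C x) = c *\<^sub>C T x)"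

definition contraction_between ::
  "'a::chilbert_space set \<Rightarrow> 'b::chilbert_space set \<Rightarrow> ('a \<Rightarrow> 'b) \<Rightarrow> bool" where
  "contraction_between X Y T \<longleftrightarrow> linear_between X Y T \<and> (\<forall>x\<in>X. norm (T x) \<le> norm x)"

definition isometry_between ::
  "'a::chilbert_space set \<Rightarrow> 'b::chilbert_space set \<Rightarrow> ('a \<Rightarrow> 'b) \<Rightarrow> bool" where
  "isometry_between X Y T \<longleftrightarrow> linear_between X Y T \<and> (\<forall>x\<in>X. norm (T x) = norm x)"

definition ominus :: "'a::chilbert_space set \<Rightarrow> 'a set \<Rightarrow> 'a set"  (infixl "\<ominus>" 65) where
  "X \<ominus> Y = {x \<in> X. \<forall>y\<in>Y. cinner x y = 0}"

definition orth_proj :: "'a::chilbert_space set \<Rightarrow> 'a \<Rightarrow> 'a" where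
  "orth_proj M x = (THE p. p \<in> M \<and> (\<forall>y\<in>M. cinner (x - p) y = 0))"


section \<open>Square-summable families\<close>

typedef (overloaded) ('i, 'h::chilbert_space) ell2 =
  "{f :: 'i \<Rightarrow> 'h. (\<lambda>i. (norm (f i))\<^sup>2) summable_on UNIV}"
  by (rule exI[of _ "\<lambda>_. 0"]) simp

setup_lifting type_definition_ell2

lemma cinner_scaleC_right: "cinner x (c *\<^sub>C y) = cnj c * cinner x y"
proof -
  have "cinner x (c *\<^sub>C y) = cnj (c * cinner y x)"
    unfolding cinner_scaleC_left[symmetric] by (rule cinner_commute)
  also have "\<dots> = cnj c * cinner x y"
    using cinner_commute[of x y] by simp
  finally show ?thesis .
qed

lemma cinner_norm_le:
  fixes x y :: "'a::chilbert_space"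
  shows "norm (cinner x y) \<le> norm x * norm y"
proof (cases "cinner x y = 0")
  case False
  define c where "c = cnj (cinner x y) / norm (cinner x y)"
  have nc: "norm c = 1" using False by (simp add: c_def norm_divide)
  have cc: "c * cnj c = 1" using complex_norm_square[of c] nc by simp
  have "cinner (c *\<^sub>C x) y = of_real (norm (cinner x y))"
    using False
    using complex_norm_square[of "cinner x y"]
    by (simp add: cinner_scaleC_left c_def field_simps power2_eq_square)
  hence "norm (cinner x y) = inner (c *\<^sub>C x) y" by (simp add: inner_eq_Re_cinner)
  also have "\<dots> \<le> norm (c *\<^sub>C x) * norm y" by (rule norm_cauchy_schwarz)
  also have "norm (c *\<^sub>C x) = norm x"
  proof -
    have "cinner (c *\<^sub>C x) (c *\<^sub>C x) = c * (cnj c * cinner x x)"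
      by (simp add: cinner_scaleC_left cinner_scaleC_right)
    also have "\<dots> = cinner x x" using cc by (simp add: mult.assoc[symmetric])
    finally show ?thesis by (simp add: norm_eq_sqrt_inner inner_eq_Re_cinner)
  qed
  finally show ?thesis .
qed simp

lemma norm_scaleC:
  fixes x :: "'a::chilbert_space"
  shows "norm (c *\<^sub>C x) = norm c * norm x"
proof -
  have "cinner (c *\<^sub>C x) (c *\<^sub>C x) = c * (cnj c * cinner x x)"
    by (simp add: cinner_scaleC_left cinner_scaleC_right)
  also have "\<dots> = of_real ((norm c)\<^sup>2) * cinner x x"
    by (simp only: complex_norm_square mult.assoc)
  finally have "inner (c *\<^sub>C x) (c *\<^sub>C x) = (norm c)\<^sup>2 * inner x x"
    by (simp add: inner_eq_Re_cinner)
  thus ?thesis by (simp add: norm_eq_sqrt_inner real_sqrt_mult)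
qed

lemma ell2_add_summable:
  fixes f g :: "'i \<Rightarrow> 'a::chilbert_space"
  assumes "(\<lambda>i. (norm (f i))\<^sup>2) summable_on UNIV" "(\<lambda>i. (norm (g i))\<^sup>2) summable_on UNIV"
  shows "(\<lambda>i. (norm (f i + g i))\<^sup>2) summable_on UNIV"
proof (rule summable_on_comparison_test)
  show "(\<lambda>i. 2 * (norm (f i))\<^sup>2 + 2 * (norm (g i))\<^sup>2) summable_on UNIV"
    using assms by (intro summable_on_add summable_on_cmult_right)
  fix i
  have "(norm (f i + g i))\<^sup>2 \<le> (norm (f i) + norm (g i))\<^sup>2"
    by (intro power_mono norm_triangle_ineq) simp
  also have "\<dots> \<le> 2 * (norm (f i))\<^sup>2 + 2 * (norm (g i))\<^sup>2"
    using sum_squares_bound[of "norm (f i)" "norm (g i)"] by (simp add: power2_sum)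
  finally show "(norm (f i + g i))\<^sup>2 \<le> 2 * (norm (f i))\<^sup>2 + 2 * (norm (g i))\<^sup>2" .
qed simp

lemma ell2_cinner_summable:
  fixes f g :: "'i \<Rightarrow> 'a::chilbert_space"
  assumes "(\<lambda>i. (norm (f i))\<^sup>2) summable_on UNIV" "(\<lambda>i. (norm (g i))\<^sup>2) summable_on UNIV"
  shows "(\<lambda>i. cinner (f i) (g i)) summable_on UNIV"
proof (rule abs_summable_summable, rule summable_on_comparison_test)
  show "(\<lambda>i. (norm (f i))\<^sup>2 + (norm (g i))\<^sup>2) summable_on UNIV"
    using assms by (intro summable_on_add)
  fix i
  have "norm (f i) * norm (g i) \<le> (norm (f i))\<^sup>2 + (norm (g i))\<^sup>2"
    using sum_squares_bound[of "norm (f i)" "norm (g i)"]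
      mult_nonneg_nonneg[OF norm_ge_zero[of "f i"] norm_ge_zero[of "g i"]]
    by linarith
  thus "norm (cinner (f i) (g i)) \<le> (norm (f i))\<^sup>2 + (norm (g i))\<^sup>2"
    using cinner_norm_le[of "f i" "g i"] by linarith
qed simp

lemma ell2_inner_summable:
  fixes f g :: "'i \<Rightarrow> 'a::chilbert_space"
  assumes "(\<lambda>i. (norm (f i))\<^sup>2) summable_on UNIV" "(\<lambda>i. (norm (g i))\<^sup>2) summable_on UNIV"
  shows "(\<lambda>i. inner (f i) (g i)) summable_on UNIV"
  using summable_on_Re[OF ell2_cinner_summable[OF assms]] by (simp add: inner_eq_Re_cinner)

instantiation ell2 :: (type, chilbert_space) real_vector
begin

lift_definition zero_ell2 :: "('a, 'b) ell2" is "\<lambda>_. 0" by simp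
lift_definition plus_ell2 :: "('a, 'b) ell2 \<Rightarrow> ('a, 'b) ell2 \<Rightarrow> ('a, 'b) ell2"
  is "\<lambda>f g i. f i + g i" by (rule ell2_add_summable)
lift_definition uminus_ell2 :: "('a, 'b) ell2 \<Rightarrow> ('a, 'b) ell2" is "\<lambda>f i. - f i" by simp
definition minus_ell2 :: "('a, 'b) ell2 \<Rightarrow> ('a, 'b) ell2 \<Rightarrow> ('a, 'b) ell2"
  where "minus_ell2 f g = f + (- g)"
lift_definition scaleR_ell2 :: "real \<Rightarrow> ('a, 'b) ell2 \<Rightarrow> ('a, 'b) ell2" is "\<lambda>r f i. scaleR r (f i)"
  by (simp add: power_mult_distrib summable_on_cmult_right)

instance
proof
  fix f g h :: "('a, 'b) ell2" and r s :: real
  show "f + g + h = f + (g + h)" by transfer (simp add: add.assoc)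
  show "f + g = g + f" by transfer (simp add: add.commute)
  show "0 + f = f" by transfer simp
  show "- f + f = 0" by transfer simp
  show "f - g = f + - g" by (rule minus_ell2_def)
  show "r *\<^sub>R (f + g) = r *\<^sub>R f + r *\<^sub>R g" by transfer (simp add: scaleR_add_right)
  show "(r + s) *\<^sub>R f = r *\<^sub>R f + s *\<^sub>R f" by transfer (simp add: scaleR_add_left)
  show "r *\<^sub>R s *\<^sub>R f = (r * s) *\<^sub>R f" by transfer simp
  show "1 *\<^sub>R f = f" by transfer simp
qed

end

instantiation ell2 :: (type, chilbert_space) real_inner
begin

lift_definition inner_ell2 :: "('a, 'b) ell2 \<Rightarrow> ('a, 'b) ell2 \<Rightarrow> real"
  is "\<lambda>f g. \<Sum>\<^sub>\<infinity>i. inner (f i) (g i)" .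
definition norm_ell2 :: "('a, 'b) ell2 \<Rightarrow> real" where "norm_ell2 f = sqrt (inner f f)"
definition sgn_ell2 :: "('a, 'b) ell2 \<Rightarrow> ('a, 'b) ell2" where "sgn_ell2 f = f /\<^sub>R norm f"
definition dist_ell2 :: "('a, 'b) ell2 \<Rightarrow> ('a, 'b) ell2 \<Rightarrow> real" where "dist_ell2 f g = norm (f - g)"
definition uniformity_ell2 :: "(('a, 'b) ell2 \<times> ('a, 'b) ell2) filter"
  where "uniformity_ell2 = (INF e\<in>{0<..}. principal {(x, y). dist x y < e})"
definition open_ell2 :: "('a, 'b) ell2 set \<Rightarrow> bool"
  where "open_ell2 U = (\<forall>x\<in>U. eventually (\<lambda>(x', y). x' = x \<longrightarrow> y \<in> U) uniformity)"

instance
proof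
  fix f g h :: "('a, 'b) ell2" and r :: real and U :: "('a, 'b) ell2 set"
  show "sgn f = f /\<^sub>R norm f" by (rule sgn_ell2_def)
  show "dist f g = norm (f - g)" by (rule dist_ell2_def)
  show "uniformity = (INF e\<in>{0<..}. principal {(x, y::('a, 'b) ell2). dist x y < e})"
    by (rule uniformity_ell2_def)
  show "open U = (\<forall>x\<in>U. eventually (\<lambda>(x', y). x' = x \<longrightarrow> y \<in> U) uniformity)"
    by (rule open_ell2_def)
  show "inner f g = inner g f" by transfer (simp add: inner_commute)
  show "inner (f + g) h = inner f h + inner g h"
    by transfer (simp add: inner_add_left infsum_add ell2_inner_summable)
  show "inner (r *\<^sub>R f) g = r * inner f g"
    by transfer (simp add: infsum_cmult_right')
  show "0 \<le> inner f f" by transfer (simp add: infsum_nonneg)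
  show "inner f f = 0 \<longleftrightarrow> f = 0"
  proof transfer
    fix f :: "'a \<Rightarrow> 'b" assume s: "(\<lambda>i. (norm (f i))\<^sup>2) summable_on UNIV"
    have "f = (\<lambda>_. 0)" if z: "(\<Sum>\<^sub>\<infinity>i. inner (f i) (f i)) = 0"
    proof
      fix i
      have "inner (f i) (f i) = 0"
        using nonneg_infsum_le_0D[of "\<lambda>i. inner (f i) (f i)" UNIV i] z ell2_inner_summable[OF s s] by simp
      thus "f i = 0" by simp
    qed
    thus "((\<Sum>\<^sub>\<infinity>i. inner (f i) (f i)) = 0) = (f = (\<lambda>_. 0))" by auto
  qed
  show "norm f = sqrt (inner f f)" by (rule norm_ell2_def)
qed

end

lemma norm_ell2_sq: "(norm f)\<^sup>2 = (\<Sum>\<^sub>\<infinity>i. (norm (Rep_ell2 f i))\<^sup>2)"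
  unfolding power2_norm_eq_inner by (rule inner_ell2.rep_eq)

lemma Rep_ell2_summable: "(\<lambda>i. (norm (Rep_ell2 f i))\<^sup>2) summable_on UNIV"
  using Rep_ell2[of f] by simp

lemma Rep_ell2_diff: "Rep_ell2 (f - g) i = Rep_ell2 f i - Rep_ell2 g i"
  unfolding minus_ell2_def plus_ell2.rep_eq uminus_ell2.rep_eq by simp

lemma sum_le_norm_ell2: "finite F \<Longrightarrow> (\<Sum>i\<in>F. (norm (Rep_ell2 f i))\<^sup>2) \<le> (norm f)\<^sup>2"
  unfolding norm_ell2_sq by (rule finite_sum_le_infsum[OF Rep_ell2_summable]) auto

lemma coord_le_norm_ell2: "norm (Rep_ell2 f i) \<le> norm f"
proof (rule power2_le_imp_le)
  show "(norm (Rep_ell2 f i))\<^sup>2 \<le> (norm f)\<^sup>2"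
    using sum_le_norm_ell2[of "{i}" f] by simp
qed simp

instance ell2 :: (type, chilbert_space) complete_space
proof
  fix X :: "nat \<Rightarrow> ('a, 'b) ell2" assume C: "Cauchy X"
  have "Cauchy (\<lambda>n. Rep_ell2 (X n) i)" for i
  proof (rule metric_CauchyI)
    fix e :: real assume "0 < e"
    then obtain N where "\<forall>m\<ge>N. \<forall>n\<ge>N. dist (X m) (X n) < e" using C by (meson Cauchy_def)
    moreover have "dist (Rep_ell2 (X m) i) (Rep_ell2 (X n) i) \<le> dist (X m) (X n)" for m n
      using coord_le_norm_ell2[of "X m - X n" i] by (simp add: dist_norm Rep_ell2_diff)
    ultimately show "\<exists>N. \<forall>m\<ge>N. \<forall>n\<ge>N. dist (Rep_ell2 (X m) i) (Rep_ell2 (X n) i) < e"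
      by (meson order.strict_trans1)
  qed
  hence "\<forall>i. \<exists>l. (\<lambda>n. Rep_ell2 (X n) i) \<longlonglongrightarrow> l"
    using Cauchy_convergent convergent_def by blast
  then obtain L where L: "(\<lambda>n. Rep_ell2 (X n) i) \<longlonglongrightarrow> L i" for i
    using choice[of "\<lambda>i l. (\<lambda>n. Rep_ell2 (X n) i) \<longlonglongrightarrow> l"] by blast
  have bd: "(\<Sum>i\<in>F. (norm (L i - Rep_ell2 (X n) i))\<^sup>2) \<le> e\<^sup>2"
    if "finite F" "\<forall>m\<ge>N. dist (X m) (X n) < e" for F n N e
  proof (rule tendsto_upperbound)
    show "(\<lambda>m. \<Sum>i\<in>F. (norm (Rep_ell2 (X m) i - Rep_ell2 (X n) i))\<^sup>2)
            \<longlonglongrightarrow> (\<Sum>i\<in>F. (norm (L i - Rep_ell2 (X n) i))\<^sup>2)"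
      by (intro tendsto_intros L)
    show "\<forall>\<^sub>F m in sequentially.
            (\<Sum>i\<in>F. (norm (Rep_ell2 (X m) i - Rep_ell2 (X n) i))\<^sup>2) \<le> e\<^sup>2"
      unfolding eventually_sequentially
    proof (intro exI allI impI)
      fix m assume "N \<le> m"
      hence "norm (X m - X n) \<le> e" using that(2) by (simp add: dist_norm less_imp_le)
      hence "(norm (X m - X n))\<^sup>2 \<le> e\<^sup>2" by (intro power_mono) auto
      thus "(\<Sum>i\<in>F. (norm (Rep_ell2 (X m) i - Rep_ell2 (X n) i))\<^sup>2) \<le> e\<^sup>2"
        using sum_le_norm_ell2[OF that(1), of "X m - X n"] by (simp add: Rep_ell2_diff)
    qed
  qed simp
  have summ: "(\<lambda>i. (norm (L i - Rep_ell2 (X n) i))\<^sup>2) summable_on UNIV"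
    if "\<forall>m\<ge>N. dist (X m) (X n) < e" for n N e
    by (rule nonneg_bdd_above_summable_on) (auto intro!: bdd_aboveI2[where M = "e\<^sup>2"] bd[OF _ that])
  obtain N1 where "\<forall>m\<ge>N1. \<forall>n\<ge>N1. dist (X m) (X n) < 1"
    using C by (meson Cauchy_def zero_less_one)
  hence "(\<lambda>i. (norm ((L i - Rep_ell2 (X N1) i) + Rep_ell2 (X N1) i))\<^sup>2) summable_on UNIV"
    by (intro ell2_add_summable summ[of N1 _ 1] Rep_ell2_summable) auto
  hence RL: "Rep_ell2 (Abs_ell2 L) = L" by (simp add: Abs_ell2_inverse)
  have "X \<longlonglongrightarrow> Abs_ell2 L"
  proof (rule metric_LIMSEQ_I)
    fix e :: real assume e: "0 < e"
    then obtain N where N: "\<forall>m\<ge>N. \<forall>n\<ge>N. dist (X m) (X n) < e / 2"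
      using C by (meson Cauchy_def half_gt_zero)
    have "dist (X n) (Abs_ell2 L) < e" if "n \<ge> N" for n
    proof -
      have N': "\<forall>m\<ge>N. dist (X m) (X n) < e / 2" using N that by blast
      have "(norm (Abs_ell2 L - X n))\<^sup>2 = (\<Sum>\<^sub>\<infinity>i. (norm (L i - Rep_ell2 (X n) i))\<^sup>2)"
        by (simp add: norm_ell2_sq Rep_ell2_diff RL)
      also have "\<dots> \<le> (e / 2)\<^sup>2"
        by (rule infsum_le_finite_sums[OF summ[OF N']]) (rule bd[OF _ N'])
      finally have "norm (Abs_ell2 L - X n) \<le> e / 2"
        by (rule power2_le_imp_le) (use e in simp)
      thus ?thesis using e by (simp add: dist_norm norm_minus_commute)
    qed
    thus "\<exists>N. \<forall>n\<ge>N. dist (X n) (Abs_ell2 L) < e" by blast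
  qed
  thus "convergent X" by (rule convergentI)
qed

instantiation ell2 :: (type, chilbert_space) chilbert_space
begin

lift_definition scaleC_ell2 :: "complex \<Rightarrow> ('a, 'b) ell2 \<Rightarrow> ('a, 'b) ell2" is "\<lambda>c f i. c *\<^sub>C f i"
  by (simp add: norm_scaleC power_mult_distrib summable_on_cmult_right)
lift_definition cinner_ell2 :: "('a, 'b) ell2 \<Rightarrow> ('a, 'b) ell2 \<Rightarrow> complex"
  is "\<lambda>f g. \<Sum>\<^sub>\<infinity>i. cinner (f i) (g i)" .

instance
proof
  fix f g h :: "('a, 'b) ell2" and c d :: complex and r :: real
  show "c *\<^sub>C (f + g) = c *\<^sub>C f + c *\<^sub>C g" by transfer (simp add: scaleC_add_right)
  show "(c + d) *\<^sub>C f = c *\<^sub>C f + d *\<^sub>C f" by transfer (simp add: scaleC_add_left)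
  show "c *\<^sub>C d *\<^sub>C f = (c * d) *\<^sub>C f" by transfer (simp add: scaleC_scaleC)
  show "scaleR r f = complex_of_real r *\<^sub>C f" by transfer (simp add: scaleR_scaleC)
  show "cinner f g = cnj (cinner g f)"
    by transfer (unfold infsum_cnj[symmetric], rule infsum_cong, rule cinner_commute)
  show "cinner (f + g) h = cinner f h + cinner g h"
    by transfer (simp add: cinner_add_left infsum_add ell2_cinner_summable)
  show "cinner (c *\<^sub>C f) g = c * cinner f g"
    by transfer (simp add: cinner_scaleC_left infsum_cmult_right')
  show "inner f g = Re (cinner f g)"
    by transfer (simp add: inner_eq_Re_cinner infsum_Re ell2_cinner_summable)
qed

end


section \<open>Positive semidefinite operator matrices and their realizations\<close>

definition pos_semidef :: "'i set \<Rightarrow> ('i \<Rightarrow> 'i \<Rightarrow> 'h \<Rightarrow> 'h::chilbert_space) \<Rightarrow> bool" where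
  "pos_semidef I A \<longleftrightarrow> (\<forall>h. (\<Sum>i\<in>I. \<Sum>j\<in>I. cinner (A i j (h j)) (h i)) \<in> \<real> \<and>
                           0 \<le> Re (\<Sum>i\<in>I. \<Sum>j\<in>I. cinner (A i j (h j)) (h i)))"

text \<open>The second conjunct of \<open>realizes\<close> says \<open>A\<^sub>i\<^sub>j = \<omega>\<^sub>i\<^sup>* \<omega>\<^sub>j\<close>. The realization space is the closed linear
  span of the ranges of the \<open>\<omega>\<^sub>i\<close>; these ranges are complex subspaces, so their real linear span is
  their complex linear span. Since realizations are unique up to unitary equivalence, one is
  picked, inside the Hilbert space of square-summable \<open>'h\<close>-valued families on the index type.
  This space is large enough: for a positive semidefinite \<open>A\<close> on a finite \<open>I\<close>, the columns of the square
  root of \<open>A\<close> (extended by zero outside \<open>I\<close>) form a realization.\<close>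

definition realizes ::
  "'i set \<Rightarrow> ('i \<Rightarrow> 'i \<Rightarrow> 'h::chilbert_space \<Rightarrow> 'h) \<Rightarrow> ('i \<Rightarrow> 'h \<Rightarrow> 'k::chilbert_space) \<Rightarrow> bool" where
  "realizes I A \<omega> \<longleftrightarrow> (\<forall>i\<in>I. bounded_operator (\<omega> i)) \<and>
     (\<forall>i\<in>I. \<forall>j\<in>I. \<forall>g h. cinner (\<omega> j g) (\<omega> i h) = cinner (A i j g) h)"

definition realization ::
  "'i set \<Rightarrow> ('i \<Rightarrow> 'i \<Rightarrow> 'h::chilbert_space \<Rightarrow> 'h) \<Rightarrow> 'i \<Rightarrow> 'h \<Rightarrow> ('i, 'h) ell2" where
  "realization I A = (SOME \<omega>. realizes I A \<omega>)"

definition closed_span :: "('i \<Rightarrow> 'h::chilbert_space \<Rightarrow> 'k::chilbert_space) \<Rightarrow> 'i set \<Rightarrow> 'k set" where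
  "closed_span \<omega> J = closure (span (\<Union>j\<in>J. range (\<omega> j)))"

definition realization_space ::
  "'i set \<Rightarrow> ('i \<Rightarrow> 'i \<Rightarrow> 'h::chilbert_space \<Rightarrow> 'h) \<Rightarrow> ('i, 'h) ell2 set" where
  "realization_space I A = closed_span (realization I A) I"

definition submatrix :: "('i \<Rightarrow> 'i \<Rightarrow> 'h \<Rightarrow> 'h) \<Rightarrow> 'i set \<Rightarrow> 'i \<Rightarrow> 'i \<Rightarrow> 'h \<Rightarrow> 'h" where
  "submatrix A J = (\<lambda>i\<in>J. \<lambda>j\<in>J. A i j)"

text \<open>The isometry from the realization space of \<open>A|J\<close> onto the closed span of the \<open>\<omega>\<^sub>j\<close>, \<open>j \<in> J\<close>, in that of \<open>A\<close>,
  along which the two are identified.\<close>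

definition identification ::
  "'i set \<Rightarrow> ('i \<Rightarrow> 'i \<Rightarrow> 'h::chilbert_space \<Rightarrow> 'h) \<Rightarrow> 'i set \<Rightarrow> ('i, 'h) ell2 \<Rightarrow> ('i, 'h) ell2" where
  "identification I A J = (THE V.
     isometry_between (realization_space J (submatrix A J)) (realization_space I A) V \<and>
     (\<forall>j\<in>J. \<forall>h. V (realization J (submatrix A J) j h) = realization I A j h))"


section \<open>The free group\<close>

text \<open>The letter \<open>(a, True)\<close> stands for the generator \<open>a\<close> and \<open>(a, False)\<close> for its inverse.\<close>

type_synonym 'a letter = "'a \<times> bool"

definition inv_letter :: "'a letter \<Rightarrow> 'a letter" where
  "inv_letter x = (fst x, \<not> snd x)"

definition reduced :: "'a letter list \<Rightarrow> bool" where
  "reduced w \<longleftrightarrow> successively (\<lambda>x y. y \<noteq> inv_letter x) w"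

fun push :: "'a letter \<Rightarrow> 'a letter list \<Rightarrow> 'a letter list" where
  "push x [] = [x]"
| "push x (y # w) = (if y = inv_letter x then w else x # y # w)"

lemma inv_letter_inv_letter [simp]: "inv_letter (inv_letter x) = x"
  by (simp add: inv_letter_def)

lemma inv_letter_neq [simp]: "inv_letter x \<noteq> x"
  by (cases x) (simp add: inv_letter_def)

lemma reduced_simps [simp]:
  "reduced []" "reduced [x]" "reduced (x # y # w) \<longleftrightarrow> y \<noteq> inv_letter x \<and> reduced (y # w)"
  by (auto simp: reduced_def)

lemma reduced_Cons: "reduced (x # w) \<Longrightarrow> reduced w"
  by (cases w) auto

lemma reduced_push: "reduced w \<Longrightarrow> reduced (push x w)"
  by (cases w) (auto dest: reduced_Cons)

lemma push_Cons: "reduced (x # w) \<Longrightarrow> push x w = x # w"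
  by (cases w) auto

lemma push_push: "reduced w \<Longrightarrow> push x (push (inv_letter x) w) = w"
  by (cases w) (auto simp: push_Cons)

lemma reduced_foldr_push: "reduced v \<Longrightarrow> reduced (foldr push u v)"
  by (induction u) (auto intro: reduced_push)

lemma foldr_push_push:
  assumes "reduced w"
  shows "foldr push (push x z) w = push x (foldr push z w)"
  using assms by (cases z) (auto simp: push_push reduced_foldr_push)

lemma reduced_inv:
  assumes "reduced w" shows "reduced (rev (map inv_letter w))"
proof -
  have "successively (\<lambda>x y. x \<noteq> inv_letter y) (map inv_letter w)"
    unfolding successively_map
    by (rule successively_mono[OF assms[unfolded reduced_def]]) auto
  thus ?thesis by (simp add: reduced_def)
qed

typedef 'a free_group = "{w :: 'a letter list. reduced w}"
  morphisms word_of Abs_free_group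
  by (rule exI[of _ "[]"]) simp

setup_lifting type_definition_free_group

instantiation free_group :: (type) "{monoid_mult, inverse}"
begin

lift_definition one_free_group :: "'a free_group" is "[]" by simp
lift_definition times_free_group :: "'a free_group \<Rightarrow> 'a free_group \<Rightarrow> 'a free_group"
  is "foldr push" by (rule reduced_foldr_push)
lift_definition inverse_free_group :: "'a free_group \<Rightarrow> 'a free_group"
  is "\<lambda>w. rev (map inv_letter w)" by (rule reduced_inv)
definition divide_free_group :: "'a free_group \<Rightarrow> 'a free_group \<Rightarrow> 'a free_group"
  where "divide_free_group s t = s * inverse t"

instance
proof
  fix s t u :: "'a free_group"
  show "s * t * u = s * (t * u)"
  proof transfer
    fix s t u :: "'a letter list" assume "reduced t" and u: "reduced u"
    show "foldr push (foldr push s t) u = foldr push s (foldr push t u)"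
      by (induction s) (simp_all add: foldr_push_push[OF u])
  qed
  show "1 * s = s" by transfer simp
  show "s * 1 = s"
  proof transfer
    fix s :: "'a letter list" assume "reduced s"
    thus "foldr push s [] = s"
    proof (induction s)
      case (Cons x s)
      thus ?case using reduced_Cons[OF Cons.prems] push_Cons[OF Cons.prems] by simp
    qed simp
  qed
qed

end

lemma free_group_left_inverse: "inverse s * s = (1 :: 'a free_group)"
proof transfer
  fix s :: "'a letter list" assume "reduced s"
  thus "foldr push (rev (map inv_letter s)) s = []"
    by (induction s) (auto dest: reduced_Cons)
qed

definition word_length :: "'a free_group \<Rightarrow> nat" where
  "word_length s = length (word_of s)"

lift_definition of_letter :: "'a letter \<Rightarrow> 'a free_group" is "\<lambda>x. [x]" by simp

lift_definition common_beginning :: "'a free_group \<Rightarrow> 'a free_group \<Rightarrow> 'a free_group"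
  is "longest_common_prefix"
proof -
  fix u v :: "'a letter list" assume "reduced u"
  moreover obtain w where "u = longest_common_prefix u v @ w"
    using longest_common_prefix_prefix1[of u v] by (auto simp: prefix_def)
  ultimately have "reduced (longest_common_prefix u v @ w)" by simp
  thus "reduced (longest_common_prefix u v)"
    unfolding reduced_def successively_append_iff by blast
qed

definition first_letter :: "'a free_group \<Rightarrow> 'a free_group" where
  "first_letter s = of_letter (hd (word_of s))"


section \<open>Lexicographic orders and the graphs\<close>

text \<open>For \<open>s\<^sub>1 = s\<^sub>2\<close> there are no first letters to compare.\<close>

definition lexicographic_order :: "('a free_group \<Rightarrow> 'a free_group \<Rightarrow> bool) \<Rightarrow> bool" where
  "lexicographic_order le \<longleftrightarrow> linear_order {(s, t). le s t} \<and>
     (\<forall>s\<^sub>1 s\<^sub>2. word_length s\<^sub>1 < word_length s\<^sub>2 \<longrightarrow> le s\<^sub>1 s\<^sub>2) \<and>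
     (\<forall>s\<^sub>1 s\<^sub>2. word_length s\<^sub>1 = word_length s\<^sub>2 \<and> s\<^sub>1 \<noteq> s\<^sub>2 \<and>
        (let t = common_beginning s\<^sub>1 s\<^sub>2
         in le (first_letter (inverse t * s\<^sub>1)) (first_letter (inverse t * s\<^sub>2)))
        \<longrightarrow> le s\<^sub>1 s\<^sub>2)"

definition inv_class :: "'a free_group \<Rightarrow> 'a free_group set" where
  "inv_class s = {s, inverse s}"

definition inv_classes :: "'a free_group set set" where
  "inv_classes = range inv_class"

definition nontrivial_classes :: "'a free_group set set" where
  "nontrivial_classes = inv_classes - {{1}}"

context
  fixes le :: "'a free_group \<Rightarrow> 'a free_group \<Rightarrow> bool"
begin

definition min_rep :: "'a free_group set \<Rightarrow> 'a free_group" where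
  "min_rep \<mu> = (THE s. s \<in> \<mu> \<and> (\<forall>t\<in>\<mu>. le s t))"

definition class_le :: "'a free_group set \<Rightarrow> 'a free_group set \<Rightarrow> bool" where
  "class_le \<mu> \<nu> \<longleftrightarrow> le (min_rep \<mu>) (min_rep \<nu>)"

definition class_less :: "'a free_group set \<Rightarrow> 'a free_group set \<Rightarrow> bool" where
  "class_less \<mu> \<nu> \<longleftrightarrow> class_le \<mu> \<nu> \<and> \<mu> \<noteq> \<nu>"

definition pred_class :: "'a free_group set \<Rightarrow> 'a free_group set" where
  "pred_class \<mu> = (THE \<nu>. \<nu> \<in> inv_classes \<and> class_less \<nu> \<mu> \<and>
                      (\<forall>\<kappa>\<in>inv_classes. class_less \<kappa> \<mu> \<longrightarrow> class_le \<kappa> \<nu>))"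

definition Sigma_upto :: "'a free_group set \<Rightarrow> 'a free_group set" where
  "Sigma_upto \<mu> = \<Union>{\<mu>' \<in> inv_classes. class_le \<mu>' \<mu>}"

definition adjacent :: "'a free_group set \<Rightarrow> 'a free_group \<Rightarrow> 'a free_group \<Rightarrow> bool" where
  "adjacent \<mu> s t \<longleftrightarrow> s \<noteq> t \<and> class_le (inv_class (inverse s * t)) \<mu>"

definition clique :: "'a free_group set \<Rightarrow> 'a free_group set \<Rightarrow> bool" where
  "clique \<mu> C \<longleftrightarrow> (\<forall>s\<in>C. \<forall>t\<in>C. s \<noteq> t \<longrightarrow> adjacent \<mu> s t)"

definition maximal_clique :: "'a free_group set \<Rightarrow> 'a free_group set \<Rightarrow> bool" where
  "maximal_clique \<mu> C \<longleftrightarrow> clique \<mu> C \<and> (\<forall>C'. clique \<mu> C' \<and> C \<subseteq> C' \<longrightarrow> C' = C)"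

definition the_clique :: "'a free_group set \<Rightarrow> 'a free_group set" where
  "the_clique \<mu> = (THE C. maximal_clique \<mu> C \<and> 1 \<in> C \<and> min_rep \<mu> \<in> C)"

end


section \<open>Positive definite functions and their parameters\<close>

definition positive_definite ::
  "'a free_group set \<Rightarrow> ('a free_group \<Rightarrow> 'h::chilbert_space \<Rightarrow> 'h) \<Rightarrow> bool" where
  "positive_definite \<Sigma> \<phi> \<longleftrightarrow>
     (\<forall>(k::nat) s. (\<forall>i<k. \<forall>j<k. inverse (s i) * s j \<in> \<Sigma>) \<longrightarrow>
        pos_semidef {..<k} (\<lambda>i j. \<phi> (inverse (s i) * s j)))"

text \<open>Functions with domain \<open>\<Sigma>\<close> are represented extensionally, so that for \<open>\<Sigma> = UNIV\<close> they are just the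
  functions on the group.\<close>

definition unital_pd_functions ::
  "'a free_group set \<Rightarrow> ('a free_group \<Rightarrow> 'h::chilbert_space \<Rightarrow> 'h) set" where
  "unital_pd_functions \<Sigma> =
     {\<phi> \<in> \<Sigma> \<rightarrow>\<^sub>E {T. bounded_operator T}. positive_definite \<Sigma> \<phi> \<and> \<phi> 1 = id}"

definition group_matrix ::
  "('a free_group \<Rightarrow> 'h \<Rightarrow> 'h) \<Rightarrow> 'a free_group set \<Rightarrow> 'a free_group \<Rightarrow> 'a free_group \<Rightarrow> 'h \<Rightarrow> 'h" where
  "group_matrix \<phi> S = (\<lambda>s\<in>S. \<lambda>t\<in>S. \<phi> (inverse s * t))"

context
  fixes le :: "'a free_group \<Rightarrow> 'a free_group \<Rightarrow> bool"
begin

definition D_space ::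
  "'a free_group set \<Rightarrow> ('a free_group \<Rightarrow> 'h::chilbert_space \<Rightarrow> 'h) \<Rightarrow> ('a free_group, 'h) ell2 set" where
  "D_space \<mu> \<psi> =
     (let C = the_clique le \<mu>; s = min_rep le \<mu>; I = C - {s}; A = group_matrix \<psi> I
      in realization_space I A \<ominus> closed_span (realization I A) (C - {1, s}))"

definition R_space ::
  "'a free_group set \<Rightarrow> ('a free_group \<Rightarrow> 'h::chilbert_space \<Rightarrow> 'h) \<Rightarrow> ('a free_group, 'h) ell2 set" where
  "R_space \<mu> \<psi> =
     (let C = the_clique le \<mu>; s = min_rep le \<mu>; I = C - {1}; A = group_matrix \<psi> I
      in realization_space I A \<ominus> closed_span (realization I A) (C - {1, s}))"

text \<open>\<open>V\<^sub>D\<close> and \<open>V\<^sub>R\<close> are the identifications through which the two spaces are viewed as subspaces of the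
  realization space over the whole clique.\<close>

definition gamma ::
  "'a free_group set \<Rightarrow> ('a free_group \<Rightarrow> 'h::chilbert_space \<Rightarrow> 'h) \<Rightarrow>
   ('a free_group, 'h) ell2 \<Rightarrow> ('a free_group, 'h) ell2" where
  "gamma \<mu> \<phi> =
     (let C = the_clique le \<mu>; s = min_rep le \<mu>; A = group_matrix \<phi> C;
          \<psi> = restrict \<phi> (Sigma_upto le (pred_class le \<mu>));
          V\<^sub>D = identification C A (C - {s}); V\<^sub>R = identification C A (C - {1})
      in (\<lambda>x\<in>D_space \<mu> \<psi>.
            inv_into (R_space \<mu> \<psi>) V\<^sub>R (orth_proj (V\<^sub>R ` R_space \<mu> \<psi>) (V\<^sub>D x))))"

definition parameters ::
  "('a free_group \<Rightarrow> 'h::chilbert_space \<Rightarrow> 'h) \<Rightarrow>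
   'a free_group set \<Rightarrow> ('a free_group, 'h) ell2 \<Rightarrow> ('a free_group, 'h) ell2" where
  "parameters \<Phi> = (\<lambda>\<mu>\<in>nontrivial_classes. gamma \<mu> \<Phi>)"

text \<open>The domain and range spaces of the entry at \<open>\<mu>\<close> are those of the function \<open>\<psi>\<close> on \<open>\<Sigma>\<close> of the
  predecessor of \<open>\<mu>\<close> that is determined by the preceding entries. That \<open>\<psi>\<close> exists and is unique
  is part of the correspondence; quantifying universally over \<open>\<psi>\<close> builds neither property into
  the set of sequences.\<close>

definition contraction_sequences ::
  "('a free_group set \<Rightarrow> ('a free_group, 'h::chilbert_space) ell2 \<Rightarrow> ('a free_group, 'h) ell2) set" where
  "contraction_sequences =
     {c \<in> extensional nontrivial_classes. \<forall>\<mu>\<in>nontrivial_classes.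
        \<forall>\<psi>\<in>unital_pd_functions (Sigma_upto le (pred_class le \<mu>)).
          (\<forall>\<mu>'\<in>nontrivial_classes. class_less le \<mu>' \<mu> \<longrightarrow> gamma \<mu>' \<psi> = c \<mu>') \<longrightarrow>
          contraction_between (D_space \<mu> \<psi>) (R_space \<mu> \<psi>) (c \<mu>)}"

end

end

theory Submission
  imports Defs
begin

text \<open>A positive definite function is built one class \<open>\<mu> = {s, s\<^sup>-\<^sup>1}\<close> at a time. The step from \<open>\<Sigma>\<close> of the predecessor
  to \<open>\<Sigma>\<^sub>\<mu>\<close> adds only the value at \<open>s\<^sup>-\<^sup>1\<close>, since the value at \<open>s\<close> is its adjoint, and the theorem holds
  because the admissible values correspond to the contractions from \<open>\<^bold>D\<close> to \<open>\<^bold>R\<close>. This rests on two facts.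

  The first is combinatorial. Any two common neighbours of \<open>1\<close> and \<open>s\<close> in \<open>\<Gamma>\<^sub>\<mu>\<close> are adjacent, and by an edge of
  a smaller class (\<open>common_neighbours_close\<close>); this is where the lexicographic order is used. Hence
  \<open>C\<^sub>\<mu>\<close> consists of \<open>1\<close>, \<open>s\<close> and their common neighbours, \<open>{1, s}\<close> is its only new edge, and every clique with
  a new edge is a translate of a part of \<open>C\<^sub>\<mu>\<close>. So a value at \<open>s\<^sup>-\<^sup>1\<close> is admissible if and only if it
  makes the single matrix \<open>A\<close> over \<open>C\<^sub>\<mu>\<close> positive semidefinite, in which all entries but two adjoint ones are
  given.

  The second is geometric. In a realization of \<open>A\<close> let \<open>S\<^sub>1 = M \<oplus> D\<close> and \<open>S\<^sub>2 = M \<oplus> R\<close> be the spaces for \<open>C\<^sub>\<mu>\<close> without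
  \<open>s\<close> and without \<open>1\<close>, where \<open>M\<close> is the space for \<open>C\<^sub>\<mu>\<close> without both. All inner products between \<open>S\<^sub>1\<close> and \<open>S\<^sub>2\<close> are
  given except those between \<open>D\<close> and \<open>R\<close>, which are described by \<open>\<gamma> = P\<^sub>R|D\<close>. The projection onto \<open>S\<^sub>2\<close> acts
  on \<open>S\<^sub>1\<close> as \<open>W = 1 \<oplus> \<gamma>\<close>, and the missing entry is read off from \<open>W\<close> (\<open>angle_eq_iff\<close>). Conversely, if \<open>\<gamma>\<close> is any
  contraction, so is \<open>W\<close>, and the quadratic form of the completed matrix is
  \<open>|x|\<^sup>2 + 2 Re \<langle>W x, y\<rangle> + |y|\<^sup>2 \<ge> 0\<close> for suitable vectors \<open>x\<close> and \<open>y\<close> (\<open>completion_pos_semidef\<close>).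

  The order of the classes has finite initial segments, so that the steps combine by induction to a
  function on the whole group, which is unique (\<open>determined_by_parameters\<close>, \<open>parameters_surjective\<close>). The spaces
  above are spans in spaces of square-summable families; that these contain a realization of every positive
  semidefinite matrix is shown with the square root of a positive operator (\<open>realization_exists\<close>).\<close>

section \<open>Inner products, orthogonal projections and adjoints\<close>

instance chilbert_space \<subseteq> banach ..

lemma scaleC_zero_right [simp]: "c *\<^sub>C 0 = (0 :: 'a::chilbert_space)"
  using scaleC_add_right[of c 0 "0 :: 'a"] by (metis add_cancel_right_right add_0)

lemma scaleC_diff_right: "c *\<^sub>C (x - y) = c *\<^sub>C x - c *\<^sub>C (y :: 'a::chilbert_space)"
  by (metis add_diff_cancel_right' diff_add_cancel scaleC_add_right)

lemma bounded_linear_scaleC: "bounded_linear (\<lambda>x. c *\<^sub>C x :: 'a::chilbert_space)"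
  by (rule bounded_linear_intro[of _ "norm c"])
    (simp_all add: scaleC_add_right norm_scaleC scaleR_scaleC scaleC_scaleC mult.commute)

lemma cinner_add_right: "cinner x (y + z) = cinner x y + cinner x (z :: 'a::chilbert_space)"
  by (metis cinner_commute cinner_add_left complex_cnj_add)

lemma bounded_bilinear_cinner: "bounded_bilinear (cinner :: 'a::chilbert_space \<Rightarrow> 'a \<Rightarrow> complex)"
proof
  show "\<exists>K. \<forall>a b :: 'a. norm (cinner a b) \<le> norm a * norm b * K"
    by (rule exI[of _ 1]) (simp add: cinner_norm_le)
qed (simp_all add: cinner_add_left cinner_add_right scaleR_scaleC cinner_scaleC_left
      cinner_scaleC_right scaleC_complex_def)

lemmas cinner_zero_left [simp] = bounded_bilinear.zero_left[OF bounded_bilinear_cinner]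
lemmas cinner_zero_right [simp] = bounded_bilinear.zero_right[OF bounded_bilinear_cinner]
lemmas cinner_diff_left = bounded_bilinear.diff_left[OF bounded_bilinear_cinner]
lemmas cinner_diff_right = bounded_bilinear.diff_right[OF bounded_bilinear_cinner]
lemmas cinner_sum_left = bounded_bilinear.sum_left[OF bounded_bilinear_cinner]
lemmas cinner_sum_right = bounded_bilinear.sum_right[OF bounded_bilinear_cinner]
lemmas continuous_on_cinner = bounded_bilinear.continuous_on[OF bounded_bilinear_cinner]

lemma cinner_self: "cinner x x = complex_of_real ((norm (x :: 'a::chilbert_space))\<^sup>2)"
proof -
  have "Im (cinner x x) = 0" by (metis Reals_cnj_iff cinner_commute complex_is_Real_iff)
  thus ?thesis by (simp add: complex_eq_iff power2_norm_eq_inner inner_eq_Re_cinner)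
qed

lemma cinner_self_eq_0 [simp]: "cinner x x = 0 \<longleftrightarrow> x = (0 :: 'a::chilbert_space)"
  by (simp add: cinner_self)

lemma Im_cinner: "Im (cinner x y) = inner x (\<i> *\<^sub>C (y :: 'a::chilbert_space))"
  by (simp add: inner_eq_Re_cinner cinner_scaleC_right)

lemma cinner_eq_of_inner:
  "cinner x y = Complex (inner x y) (inner x (\<i> *\<^sub>C (y :: 'a::chilbert_space)))"
  by (simp add: complex_eq_iff Im_cinner inner_eq_Re_cinner)

lemma cinner_left_cancel:
  assumes "\<And>z. cinner x z = cinner (y :: 'a::chilbert_space) z" shows "x = y"
proof -
  have "cinner (x - y) (x - y) = 0" using assms by (simp add: cinner_diff_left)
  thus ?thesis by simp
qed

lemma cinner_flip: "cinner x y = cinner u v \<Longrightarrow> cinner v u = cinner y (x :: 'a::chilbert_space)"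
  by (metis cinner_commute)

lemma cinner_eq_0_commute: "cinner x y = 0 \<longleftrightarrow> cinner y (x :: 'a::chilbert_space) = 0"
  by (metis cinner_commute complex_cnj_zero)

definition csubspace :: "'a::chilbert_space set \<Rightarrow> bool" where
  "csubspace M \<longleftrightarrow> subspace M \<and> (\<forall>c. \<forall>x\<in>M. c *\<^sub>C x \<in> M)"

lemma csubspaceD:
  assumes "csubspace M"
  shows "subspace M" "0 \<in> M" "x \<in> M \<Longrightarrow> c *\<^sub>C x \<in> M" "x \<in> M \<Longrightarrow> y \<in> M \<Longrightarrow> x + y \<in> M"
    "x \<in> M \<Longrightarrow> y \<in> M \<Longrightarrow> x - y \<in> M"
  using assms by (auto simp: csubspace_def subspace_0 subspace_add subspace_diff)

lemma csubspaceI: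
  assumes "0 \<in> M" "\<And>x y. x \<in> M \<Longrightarrow> y \<in> M \<Longrightarrow> x + y \<in> M" "\<And>c x. x \<in> M \<Longrightarrow> c *\<^sub>C x \<in> M"
  shows "csubspace M"
  using assms by (auto simp: csubspace_def subspace_def scaleR_scaleC)

text \<open>A minimizing sequence for the distance from \<open>x\<close> to \<open>M\<close> is Cauchy by the parallelogram law, and
  perturbing its limit \<open>p\<close> inside \<open>M\<close> shows \<open>x - p \<bottom> M\<close>.\<close>

lemma projection_exists:
  fixes M :: "'a::chilbert_space set"
  assumes "csubspace M" "closed M"
  shows "\<exists>p\<in>M. \<forall>y\<in>M. cinner (x - p) y = 0"
proof -
  note M = csubspaceD[OF assms(1)]
  define d where "d = infdist x M"
  have ne: "M \<noteq> {}" using M(2) by auto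
  have dle: "d \<le> norm (x - y)" if "y \<in> M" for y
    using infdist_le[OF that, of x] by (simp add: d_def dist_norm)
  have d0: "0 \<le> d" by (simp add: d_def infdist_nonneg)
  have "\<exists>y\<in>M. norm (x - y) < d + 1 / real (Suc n)" for n
  proof -
    have "(INF a\<in>M. dist x a) < d + 1 / real (Suc n)"
      using infdist_notempty[OF ne, of x] by (simp add: d_def)
    thus ?thesis 
      using cINF_less_iff[OF ne bdd_belowI2[of M 0 "dist x"]] by (auto simp: dist_norm)
  qed
  then obtain Y where Y: "Y n \<in> M" "norm (x - Y n) < d + 1 / real (Suc n)" for n by metis
  have lim: "(\<lambda>n. (d + 1 / real (Suc n))\<^sup>2 - d\<^sup>2) \<longlonglongrightarrow> (d + 0)\<^sup>2 - d\<^sup>2"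
    by (intro tendsto_intros LIMSEQ_Suc[OF lim_inverse_n'])
  have par: "(norm (Y m - Y n))\<^sup>2 \<le> 2 * ((norm (x - Y m))\<^sup>2 - d\<^sup>2) + 2 * ((norm (x - Y n))\<^sup>2 - d\<^sup>2)" for m n
  proof -
    define a where "a = x - Y m"
    define b where "b = x - Y n"
    have "d \<le> norm (x - (1/2) *\<^sub>R (Y m + Y n))"
      by (rule dle) (intro subspace_scale[OF M(1)] M(4) Y)
    also have "x - (1/2) *\<^sub>R (Y m + Y n) = (1/2) *\<^sub>R ((x + x) - (Y m + Y n))"
      by (simp only: scaleR_diff_right scaleR_half_double)
    also have "(x + x) - (Y m + Y n) = a + b" by (simp add: a_def b_def)
    finally have "2 * d \<le> norm (a + b)" by simp
    hence "(2 * d)\<^sup>2 \<le> (norm (a + b))\<^sup>2" using d0 by (intro power_mono) auto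
    moreover have "(norm (a + b))\<^sup>2 + (norm (a - b))\<^sup>2 = 2 * (norm a)\<^sup>2 + 2 * (norm b)\<^sup>2"
      by (simp add: power2_norm_eq_inner inner_add_left inner_add_right inner_diff_left
          inner_diff_right)
    moreover have "norm (a - b) = norm (Y m - Y n)"
      by (simp add: a_def b_def norm_minus_commute)
    ultimately have "4 * d\<^sup>2 + (norm (Y m - Y n))\<^sup>2 \<le> 2 * (norm a)\<^sup>2 + 2 * (norm b)\<^sup>2"
      by (simp add: power_mult_distrib)
    thus ?thesis by (simp add: a_def b_def)
  qed
  have "Cauchy Y"
  proof (rule metric_CauchyI)
    fix e :: real assume e: "0 < e"
    have "\<forall>\<^sub>F n in sequentially. (d + 1 / real (Suc n))\<^sup>2 - d\<^sup>2 < e\<^sup>2 / 4"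
      by (rule order_tendstoD(2)[OF lim]) (use e in simp)
    then obtain N where N: "\<And>n. n \<ge> N \<Longrightarrow> (d + 1 / real (Suc n))\<^sup>2 - d\<^sup>2 < e\<^sup>2 / 4"
      by (auto simp: eventually_sequentially)
    have b: "(norm (x - Y n))\<^sup>2 - d\<^sup>2 < e\<^sup>2 / 4" if "n \<ge> N" for n
    proof -
      have "(norm (x - Y n))\<^sup>2 \<le> (d + 1 / real (Suc n))\<^sup>2"
        using Y(2)[of n] by (intro power_mono) auto
      thus ?thesis using N[OF that] by linarith
    qed
    have "dist (Y m) (Y n) < e" if "m \<ge> N" "n \<ge> N" for m n
    proof -
      have "(norm (Y m - Y n))\<^sup>2 < e\<^sup>2" 
        using order.strict_trans1[OF par[of m n]
            add_strict_mono[OF mult_strict_left_mono[OF b[OF that(1)], of 2]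
              mult_strict_left_mono[OF b[OF that(2)], of 2]]] by simp
      thus ?thesis using e by (simp add: dist_norm power_less_imp_less_base)
    qed
    thus "\<exists>N. \<forall>m\<ge>N. \<forall>n\<ge>N. dist (Y m) (Y n) < e" by blast
  qed
  then obtain p where p: "Y \<longlonglongrightarrow> p" using Cauchy_convergent convergent_def by blast
  have pM: "p \<in> M" using closed_sequentially[OF assms(2)] Y(1) p by blast
  have "norm (x - p) \<le> d"
  proof (rule LIMSEQ_le)
    show "(\<lambda>n. norm (x - Y n)) \<longlonglongrightarrow> norm (x - p)" by (intro tendsto_intros p)
    have "(\<lambda>n. d + 1 / real (Suc n)) \<longlonglongrightarrow> d + 0"
      by (intro tendsto_intros LIMSEQ_Suc[OF lim_inverse_n'])
    thus "(\<lambda>n. d + 1 / real (Suc n)) \<longlonglongrightarrow> d" by simp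
    show "\<exists>N. \<forall>n\<ge>N. norm (x - Y n) \<le> d + 1 / real (Suc n)" using Y(2) less_imp_le by blast
  qed
  hence min: "norm (x - p) \<le> norm (x - y)" if "y \<in> M" for y using dle[OF that] by linarith
  have re: "inner (x - p) y = 0" if y: "y \<in> M" for y
  proof (cases "y = 0")
    case False
    define t where "t = inner (x - p) y / inner y y"
    have "(norm (x - p))\<^sup>2 \<le> (norm (x - (p + t *\<^sub>R y)))\<^sup>2"
      by (intro power_mono min M(4) pM subspace_scale[OF M(1)] y) auto
    also have "x - (p + t *\<^sub>R y) = (x - p) - t *\<^sub>R y" by simp
    finally have "0 \<le> t\<^sup>2 * inner y y - 2 * t * inner (x - p) y"
      unfolding power2_norm_eq_inner
      by (simp add: inner_diff_left inner_diff_right inner_commute power2_eq_square algebra_simps)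
    also have "\<dots> = - (inner (x - p) y)\<^sup>2 / inner y y"
      using False by (simp add: t_def field_simps power2_eq_square)
    finally show ?thesis using False by (simp add: field_simps zero_le_divide_iff)
  qed simp
  have "cinner (x - p) y = 0" if "y \<in> M" for y
    using re[OF that] re[OF M(3)[OF that]] by (simp add: cinner_eq_of_inner complex_eq_iff)
  thus ?thesis using pM by blast
qed

lemma orth_proj:
  fixes M :: "'a::chilbert_space set"
  assumes "csubspace M" "closed M"
  shows orth_proj_in: "orth_proj M x \<in> M"
    and orth_proj_orth: "y \<in> M \<Longrightarrow> cinner (x - orth_proj M x) y = 0"
    and orth_proj_unique: "\<And>q. q \<in> M \<Longrightarrow> (\<And>y. y \<in> M \<Longrightarrow> cinner (x - q) y = 0) \<Longrightarrow> orth_proj M x = q"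
proof -
  have uniq: "p = q" if "p \<in> M" "q \<in> M" "\<forall>y\<in>M. cinner (x - p) y = 0" "\<forall>y\<in>M. cinner (x - q) y = 0" for p q
  proof -
    have pq: "p - q \<in> M" using that csubspaceD(5)[OF assms(1)] by blast
    have "cinner (p - q) (p - q) = cinner (x - q) (p - q) - cinner (x - p) (p - q)"
      unfolding cinner_diff_left[symmetric] by simp
    also have "\<dots> = 0" using pq that(3,4) by simp
    finally show ?thesis by simp
  qed
  obtain p where p: "p \<in> M" "\<forall>y\<in>M. cinner (x - p) y = 0" using projection_exists[OF assms] by blast
  have eq: "orth_proj M x = p"
    unfolding orth_proj_def by (rule the_equality) (use p uniq in auto)
  show "orth_proj M x \<in> M" using p(1) eq by simp
  show "y \<in> M \<Longrightarrow> cinner (x - orth_proj M x) y = 0" using p(2) eq by simp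
  show "orth_proj M x = q" if "q \<in> M" "\<And>y. y \<in> M \<Longrightarrow> cinner (x - q) y = 0" for q
    using uniq[OF p(1) that(1) p(2)] that(2) eq by simp
qed

lemma pythagoras:
  fixes x y :: "'a::chilbert_space"
  assumes "cinner x y = 0"
  shows "(norm (x + y))\<^sup>2 = (norm x)\<^sup>2 + (norm y)\<^sup>2"
proof -
  have "inner x y = 0" using assms by (simp add: inner_eq_Re_cinner)
  thus ?thesis by (simp add: power2_norm_eq_inner inner_add_left inner_add_right inner_commute)
qed

lemma bounded_operatorD:
  assumes "bounded_operator T"
  shows "bounded_linear T" "T (x + y) = T x + T y" "T (c *\<^sub>C x) = c *\<^sub>C T x" "T 0 = 0"
    "T (x - y) = T x - T y" "T (sum f I) = (\<Sum>i\<in>I. T (f i))" "T (r *\<^sub>R x) = r *\<^sub>R T x"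
  using assms linear_simps[of T] linear_sum[of T f I]
  by (auto simp: bounded_operator_def bounded_linear.linear)

lemma bounded_operatorI:
  fixes T :: "'a::chilbert_space \<Rightarrow> 'b::chilbert_space"
  assumes "\<And>x y. T (x + y) = T x + T y" "\<And>c x. T (c *\<^sub>C x) = c *\<^sub>C T x" "\<And>x. norm (T x) \<le> norm x * K"
  shows "bounded_operator T"
  unfolding bounded_operator_def
  by (intro conjI bounded_linear_intro[of _ K]) (simp_all add: assms scaleR_scaleC)

lemma bounded_operator_compose:
  "bounded_operator S \<Longrightarrow> bounded_operator T \<Longrightarrow> bounded_operator (\<lambda>x. S (T x))"
  by (simp add: bounded_operator_def bounded_linear_compose)

lemma bounded_operator_add:
  "bounded_operator S \<Longrightarrow> bounded_operator T \<Longrightarrow> bounded_operator (\<lambda>x. S x + T x)"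
  by (simp add: bounded_operator_def bounded_linear_add scaleC_add_right)

lemma bounded_operator_sum:
  assumes "\<And>i. i \<in> I \<Longrightarrow> bounded_operator (T i)"
  shows "bounded_operator (\<lambda>x. \<Sum>i\<in>I. T i x)"
proof (cases "finite I")
  case True
  thus ?thesis using assms
  proof induction
    case empty
    show ?case by (simp add: bounded_operator_def)
  qed (simp add: bounded_operator_add)
next
  case False
  thus ?thesis by (simp add: bounded_operator_def)
qed

text \<open>The representing vector of a nonzero functional \<open>f\<close> is the multiple of any \<open>v \<bottom> ker f\<close>
  on which \<open>f\<close> has the right value.\<close>

lemma riesz_representation:
  fixes f :: "'a::chilbert_space \<Rightarrow> complex"
  assumes "bounded_linear f" "\<And>c x. f (c *\<^sub>C x) = c * f x"
  shows "\<exists>v. \<forall>x. f x = cinner x v"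
proof (cases "\<forall>x. f x = 0")
  case True
  thus ?thesis by (intro exI[of _ 0]) simp
next
  case False
  then obtain w where w: "f w \<noteq> 0" by blast
  note f = linear_simps[OF assms(1)]
  define M where "M = {x. f x = 0}"
  have cs: "csubspace M" by (rule csubspaceI) (auto simp: M_def f assms(2))
  have cl: "closed M" unfolding M_def
    by (intro closed_Collect_eq continuous_intros linear_continuous_on assms(1))
  define u where "u = w - orth_proj M w"
  have fu: "f u = f w" using orth_proj_in[OF cs cl, of w] by (simp add: u_def f M_def)
  have u0: "cinner u u \<noteq> 0" using fu w by (auto simp: f)
  have ort: "cinner y u = 0" if "f y = 0" for y
    using orth_proj_orth[OF cs cl, of y w] that by (simp add: M_def u_def cinner_eq_0_commute)
  define v where "v = cnj (f u / cinner u u) *\<^sub>C u"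
  have "f x = cinner x v" for x
  proof -
    have "cinner (x - (f x / f u) *\<^sub>C u) u = 0"
      by (rule ort) (use w fu in \<open>simp add: f assms(2)\<close>)
    hence "cinner x u = f x / f u * cinner u u" by (simp add: cinner_diff_left cinner_scaleC_left)
    thus ?thesis using u0 w fu by (simp add: v_def cinner_scaleC_right)
  qed
  thus ?thesis by blast
qed

lemma adjoint_exists:
  fixes T :: "'a::chilbert_space \<Rightarrow> 'b::chilbert_space"
  assumes T: "bounded_operator T"
  shows "\<exists>T'. bounded_operator T' \<and> (\<forall>x y. cinner (T x) y = cinner x (T' y))"
proof -
  note lin = bounded_operatorD[OF T]
  have "\<exists>v. \<forall>x. cinner (T x) y = cinner x v" for y
  proof (rule riesz_representation)
    show "bounded_linear (\<lambda>x. cinner (T x) y)"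
      using bounded_linear_compose[OF bounded_bilinear.bounded_linear_left[OF bounded_bilinear_cinner] lin(1)]
      by simp
  qed (simp add: lin cinner_scaleC_left)
  then obtain T' where T': "\<And>x y. cinner (T x) y = cinner x (T' y)" by metis
  have T'': "cinner (T' y) x = cinner y (T x)" for x y
    by (metis T' cinner_commute)
  obtain K where K0: "0 \<le> K" and K: "\<And>x. norm (T x) \<le> norm x * K"
    using bounded_linear.nonneg_bounded[OF lin(1)] by blast
  have "bounded_operator T'"
  proof (rule bounded_operatorI)
    show "T' (x + y) = T' x + T' y" for x y
      by (rule cinner_left_cancel) (simp add: T'' cinner_add_left)
    show "T' (c *\<^sub>C x) = c *\<^sub>C T' x" for c x
      by (rule cinner_left_cancel) (simp add: T'' cinner_scaleC_left)
    show "norm (T' y) \<le> norm y * K" for y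
    proof (cases "T' y = 0")
      case True
      thus ?thesis using K0 by simp
    next
      case False
      have "norm (T' y) * norm (T' y) = norm (cinner (T' y) (T' y))"
        by (simp add: cinner_self power2_eq_square norm_mult)
      also have "\<dots> \<le> norm y * norm (T (T' y))" unfolding T'' by (rule cinner_norm_le)
      also have "\<dots> \<le> norm y * (norm (T' y) * K)" by (intro mult_left_mono K) simp
      finally show ?thesis using False by (simp add: algebra_simps)
    qed
  qed
  thus ?thesis using T' by blast
qed

section \<open>Square roots and the existence of realizations\<close>

lemma real_quadratic_form_selfadjoint:
  fixes T :: "'a::chilbert_space \<Rightarrow> 'a"
  assumes T: "bounded_operator T" and re: "\<And>x. cinner (T x) x \<in> \<real>"
  shows "cinner (T x) y = cinner x (T y)"
proof -
  note lin = bounded_operatorD[OF T]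
  have Im0: "Im (cinner (T x) x) = 0" for x using re[of x] by (simp add: complex_is_Real_iff)
  have im: "Im (cinner (T x) y) + Im (cinner (T y) x) = 0" for x y
    using Im0[of "x + y"] Im0[of x] Im0[of y] by (simp add: lin cinner_add_left cinner_add_right)
  have "cinner (T x) y = cnj (cinner (T y) x)"
    using im[of x y] im[of "\<i> *\<^sub>C x" y]
    by (simp add: complex_eq_iff lin cinner_scaleC_left cinner_scaleC_right)
  also have "\<dots> = cinner x (T y)" by (rule cinner_commute[symmetric])
  finally show ?thesis .
qed

text \<open>With \<open>(1 - Y)\<^sup>2 = 1 - X\<close> in mind, \<open>Y\<close> is the limit of the iteration \<open>Y \<mapsto> (X + Y\<^sup>2) / 2\<close> from \<open>0\<close>. Its
  increments are bounded by those of the same iteration for the number \<open>1\<close> in place of \<open>X\<close>, which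
  increases and stays below \<open>1\<close>; this follows from \<open>a\<^sup>2 - b\<^sup>2 = (a - b) a + b (a - b)\<close> for successive
  iterates \<open>a\<close> and \<open>b\<close>.\<close>

lemma contraction_square_root:
  fixes X :: "'a::chilbert_space \<Rightarrow>\<^sub>L 'a"
  assumes nX: "norm X \<le> 1" and sym: "\<And>x y. inner (X x) y = inner x (X y)"
    and hom: "\<And>c x. X (c *\<^sub>C x) = c *\<^sub>C X x"
  shows "\<exists>Y. 2 *\<^sub>R Y = X + (Y o\<^sub>L Y) \<and> (\<forall>x y. inner (Y x) y = inner x (Y y)) \<and>
             (\<forall>c x. Y (c *\<^sub>C x) = c *\<^sub>C Y x)"
proof -
  define Y where "Y = rec_nat 0 (\<lambda>_ Y. (1/2) *\<^sub>R (X + (Y o\<^sub>L Y)))"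
  define t :: "nat \<Rightarrow> real" where "t = rec_nat 0 (\<lambda>_ t. (1/2) * (1 + t * t))"
  have Y0: "Y 0 = 0" and YS: "Y (Suc n) = (1/2) *\<^sub>R (X + (Y n o\<^sub>L Y n))" for n
    by (simp_all add: Y_def)
  have t0: "t 0 = 0" and tS: "t (Suc n) = (1/2) * (1 + t n * t n)" for n
    by (simp_all add: t_def)
  have tb: "0 \<le> t n \<and> t n \<le> 1" for n
  proof (induction n)
    case (Suc n)
    hence "t n * t n \<le> 1 * 1" by (intro mult_mono) auto
    thus ?case by (simp add: tS)
  qed (simp add: t0)
  have tinc: "t n \<le> t (Suc n)" for n
  proof -
    have "t (Suc n) - t n = (1/2) * ((1 - t n) * (1 - t n))" by (simp add: tS algebra_simps)
    also have "\<dots> \<ge> 0" by simp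
    finally show ?thesis by simp
  qed
  have nY: "norm (Y n) \<le> t n" for n
  proof (induction n)
    case (Suc n)
    have "norm (X + (Y n o\<^sub>L Y n)) \<le> 1 + t n * t n"
      by (intro order.trans[OF norm_triangle_ineq] add_mono nX order.trans[OF norm_blinfun_compose]
          mult_mono Suc) (use tb in auto)
    thus ?case by (simp add: YS tS)
  qed (simp add: Y0 t0)
  have inc: "norm (Y (Suc n) - Y n) \<le> t (Suc n) - t n" for n
  proof (induction n)
    case 0
    show ?case using nX by (simp add: YS tS Y0 t0)
  next
    case (Suc n)
    define a where "a = Y (Suc n)"
    define b where "b = Y n"
    have ab: "Y (Suc (Suc n)) - Y (Suc n) = (1/2) *\<^sub>R (((a - b) o\<^sub>L a) + (b o\<^sub>L (a - b)))"
    proof -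
      have "((a - b) o\<^sub>L a) + (b o\<^sub>L (a - b)) = (a o\<^sub>L a) - (b o\<^sub>L b)"
        by (rule blinfun_eqI) (simp add: blinfun.diff_left blinfun.diff_right blinfun.add_left)
      thus ?thesis
        by (simp only: YS[of "Suc n"] a_def[symmetric]) (simp add: YS b_def[symmetric] a_def
            flip: scaleR_diff_right)
    qed
    have "norm (((a - b) o\<^sub>L a) + (b o\<^sub>L (a - b))) \<le>
        (t (Suc n) - t n) * t (Suc n) + t n * (t (Suc n) - t n)"
      unfolding a_def b_def
      by (intro order.trans[OF norm_triangle_ineq] add_mono order.trans[OF norm_blinfun_compose]
          mult_mono Suc nY) (use tb tinc in auto)
    hence "norm (Y (Suc (Suc n)) - Y (Suc n)) \<le>
        ((t (Suc n) - t n) * t (Suc n) + t n * (t (Suc n) - t n)) / 2"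
      unfolding ab by simp
    also have "\<dots> = t (Suc (Suc n)) - t (Suc n)"
      by (simp add: tS[of "Suc n"] tS[of n] field_simps)
    finally show ?case .
  qed
  have incs: "norm (Y (n + k) - Y n) \<le> t (n + k) - t n" for n k
  proof (induction k)
    case (Suc k)
    thus ?case using inc[of "n + k"] norm_triangle_ineq[of "Y (Suc (n + k)) - Y (n + k)" "Y (n + k) - Y n"]
      by simp
  qed simp
  have tle: "t n \<le> t m" if "n \<le> m" for n m by (rule lift_Suc_mono_le[of t, OF tinc that])
  have "Bseq t" by (rule BseqI'[of _ 1]) (use tb in auto)
  hence "convergent t" by (rule Bseq_mono_convergent) (use tle in auto)
  hence Ct: "Cauchy t" by (rule convergent_Cauchy)
  have "Cauchy Y"
  proof (rule metric_CauchyI)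
    fix e :: real assume "0 < e"
    then obtain N where N: "\<And>m n. m \<ge> N \<Longrightarrow> n \<ge> N \<Longrightarrow> dist (t m) (t n) < e"
      using Ct by (meson Cauchy_def)
    have "dist (Y m) (Y n) < e" if mn: "m \<ge> N" "n \<ge> N" for m n
    proof -
      have *: "dist (Y m) (Y n) < e" if "n \<le> m" "m \<ge> N" "n \<ge> N" for m n
        using incs[of n "m - n"] N[of m n] that tle[of n m] by (simp add: dist_norm)
      show ?thesis using *[of n m] *[of m n] mn by (metis dist_commute nle_le)
    qed
    thus "\<exists>N. \<forall>m\<ge>N. \<forall>n\<ge>N. dist (Y m) (Y n) < e" by blast
  qed
  then obtain L where L: "Y \<longlonglongrightarrow> L" using Cauchy_convergent convergent_def by blast
  have Lx: "(\<lambda>n. Y n x) \<longlonglongrightarrow> L x" for x by (intro tendsto_intros L)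
  have YSx: "Y (Suc n) x = (1/2) *\<^sub>R (X x + Y n (Y n x))" for n x
    by (simp add: YS blinfun.scaleR_left blinfun.add_left)
  have YYx: "(\<lambda>n. Y n (Y n x)) \<longlonglongrightarrow> L (L x)" for x by (intro tendsto_intros L)
  have "(\<lambda>n. Y (Suc n) x) \<longlonglongrightarrow> (1/2) *\<^sub>R (X x + L (L x))" for x
    unfolding YSx by (intro tendsto_intros YYx)
  hence Lhalf: "L x = (1/2) *\<^sub>R (X x + L (L x))" for x
    using LIMSEQ_unique[OF LIMSEQ_Suc[OF Lx]] by blast
  have Leq: "2 *\<^sub>R L x = X x + L (L x)" for x by (subst Lhalf) simp
  have symY: "inner (Y n x) y = inner x (Y n y)" for n x y
  proof (induction n arbitrary: x y)
    case (Suc n)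
    thus ?case
      by (simp add: YS blinfun.scaleR_left blinfun.add_left inner_add_left inner_add_right sym)
  qed (simp add: Y0)
  have symL: "inner (L x) y = inner x (L y)" for x y
    by (rule LIMSEQ_unique[of "\<lambda>n. inner (Y n x) y"])
      (intro tendsto_intros Lx, unfold symY, intro tendsto_intros Lx)
  have homY: "Y n (c *\<^sub>C x) = c *\<^sub>C Y n x" for n c x
  proof (induction n arbitrary: x)
    case (Suc n)
    thus ?case
      by (simp add: YS blinfun.scaleR_left blinfun.add_left hom scaleC_add_right scaleR_scaleC
          scaleC_scaleC mult.commute)
  qed (simp add: Y0)
  have homL: "L (c *\<^sub>C x) = c *\<^sub>C L x" for c x
  proof (rule LIMSEQ_unique[of "\<lambda>n. Y n (c *\<^sub>C x)"])
    from bounded_linear.tendsto[OF bounded_linear_scaleC Lx]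
    show "(\<lambda>n. Y n (c *\<^sub>C x)) \<longlonglongrightarrow> c *\<^sub>C L x" by (simp add: homY)
  qed (rule Lx)
  show ?thesis
    by (intro exI[of _ L] conjI blinfun_eqI allI)
      (simp_all add: Leq symL homL blinfun.scaleR_left blinfun.add_left)
qed

text \<open>If \<open>T\<close> is bounded by \<open>M\<close>, then \<open>X = 1 - T / M\<close> is a contraction, and \<open>S\<close> is \<open>\<surd>M\<close> times the square root
  \<open>1 - Y\<close> of \<open>1 - X\<close>.\<close>

lemma positive_operator_factorization:
  fixes T :: "'a::chilbert_space \<Rightarrow> 'a"
  assumes T: "bounded_operator T" and re: "\<And>x. cinner (T x) x \<in> \<real>"
    and pos: "\<And>x. 0 \<le> Re (cinner (T x) x)"
  shows "\<exists>S :: 'a \<Rightarrow> 'a. bounded_operator S \<and> (\<forall>x y. cinner (S x) (S y) = cinner (T x) y)"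
proof -
  note lin = bounded_operatorD[OF T]
  have sa: "inner (T x) y = inner x (T y)" for x y
    using real_quadratic_form_selfadjoint[OF T re, of x y] by (simp add: inner_eq_Re_cinner)
  have pos': "0 \<le> inner (T x) x" for x using pos[of x] by (simp add: inner_eq_Re_cinner)
  obtain M where M: "0 < M" "\<And>x. norm (T x) \<le> norm x * M"
    using bounded_linear.pos_bounded[OF lin(1)] by blast
  have blX: "bounded_linear (\<lambda>x. x - (1/M) *\<^sub>R T x)"
    by (intro bounded_linear_sub bounded_linear_ident bounded_linear_compose[OF bounded_linear_scaleR_right] lin(1))
  define X where "X = Blinfun (\<lambda>x. x - (1/M) *\<^sub>R T x)"
  have X: "blinfun_apply X = (\<lambda>x. x - (1/M) *\<^sub>R T x)"
    by (simp add: X_def bounded_linear_Blinfun_apply blX)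
  have nXx: "norm (X v) \<le> norm v" for v
  proof -
    \<comment> \<open>Positivity of \<open>T\<close> at \<open>v - (1/M) T v\<close> gives \<open>|T v|\<^sup>2 \<le> M \<langle>T v, v\<rangle>\<close>.\<close>
    have "inner (T (T v)) (T v) \<le> norm (T (T v)) * norm (T v)" by (rule norm_cauchy_schwarz)
    also have "\<dots> \<le> (norm (T v) * M) * norm (T v)" by (intro mult_right_mono M) simp
    finally have TT: "inner (T (T v)) (T v) \<le> M * inner (T v) (T v)"
      by (simp add: power2_norm_eq_inner[symmetric] power2_eq_square mult.commute mult.left_commute)
    have "0 \<le> inner (T (v - (1/M) *\<^sub>R T v)) (v - (1/M) *\<^sub>R T v)" by (rule pos')
    also have "\<dots> = inner (T v) v - 2 / M * inner (T v) (T v) + (1/M)\<^sup>2 * inner (T (T v)) (T v)"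
      by (simp add: lin inner_diff_left inner_diff_right sa power2_eq_square algebra_simps)
    also have "\<dots> \<le> inner (T v) v - 2 / M * inner (T v) (T v) + (1/M)\<^sup>2 * (M * inner (T v) (T v))"
      by (intro add_left_mono mult_left_mono TT) simp
    also have "\<dots> = inner (T v) v - inner (T v) (T v) / M"
      using M(1) by (simp add: power2_eq_square field_simps)
    finally have a: "inner (T v) (T v) / M \<le> inner (T v) v" by simp
    have "(norm (X v))\<^sup>2 = inner v v - 2 / M * inner (T v) v + inner (T v) (T v) / M / M"
      using M(1) unfolding X power2_norm_eq_inner
      by (simp add: inner_diff_left inner_diff_right inner_commute power2_eq_square field_simps)
    also have "\<dots> \<le> inner v v - 2 / M * inner (T v) v + inner (T v) v / M"
      by (intro add_left_mono divide_right_mono a) (use M in simp)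
    also have "\<dots> \<le> (norm v)\<^sup>2"
      using pos'[of v] M(1) by (simp add: power2_norm_eq_inner field_simps)
    finally show ?thesis by (simp add: power2_le_iff_abs_le)
  qed
  have "norm X \<le> 1" by (rule norm_blinfun_bound) (use nXx in auto)
  moreover have "inner (X x) y = inner x (X y)" for x y
    by (simp add: X inner_diff_left inner_diff_right sa)
  moreover have "X (c *\<^sub>C x) = c *\<^sub>C X x" for c x
  proof -
    show ?thesis by (simp add: X lin scaleR_scaleC scaleC_scaleC scaleC_diff_right mult.commute)
  qed
  ultimately obtain Y where Y: "2 *\<^sub>R Y = X + (Y o\<^sub>L Y)" "\<And>x y. inner (Y x) y = inner x (Y y)"
      "\<And>c x. Y (c *\<^sub>C x) = c *\<^sub>C Y x"
    using contraction_square_root[of X] by blast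
  define S where "S x = of_real (sqrt M) *\<^sub>C (x - Y x)" for x
  have Yx: "Y (Y x) = 2 *\<^sub>R Y x - X x" for x
    using arg_cong[OF Y(1), of "\<lambda>Z. blinfun_apply Z x"] by (simp add: blinfun.scaleR_left blinfun.add_left)
  have bS: "bounded_operator S"
  proof -
    have "bounded_linear (\<lambda>x. sqrt M *\<^sub>R (x - Y x))"
      by (intro bounded_linear_compose[OF bounded_linear_scaleR_right] bounded_linear_sub
          bounded_linear_ident blinfun.bounded_linear_right)
    thus ?thesis
      by (simp add: bounded_operator_def S_def[abs_def] scaleR_scaleC Y(3) scaleC_diff_right scaleC_scaleC mult.commute)
  qed
  have iS: "inner (S x) (S y) = inner (T x) y" for x y
  proof -
    have "inner (x - Y x) (y - Y y) = inner x y - 2 * inner (Y x) y + inner (Y (Y x)) y"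
      by (simp add: inner_diff_left inner_diff_right Y(2))
    also have "\<dots> = inner (x - X x) y" unfolding Yx by (simp add: inner_diff_left)
    also have "\<dots> = inner (T x) y / M" by (simp add: X)
    finally show ?thesis
      using M(1) unfolding S_def scaleR_scaleC[symmetric] by (simp add: mult.assoc[symmetric])
  qed
  have "cinner (S x) (S y) = cinner (T x) y" for x y
    using iS[of x y] iS[of x "\<i> *\<^sub>C y"]
    by (simp add: cinner_eq_of_inner bounded_operatorD(3)[OF bS])
  thus ?thesis using bS by blast
qed

lift_definition unit_family :: "'i \<Rightarrow> 'h::chilbert_space \<Rightarrow> ('i, 'h) ell2" is "\<lambda>i h j. if j = i then h else 0"
proof -
  fix i :: 'i and h :: 'h
  show "(\<lambda>j. (norm (if j = i then h else 0))\<^sup>2) summable_on UNIV"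
    by (rule summable_on_cong_neutral[THEN iffD1, OF _ _ _ summable_on_finite[of "{i}"]]) auto
qed

lemma cinner_unit_family: "cinner (unit_family i h) f = cinner h (Rep_ell2 f i)"
proof -
  have "cinner (unit_family i h) f = (\<Sum>\<^sub>\<infinity>j. cinner (if j = i then h else 0) (Rep_ell2 f j))"
    by (simp add: cinner_ell2.rep_eq unit_family.rep_eq)
  also have "\<dots> = (\<Sum>\<^sub>\<infinity>j\<in>{i}. cinner h (Rep_ell2 f j))"
    by (rule infsum_cong_neutral) auto
  finally show ?thesis by simp
qed

lemma bounded_operator_unit_family:
  "bounded_operator (unit_family i :: 'h::chilbert_space \<Rightarrow> ('i, 'h) ell2)"
proof (rule bounded_operatorI)
  fix x y :: 'h and c
  show "unit_family i (x + y) = unit_family i x + unit_family i y" by transfer auto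
  show "unit_family i (c *\<^sub>C x) = c *\<^sub>C unit_family i x" by transfer auto
  have "cinner (unit_family i x) (unit_family i x) = cinner x x"
    by (simp add: cinner_unit_family unit_family.rep_eq)
  thus "norm (unit_family i x) \<le> norm x * 1"
    by (simp add: cinner_self del: cinner_self_eq_0 of_real_power)
qed

lemma bounded_operator_coordinate: "bounded_operator (\<lambda>f. Rep_ell2 f i)"
  by (rule bounded_operatorI[of _ 1]) (simp_all add: plus_ell2.rep_eq scaleC_ell2.rep_eq coord_le_norm_ell2)

text \<open>The columns of the square root of the operator with matrix \<open>A\<close> form a realization.\<close>

lemma realization_exists:
  fixes A :: "'i \<Rightarrow> 'i \<Rightarrow> 'h::chilbert_space \<Rightarrow> 'h"
  assumes fin: "finite I" and psd: "pos_semidef I A"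
    and bdd: "\<And>i j. i \<in> I \<Longrightarrow> j \<in> I \<Longrightarrow> bounded_operator (A i j)"
  shows "realizes I A (realization I A)"
proof -
  define T :: "('i, 'h) ell2 \<Rightarrow> ('i, 'h) ell2"
    where "T f = (\<Sum>i\<in>I. \<Sum>j\<in>I. unit_family i (A i j (Rep_ell2 f j)))" for f
  have bT: "bounded_operator T"
    unfolding T_def[abs_def]
    by (intro bounded_operator_sum bounded_operator_compose[OF bounded_operator_unit_family]
        bounded_operator_compose[OF bdd] bounded_operator_coordinate)
  have T: "cinner (T f) g = (\<Sum>i\<in>I. \<Sum>j\<in>I. cinner (A i j (Rep_ell2 f j)) (Rep_ell2 g i))" for f g
    by (simp add: T_def cinner_sum_left cinner_unit_family)
  have "\<exists>S :: ('i, 'h) ell2 \<Rightarrow> ('i, 'h) ell2.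
      bounded_operator S \<and> (\<forall>x y. cinner (S x) (S y) = cinner (T x) y)"
    by (rule positive_operator_factorization[OF bT]) (use psd in \<open>auto simp: T pos_semidef_def\<close>)
  then obtain S :: "('i, 'h) ell2 \<Rightarrow> ('i, 'h) ell2" where S: "bounded_operator S"
      "\<And>x y. cinner (S x) (S y) = cinner (T x) y"
    by blast
  have Tu: "cinner (T (unit_family j g)) (unit_family i h) = cinner (A i j g) h"
    if "i \<in> I" "j \<in> I" for i j g h
  proof -
    have A0: "A k l 0 = 0" if "k \<in> I" "l \<in> I" for k l by (rule bounded_operatorD(4)[OF bdd[OF that]])
    have "(\<Sum>l\<in>I. cinner (A k l (if l = j then g else 0)) (if k = i then h else 0)) =
        (if k = i then cinner (A i j g) h else 0)" if k: "k \<in> I" for k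
    proof -
      have "(\<Sum>l\<in>I. cinner (A k l (if l = j then g else 0)) (if k = i then h else 0)) =
        (\<Sum>l\<in>I. if l = j then (if k = i then cinner (A i j g) h else 0) else 0)"
        by (rule sum.cong) (auto simp: A0 k)
      thus ?thesis using fin \<open>j \<in> I\<close> by simp
    qed
    thus ?thesis using fin \<open>i \<in> I\<close> by (simp add: T unit_family.rep_eq)
  qed
  have "realizes I A (\<lambda>i h. S (unit_family i h))"
    unfolding realizes_def
    using bounded_operator_compose[OF S(1) bounded_operator_unit_family] by (simp add: S(2) Tu)
  thus ?thesis unfolding realization_def by (rule someI[of "realizes I A"])
qed

section \<open>Closed spans and the isometries between them\<close>

lemma csubspace_closure:
  assumes M: "csubspace M" shows "csubspace (closure M)"
proof (rule csubspaceI)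
  show "0 \<in> closure M" using csubspaceD(2)[OF M] closure_subset by blast
  show "x + y \<in> closure M" if xy: "x \<in> closure M" "y \<in> closure M" for x y
  proof -
    obtain X where X: "\<forall>n. X n \<in> M" "X \<longlonglongrightarrow> x" using xy(1) unfolding closure_sequential by blast
    obtain Y where Y: "\<forall>n. Y n \<in> M" "Y \<longlonglongrightarrow> y" using xy(2) unfolding closure_sequential by blast
    have "(\<lambda>n. X n + Y n) \<longlonglongrightarrow> x + y" by (intro tendsto_intros X Y)
    moreover have "\<forall>n. X n + Y n \<in> M" using X(1) Y(1) csubspaceD(4)[OF M] by simp
    ultimately show ?thesis unfolding closure_sequential by (intro exI conjI)
  qed
  show "c *\<^sub>C x \<in> closure M" if x: "x \<in> closure M" for c x
  proof -
    have "(\<lambda>x. c *\<^sub>C x) ` closure M \<subseteq> closure ((\<lambda>x. c *\<^sub>C x) ` M)"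
      by (rule closure_bounded_linear_image_subset[OF bounded_linear_scaleC])
    also have "\<dots> \<subseteq> closure M" by (intro closure_mono) (use csubspaceD(3)[OF M] in auto)
    finally show ?thesis using x by blast
  qed
qed

lemma csubspace_span_ranges:
  assumes "\<And>j. j \<in> J \<Longrightarrow> bounded_operator (\<omega> j)"
  shows "csubspace (span (\<Union>j\<in>J. range (\<omega> j)))"
proof -
  have "c *\<^sub>C x \<in> span (\<Union>j\<in>J. range (\<omega> j))" if x: "x \<in> span (\<Union>j\<in>J. range (\<omega> j))" for c x
    using x
  proof (induction rule: span_induct_alt)
    case base
    show ?case by (simp add: span_zero)
  next
    case (step r y z)
    then obtain j h where j: "j \<in> J" "y = \<omega> j h" by auto
    have "c *\<^sub>C (r *\<^sub>R y) = r *\<^sub>R \<omega> j (c *\<^sub>C h)"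
      using j(2) bounded_operatorD(3)[OF assms[OF j(1)]]
      by (simp add: scaleR_scaleC scaleC_scaleC mult.commute)
    also have "\<dots> \<in> span (\<Union>j\<in>J. range (\<omega> j))" by (intro span_scale span_base) (use j in auto)
    finally show ?case using step by (simp add: scaleC_add_right span_add)
  qed
  thus ?thesis by (simp add: csubspace_def)
qed

lemma closed_span:
  assumes "\<And>j. j \<in> J \<Longrightarrow> bounded_operator (\<omega> j)"
  shows csubspace_closed_span: "csubspace (closed_span \<omega> J)"
    and closed_closed_span: "closed (closed_span \<omega> J)"
  using csubspace_closure[OF csubspace_span_ranges[OF assms]] by (auto simp: closed_span_def)

lemma closed_span_base: "j \<in> J \<Longrightarrow> \<omega> j h \<in> closed_span \<omega> J"
  unfolding closed_span_def by (intro closure_subset[THEN subsetD] span_base) auto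

lemma closed_span_mono: "J \<subseteq> K \<Longrightarrow> closed_span \<omega> J \<subseteq> closed_span \<omega> K"
  unfolding closed_span_def by (intro closure_mono span_mono) auto

definition cont_linear_on :: "'a::real_normed_vector set \<Rightarrow> ('a \<Rightarrow> 'b::real_normed_vector) \<Rightarrow> bool" where
  "cont_linear_on S F \<longleftrightarrow> (\<forall>x\<in>S. \<forall>y\<in>S. F (x + y) = F x + F y) \<and>
     (\<forall>r. \<forall>x\<in>S. F (r *\<^sub>R x) = r *\<^sub>R F x) \<and> continuous_on S F"

lemma cont_linear_onD:
  assumes "cont_linear_on S F"
  shows "x \<in> S \<Longrightarrow> y \<in> S \<Longrightarrow> F (x + y) = F x + F y" "x \<in> S \<Longrightarrow> F (r *\<^sub>R x) = r *\<^sub>R F x"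
    "continuous_on S F"
  using assms by (auto simp: cont_linear_on_def)

lemma cont_linear_on_subset: "cont_linear_on S F \<Longrightarrow> T \<subseteq> S \<Longrightarrow> cont_linear_on T F"
  by (auto simp: cont_linear_on_def subset_iff intro: continuous_on_subset[of S])

lemma cont_linear_on_id: "cont_linear_on S (\<lambda>x. x)"
  by (auto simp: cont_linear_on_def)

lemma cont_linear_on_const_0: "cont_linear_on S (\<lambda>x. 0)"
  by (auto simp: cont_linear_on_def)

lemma cont_linear_on_cinner:
  assumes "cont_linear_on S F"
  shows cont_linear_on_cinner_left: "cont_linear_on S (\<lambda>x. cinner (F x) z)"
    and cont_linear_on_cinner_right: "cont_linear_on S (\<lambda>x. cinner z (F x))"
  using assms
  by (auto simp: cont_linear_on_def cinner_add_left cinner_add_right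
      bounded_bilinear.scaleR_left[OF bounded_bilinear_cinner]
      bounded_bilinear.scaleR_right[OF bounded_bilinear_cinner]
      intro!: continuous_on_cinner continuous_on_const)

text \<open>Every identity between bounded linear maps on a realization space is checked on the vectors
  \<open>\<omega>\<^sub>j h\<close> through the following principle.\<close>

lemma eq_on_closed_span:
  fixes F G :: "'k::chilbert_space \<Rightarrow> 'b::real_normed_vector"
  assumes \<omega>: "\<And>j. j \<in> J \<Longrightarrow> bounded_operator (\<omega> j)"
    and FG: "cont_linear_on (closed_span \<omega> J) F" "cont_linear_on (closed_span \<omega> J) G"
    and gen: "\<And>j h. j \<in> J \<Longrightarrow> F (\<omega> j h) = G (\<omega> j h)"
    and x: "x \<in> closed_span \<omega> J"
  shows "F x = G x"
proof -
  let ?S = "closed_span \<omega> J"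
  note S = csubspaceD[OF csubspace_closed_span[OF \<omega>]]
  define N where "N = ?S \<inter> (\<lambda>x. F x - G x) -` {0}"
  have "closed N" unfolding N_def
    by (intro continuous_closed_preimage continuous_on_diff cont_linear_onD(3) FG closed_closed_span \<omega>) auto
  moreover have "subspace N"
    using cont_linear_onD(2)[OF FG(1), of 0 0] cont_linear_onD(2)[OF FG(2), of 0 0]
    by (intro subspaceI)
      (auto simp: N_def S cont_linear_onD(1,2)[OF FG(1)] cont_linear_onD(1,2)[OF FG(2)] subspace_scale)
  moreover have "(\<Union>j\<in>J. range (\<omega> j)) \<subseteq> N"
    by (auto simp: N_def gen intro: closed_span_base)
  ultimately have "?S \<subseteq> N"
    unfolding closed_span_def by (intro closure_minimal span_minimal)
  thus ?thesis using x by (auto simp: N_def)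
qed

lemma linear_betweenD:
  assumes "linear_between X Y V"
  shows "x \<in> X \<Longrightarrow> V x \<in> Y" "x \<in> X \<Longrightarrow> y \<in> X \<Longrightarrow> V (x + y) = V x + V y"
    "x \<in> X \<Longrightarrow> V (c *\<^sub>C x) = c *\<^sub>C V x" "x \<in> X \<Longrightarrow> V (r *\<^sub>R x) = r *\<^sub>R V x" "V \<in> extensional X"
  using assms by (auto simp: linear_between_def PiE_def scaleR_scaleC)

lemma linear_between_0:
  assumes "linear_between X Y V" "0 \<in> X" shows "V 0 = 0"
  using linear_betweenD(4)[OF assms, of 0] by simp

lemma linear_between_diff:
  assumes V: "linear_between X Y V" and X: "csubspace X" and "x \<in> X" "y \<in> X"
  shows "V (x - y) = V x - V y"
proof -
  have "V ((x - y) + y) = V (x - y) + V y"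
    by (rule linear_betweenD(2)[OF V]) (use assms csubspaceD(5)[OF X] in auto)
  thus ?thesis by simp
qed

lemma cont_linear_on_contraction:
  assumes V: "contraction_between X Y V" and X: "csubspace X"
  shows "cont_linear_on X V"
proof -
  have lin: "linear_between X Y V" using V by (simp add: contraction_between_def)
  have "norm (V x - V y) \<le> norm (x - y)" if "x \<in> X" "y \<in> X" for x y
    using V that csubspaceD(5)[OF X that]
    by (simp add: contraction_between_def flip: linear_between_diff[OF lin X])
  hence "1-lipschitz_on X V" by (intro lipschitz_onI) (auto simp: dist_norm)
  hence "continuous_on X V" by (rule lipschitz_on_continuous_on)
  thus ?thesis using linear_betweenD[OF lin] by (auto simp: cont_linear_on_def)
qed

lemma isometry_betweenD:
  assumes "isometry_between X Y V"
  shows "linear_between X Y V" "contraction_between X Y V" "x \<in> X \<Longrightarrow> norm (V x) = norm x"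
  using assms by (auto simp: isometry_between_def contraction_between_def)

lemma cinner_isometry:
  assumes V: "isometry_between X Y V" and X: "csubspace X" and xy: "x \<in> X" "y \<in> X"
  shows "cinner (V x) (V y) = cinner x y"
proof -
  note lin = isometry_betweenD(1)[OF V] 
  have *: "inner (V x) (V y) = inner x y" if "x \<in> X" "y \<in> X" for x y
    using isometry_betweenD(3)[OF V] that
      isometry_betweenD(3)[OF V csubspaceD(4)[OF X that], unfolded linear_betweenD(2)[OF lin that]]
    by (simp add: dot_norm)
  show ?thesis
    using *[OF xy] *[OF xy(1) csubspaceD(3)[OF X xy(2), of \<i>]] xy
    by (simp add: cinner_eq_of_inner linear_betweenD(3)[OF lin])
qed

lemma isometry_image_closed:
  assumes V: "isometry_between X Y V" and X: "csubspace X" and Z: "Z \<subseteq> X" "csubspace Z" "closed Z"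
  shows "csubspace (V ` Z)" "closed (V ` Z)"
proof -
  note lin = isometry_betweenD(1)[OF V] 
  note l = linear_betweenD[OF lin]
  show "csubspace (V ` Z)"
  proof (rule csubspaceI)
    show "0 \<in> V ` Z"
      by (rule image_eqI[of _ _ 0]) (simp_all add: linear_between_0[OF lin] csubspaceD(2) X Z(2))
    show "x + y \<in> V ` Z" if xy: "x \<in> V ` Z" "y \<in> V ` Z" for x y
    proof -
      obtain u v where "u \<in> Z" "v \<in> Z" "x = V u" "y = V v" using xy by blast
      moreover from this have "V (u + v) = V u + V v" using l(2) Z(1) by auto
      ultimately show ?thesis using csubspaceD(4)[OF Z(2)] by (intro image_eqI[of _ _ "u + v"]) auto
    qed
    show "c *\<^sub>C x \<in> V ` Z" if x: "x \<in> V ` Z" for c x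
    proof -
      obtain u where "u \<in> Z" "x = V u" using x by blast
      moreover from this have "V (c *\<^sub>C u) = c *\<^sub>C V u" using l(3) Z(1) by auto
      ultimately show ?thesis using csubspaceD(3)[OF Z(2)] by (intro image_eqI[of _ _ "c *\<^sub>C u"]) auto
    qed
  qed
  show "closed (V ` Z)"
    unfolding closed_sequential_limits
  proof (intro allI impI, elim conjE)
    fix f l assume f: "\<forall>n. f n \<in> V ` Z" and fl: "f \<longlonglongrightarrow> l"
    have "\<forall>n. \<exists>z. z \<in> Z \<and> f n = V z" using f by blast
    then obtain z where z: "\<And>n. z n \<in> Z" "\<And>n. f n = V (z n)" by metis
    have d: "dist (z m) (z n) = dist (f m) (f n)" for m n
      using isometry_betweenD(3)[OF V csubspaceD(5)[OF X, of "z m" "z n"]] z(1) Z(1)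
        linear_between_diff[OF lin X, of "z m" "z n"] by (auto simp: dist_norm z(2) subset_iff)
    have "Cauchy z" using LIMSEQ_imp_Cauchy[OF fl] by (simp add: Cauchy_def d)
    then obtain y where y: "z \<longlonglongrightarrow> y" using Cauchy_convergent convergent_def by blast
    have yZ: "y \<in> Z" using closed_sequentially[OF Z(3)] z(1) y by blast
    have "(\<lambda>n. V (z n)) \<longlonglongrightarrow> V y"
      by (rule continuous_on_tendsto_compose[OF
            cont_linear_onD(3)[OF cont_linear_on_contraction[OF isometry_betweenD(2)[OF V] X]] y])
        (use z(1) yZ Z(1) in \<open>auto intro!: eventuallyI\<close>)
    moreover have "(\<lambda>n. V (z n)) = f" by (simp add: z(2) fun_eq_iff)
    ultimately have "l = V y" using fl LIMSEQ_unique by blast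
    thus "l \<in> V ` Z" using yZ by blast
  qed
qed

lemma span_ranges:
  assumes fin: "finite J" and \<omega>: "\<And>j. j \<in> J \<Longrightarrow> bounded_operator (\<omega> j)"
  shows "span (\<Union>j\<in>J. range (\<omega> j)) = range (\<lambda>p. \<Sum>j\<in>J. \<omega> j (p j))"
proof
  note lin = bounded_operatorD[OF \<omega>]
  have "subspace (range (\<lambda>p. \<Sum>j\<in>J. \<omega> j (p j)))"
  proof (rule subspaceI)
    have "(\<Sum>j\<in>J. \<omega> j 0) = 0" by (rule sum.neutral) (simp add: lin)
    thus "0 \<in> range (\<lambda>p. \<Sum>j\<in>J. \<omega> j (p j))" by (intro image_eqI[of _ _ "\<lambda>_. 0"]) auto
    show "x + y \<in> range (\<lambda>p. \<Sum>j\<in>J. \<omega> j (p j))"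
      if xy: "x \<in> range (\<lambda>p. \<Sum>j\<in>J. \<omega> j (p j))" "y \<in> range (\<lambda>p. \<Sum>j\<in>J. \<omega> j (p j))" for x y
    proof -
      obtain p q where "x = (\<Sum>j\<in>J. \<omega> j (p j))" "y = (\<Sum>j\<in>J. \<omega> j (q j))" using xy by blast
      hence "x + y = (\<Sum>j\<in>J. \<omega> j (p j + q j))" by (simp add: lin flip: sum.distrib)
      thus ?thesis by (intro image_eqI[of _ _ "\<lambda>j. p j + q j"]) auto
    qed
    show "r *\<^sub>R x \<in> range (\<lambda>p. \<Sum>j\<in>J. \<omega> j (p j))" if "x \<in> range (\<lambda>p. \<Sum>j\<in>J. \<omega> j (p j))" for r x
    proof -
      obtain p where "x = (\<Sum>j\<in>J. \<omega> j (p j))" using \<open>x \<in> _\<close> by blast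
      hence "r *\<^sub>R x = (\<Sum>j\<in>J. \<omega> j (r *\<^sub>R p j))" by (simp add: lin scaleR_sum_right)
      thus ?thesis by (intro image_eqI[of _ _ "\<lambda>j. r *\<^sub>R p j"]) auto
    qed
  qed
  moreover have "(\<Union>j\<in>J. range (\<omega> j)) \<subseteq> range (\<lambda>p. \<Sum>j\<in>J. \<omega> j (p j))"
  proof clarify
    fix i h assume i: "i \<in> J"
    have "(\<Sum>j\<in>J. \<omega> j (if j = i then h else 0)) = (\<Sum>j\<in>J. if j = i then \<omega> i h else 0)"
      by (rule sum.cong) (auto simp: lin)
    also have "\<dots> = \<omega> i h" using fin i by simp
    finally show "\<omega> i h \<in> range (\<lambda>p. \<Sum>j\<in>J. \<omega> j (p j))"
      by (intro image_eqI[of _ _ "\<lambda>j. if j = i then h else 0"]) auto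
  qed
  ultimately show "span (\<Union>j\<in>J. range (\<omega> j)) \<subseteq> range (\<lambda>p. \<Sum>j\<in>J. \<omega> j (p j))"
    by (rule span_minimal[rotated])
  show "range (\<lambda>p. \<Sum>j\<in>J. \<omega> j (p j)) \<subseteq> span (\<Union>j\<in>J. range (\<omega> j))"
  proof clarify
    show "(\<Sum>j\<in>J. \<omega> j (p j)) \<in> span (\<Union>j\<in>J. range (\<omega> j))" for p
      by (intro span_sum span_base) auto
  qed
qed

text \<open>By equality of the Gram matrices, the finite sums \<open>\<Sum> \<omega>\<^sub>j (p\<^sub>j)\<close> and \<open>\<Sum> \<omega>'\<^sub>j (p\<^sub>j)\<close> have the same norm. Hence the
  second depends only on the first, and the assignment extends to the closures by uniform continuity.\<close>

lemma isometry_exists: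
  fixes \<omega> :: "'i \<Rightarrow> 'h::chilbert_space \<Rightarrow> 'k::chilbert_space"
    and \<omega>' :: "'i \<Rightarrow> 'h \<Rightarrow> 'l::chilbert_space"
  assumes fin: "finite J"
    and \<omega>: "\<And>j. j \<in> J \<Longrightarrow> bounded_operator (\<omega> j)" and \<omega>': "\<And>j. j \<in> J \<Longrightarrow> bounded_operator (\<omega>' j)"
    and gram: "\<And>i j g h. i \<in> J \<Longrightarrow> j \<in> J \<Longrightarrow> cinner (\<omega> j g) (\<omega> i h) = cinner (\<omega>' j g) (\<omega>' i h)"
  shows "\<exists>V. isometry_between (closed_span \<omega> J) (closed_span \<omega>' J) V \<and> (\<forall>j\<in>J. \<forall>h. V (\<omega> j h) = \<omega>' j h)"
proof -
  define a where "a p = (\<Sum>j\<in>J. \<omega> j (p j))" for p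
  define b where "b p = (\<Sum>j\<in>J. \<omega>' j (p j))" for p
  have Sa: "closed_span \<omega> J = closure (range a)" and Sb: "closed_span \<omega>' J = closure (range b)"
    by (simp_all add: closed_span_def span_ranges[OF fin \<omega>] span_ranges[OF fin \<omega>'] a_def[abs_def] b_def[abs_def])
  have lin: "a (\<lambda>j. p j + q j) = a p + a q" "b (\<lambda>j. p j + q j) = b p + b q"
    "a (\<lambda>j. p j - q j) = a p - a q" "b (\<lambda>j. p j - q j) = b p - b q" for p q
    by (simp_all add: a_def b_def bounded_operatorD[OF \<omega>] bounded_operatorD[OF \<omega>'] sum.distrib sum_subtractf)
  have sc: "c *\<^sub>C sum f J = (\<Sum>j\<in>J. c *\<^sub>C f j)" for c and f :: "'i \<Rightarrow> 'z::chilbert_space"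
    using fin by (induction J) (simp_all add: scaleC_add_right)
  have hom: "a (\<lambda>j. c *\<^sub>C p j) = c *\<^sub>C a p" "b (\<lambda>j. c *\<^sub>C p j) = c *\<^sub>C b p" for c p
    by (simp_all add: a_def b_def bounded_operatorD[OF \<omega>] bounded_operatorD[OF \<omega>'] sc)
  have "cinner (a p) (a p) = cinner (b p) (b p)" for p
    unfolding a_def b_def cinner_sum_left cinner_sum_right by (intro sum.cong refl gram)
  hence nrm: "norm (a p) = norm (b p)" for p
    by (simp add: cinner_self del: of_real_power cinner_self_eq_0)
  have dst: "dist (a p) (a q) = dist (b p) (b q)" for p q
    using nrm[of "\<lambda>j. p j - q j"] by (simp add: dist_norm lin)
  define V0 where "V0 x = b (SOME p. a p = x)" for x
  have V0: "V0 (a p) = b p" for p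
  proof -
    have "a (SOME q. a q = a p) = a p" by (rule someI[of _ p]) simp
    hence "dist (V0 (a p)) (b p) = 0" using dst[of "SOME q. a q = a p" p] by (simp add: V0_def)
    thus ?thesis by simp
  qed
  have "uniformly_continuous_on (range a) V0"
    unfolding uniformly_continuous_on_def by (auto simp: V0 dst)
  then obtain V where V: "uniformly_continuous_on (closure (range a)) V" "\<And>x. x \<in> range a \<Longrightarrow> V0 x = V x"
    by (rule uniformly_continuous_on_extension_on_closure) (rule that)
  have Va: "V (a p) = b p" for p using V(2)[of "a p"] by (simp add: V0)
  have lim: "(\<lambda>n. b (p n)) \<longlonglongrightarrow> V x" if "(\<lambda>n. a (p n)) \<longlonglongrightarrow> x" "x \<in> closure (range a)" for p x
    using continuous_on_tendsto_compose[OF uniformly_continuous_imp_continuous[OF V(1)] that]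
    by (simp add: Va closure_subset[THEN subsetD])
  have seq: "\<exists>p. (\<lambda>n. a (p n)) \<longlonglongrightarrow> x" if x: "x \<in> closure (range a)" for x
  proof -
    obtain X where X: "\<forall>n. X n \<in> range a" "X \<longlonglongrightarrow> x"
      using x[unfolded closure_sequential] by blast
    have "\<forall>n. \<exists>p. X n = a p" using X(1) by blast
    from choice[OF this] obtain p where "\<forall>n. X n = a (p n)" by (elim exE)
    hence "X = (\<lambda>n. a (p n))" by blast
    thus ?thesis using X(2) by blast
  qed
  have "csubspace (closed_span \<omega> J)" by (rule csubspace_closed_span[OF \<omega>])
  note S = csubspaceD[OF this[unfolded Sa]]
  let ?V = "restrict V (closed_span \<omega> J)"
  have cl: "V x \<in> closure (range b)" "norm (V x) = norm x" if x: "x \<in> closure (range a)" for x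
  proof -
    obtain p where p: "(\<lambda>n. a (p n)) \<longlonglongrightarrow> x" using seq[OF x] by blast
    show "V x \<in> closure (range b)"
      unfolding closure_sequential using lim[OF p x] by (intro exI[of _ "\<lambda>n. b (p n)"]) auto
    show "norm (V x) = norm x"
      using LIMSEQ_unique[OF tendsto_norm[OF lim[OF p x]]] tendsto_norm[OF p] by (simp add: nrm)
  qed
  have "V (x + y) = V x + V y" if x: "x \<in> closure (range a)" and y: "y \<in> closure (range a)" for x y
  proof -
    obtain p where p: "(\<lambda>n. a (p n)) \<longlonglongrightarrow> x" using seq[OF x] by blast
    obtain q where q: "(\<lambda>n. a (q n)) \<longlonglongrightarrow> y" using seq[OF y] by blast
    have "(\<lambda>n. a (\<lambda>j. p n j + q n j)) \<longlonglongrightarrow> x + y" unfolding lin by (intro tendsto_intros p q)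
    from lim[OF this S(4)[OF x y]] have "(\<lambda>n. b (p n) + b (q n)) \<longlonglongrightarrow> V (x + y)" by (simp add: lin)
    moreover have "(\<lambda>n. b (p n) + b (q n)) \<longlonglongrightarrow> V x + V y" by (intro tendsto_intros lim p q x y)
    ultimately show ?thesis by (rule LIMSEQ_unique)
  qed
  moreover have "V (c *\<^sub>C x) = c *\<^sub>C V x" if x: "x \<in> closure (range a)" for c x
  proof -
    obtain p where p: "(\<lambda>n. a (p n)) \<longlonglongrightarrow> x" using seq[OF x] by blast
    have "(\<lambda>n. a (\<lambda>j. c *\<^sub>C p n j)) \<longlonglongrightarrow> c *\<^sub>C x" unfolding hom by (intro bounded_linear.tendsto[OF bounded_linear_scaleC] p)
    from lim[OF this S(3)[OF x]] have "(\<lambda>n. c *\<^sub>C b (p n)) \<longlonglongrightarrow> V (c *\<^sub>C x)" by (simp add: hom)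
    moreover have "(\<lambda>n. c *\<^sub>C b (p n)) \<longlonglongrightarrow> c *\<^sub>C V x" by (intro bounded_linear.tendsto[OF bounded_linear_scaleC] lim p x)
    ultimately show ?thesis by (rule LIMSEQ_unique)
  qed
  ultimately have "isometry_between (closed_span \<omega> J) (closed_span \<omega>' J) ?V"
    using cl S by (auto simp: isometry_between_def linear_between_def Sa Sb)
  moreover have "?V (\<omega> j h) = \<omega>' j h" if j: "j \<in> J" for j h
  proof -
    have "a (\<lambda>i. if i = j then h else 0) = (\<Sum>i\<in>J. if i = j then \<omega> j h else 0)"
      unfolding a_def by (rule sum.cong) (auto simp: bounded_operatorD[OF \<omega>])
    moreover have "b (\<lambda>i. if i = j then h else 0) = (\<Sum>i\<in>J. if i = j then \<omega>' j h else 0)"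
      unfolding b_def by (rule sum.cong) (auto simp: bounded_operatorD[OF \<omega>'])
    ultimately have "V (\<omega> j h) = \<omega>' j h" using Va[of "\<lambda>i. if i = j then h else 0"] fin j by simp
    thus ?thesis using closed_span_base[OF j, of \<omega> h] by simp
  qed
  ultimately show ?thesis by blast
qed

lemma pos_semidef_cong:
  assumes "\<And>i j. i \<in> I \<Longrightarrow> j \<in> I \<Longrightarrow> A i j = B i j"
  shows "pos_semidef I A \<longleftrightarrow> pos_semidef I B"
  using assms by (simp add: pos_semidef_def cong: sum.cong)

lemma pos_semidef_subset:
  assumes fin: "finite I" and psd: "pos_semidef I A" and J: "J \<subseteq> I"
    and bdd: "\<And>i j. i \<in> I \<Longrightarrow> j \<in> I \<Longrightarrow> bounded_operator (A i j)"
  shows "pos_semidef J A"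
  unfolding pos_semidef_def
proof
  fix h :: "'a \<Rightarrow> 'b"
  define k where "k i = (if i \<in> J then h i else 0)" for i
  have "(\<Sum>i\<in>I. \<Sum>j\<in>I. cinner (A i j (k j)) (k i)) = (\<Sum>i\<in>J. \<Sum>j\<in>I. cinner (A i j (k j)) (k i))"
    by (rule sum.mono_neutral_right[OF fin J]) (simp add: k_def)
  also have "\<dots> = (\<Sum>i\<in>J. \<Sum>j\<in>J. cinner (A i j (k j)) (k i))"
    by (intro sum.cong refl sum.mono_neutral_right[OF fin J])
      (use J in \<open>auto simp: k_def bounded_operatorD(4)[OF bdd]\<close>)
  also have "\<dots> = (\<Sum>i\<in>J. \<Sum>j\<in>J. cinner (A i j (h j)) (h i))"
    by (intro sum.cong refl) (simp add: k_def)
  finally show "(\<Sum>i\<in>J. \<Sum>j\<in>J. cinner (A i j (h j)) (h i)) \<in> \<real> \<and>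
      0 \<le> Re (\<Sum>i\<in>J. \<Sum>j\<in>J. cinner (A i j (h j)) (h i))"
    using psd[unfolded pos_semidef_def, rule_format, of k] by simp
qed

lemma submatrix_realization:
  assumes fin: "finite I" and psd: "pos_semidef I A" and J: "J \<subseteq> I"
    and bdd: "\<And>i j. i \<in> I \<Longrightarrow> j \<in> I \<Longrightarrow> bounded_operator (A i j)"
  shows "realizes J (submatrix A J) (realization J (submatrix A J))"
proof (rule realization_exists)
  show "finite J" using J fin finite_subset by blast
  have "pos_semidef J (submatrix A J) \<longleftrightarrow> pos_semidef J A"
    by (rule pos_semidef_cong) (simp add: submatrix_def)
  thus "pos_semidef J (submatrix A J)" using pos_semidef_subset[OF assms] by simp
  show "bounded_operator (submatrix A J i j)" if "i \<in> J" "j \<in> J" for i j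
    using bdd that J by (auto simp: submatrix_def)
qed

lemma identification:
  assumes fin: "finite I" and psd: "pos_semidef I A" and J: "J \<subseteq> I"
    and bdd: "\<And>i j. i \<in> I \<Longrightarrow> j \<in> I \<Longrightarrow> bounded_operator (A i j)"
  shows "isometry_between (realization_space J (submatrix A J)) (realization_space I A) (identification I A J)"
    and "j \<in> J \<Longrightarrow> identification I A J (realization J (submatrix A J) j h) = realization I A j h"
proof -
  let ?\<omega> = "realization J (submatrix A J)" and ?\<omega>' = "realization I A"
  let ?P = "\<lambda>V. isometry_between (realization_space J (submatrix A J)) (realization_space I A) V \<and>
     (\<forall>j\<in>J. \<forall>h. V (?\<omega> j h) = ?\<omega>' j h)"
  have \<omega>: "realizes J (submatrix A J) ?\<omega>" by (rule submatrix_realization[OF assms])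
  have \<omega>': "realizes I A ?\<omega>'" by (rule realization_exists[OF fin psd bdd])
  have b: "bounded_operator (?\<omega> j)" if "j \<in> J" for j using \<omega> that by (simp add: realizes_def)
  have b': "bounded_operator (?\<omega>' j)" if "j \<in> J" for j using \<omega>' that J by (auto simp: realizes_def)
  have gram: "cinner (?\<omega> j g) (?\<omega> i h) = cinner (?\<omega>' j g) (?\<omega>' i h)" if "i \<in> J" "j \<in> J" for i j g h
    using \<omega> \<omega>' that J by (auto simp: realizes_def submatrix_def subset_iff)
  have "\<exists>V. isometry_between (closed_span ?\<omega> J) (closed_span ?\<omega>' J) V \<and> (\<forall>j\<in>J. \<forall>h. V (?\<omega> j h) = ?\<omega>' j h)"
    by (rule isometry_exists[OF finite_subset[OF J fin]]) (simp_all add: b b' gram)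
  then obtain V where
    V: "isometry_between (closed_span ?\<omega> J) (closed_span ?\<omega>' J) V" "\<forall>j\<in>J. \<forall>h. V (?\<omega> j h) = ?\<omega>' j h"
    by (elim exE conjE)
  have "?P V"
    using V closed_span_mono[OF J, of ?\<omega>']
    by (auto simp: realization_space_def isometry_between_def linear_between_def PiE_iff)
  moreover have "V' = V" if V': "?P V'" for V'
  proof (rule extensionalityI)
    let ?S = "closed_span ?\<omega> J"
    have cs: "csubspace ?S" by (rule csubspace_closed_span[OF b])
    have iso: "isometry_between ?S (realization_space I A) V'"
      using V' by (simp add: realization_space_def)
    show "V' \<in> extensional ?S" "V \<in> extensional ?S"
      using linear_betweenD(5)[OF isometry_betweenD(1)[OF iso]]
        linear_betweenD(5)[OF isometry_betweenD(1)[OF V(1)]] by auto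
    show "V' x = V x" if "x \<in> ?S" for x
      by (rule eq_on_closed_span[OF b cont_linear_on_contraction[OF isometry_betweenD(2)[OF iso] cs]
            cont_linear_on_contraction[OF isometry_betweenD(2)[OF V(1)] cs] _ that])
        (use V' V(2) in auto)
  qed
  ultimately have "?P (identification I A J)"
    unfolding identification_def by (rule theI[of ?P])
  thus "isometry_between (realization_space J (submatrix A J)) (realization_space I A) (identification I A J)"
    "j \<in> J \<Longrightarrow> identification I A J (realization J (submatrix A J) j h) = realization I A j h"
    by auto
qed

section \<open>Completing a positive semidefinite matrix with one missing entry\<close>

lemma ominus:
  assumes "csubspace X" "closed X"
  shows csubspace_ominus: "csubspace (X \<ominus> Y)" and closed_ominus: "closed (X \<ominus> Y)"
proof -
  note X = csubspaceD[OF assms(1)]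
  show "csubspace (X \<ominus> Y)"
    by (rule csubspaceI) (auto simp: ominus_def X cinner_add_left cinner_scaleC_left)
  have "X \<ominus> Y = X \<inter> (\<Inter>y\<in>Y. {x. cinner x y = 0})" by (auto simp: ominus_def)
  moreover have "closed {x. cinner x y = 0}" for y :: 'a
    by (intro closed_Collect_eq continuous_on_cinner continuous_intros)
  ultimately show "closed (X \<ominus> Y)" using assms(2) by (auto intro!: closed_Int closed_INT)
qed

text \<open>The rows and columns are indexed by \<open>C\<close>, and the entries at \<open>(e, s)\<close> and \<open>(s, e)\<close> are missing.
  The family \<open>\<omega>\<^sub>1\<close> realizes the submatrix without \<open>s\<close>, and \<open>\<omega>\<^sub>2\<close> the one without \<open>e\<close>.\<close>

locale missing_entry =
  fixes C :: "'i set" and e s :: 'i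
    and \<omega>\<^sub>1 :: "'i \<Rightarrow> 'h::chilbert_space \<Rightarrow> 'k::chilbert_space"
    and \<omega>\<^sub>2 :: "'i \<Rightarrow> 'h \<Rightarrow> 'l::chilbert_space"
  assumes finite_C: "finite C" and e_in: "e \<in> C" and s_in: "s \<in> C" and e_neq_s: "e \<noteq> s"
    and \<omega>\<^sub>1: "\<And>j. j \<in> C - {s} \<Longrightarrow> bounded_operator (\<omega>\<^sub>1 j)"
    and \<omega>\<^sub>2: "\<And>j. j \<in> C - {e} \<Longrightarrow> bounded_operator (\<omega>\<^sub>2 j)"
    and gram: "\<And>i j g h. i \<in> C - {e, s} \<Longrightarrow> j \<in> C - {e, s} \<Longrightarrow>
       cinner (\<omega>\<^sub>1 j g) (\<omega>\<^sub>1 i h) = cinner (\<omega>\<^sub>2 j g) (\<omega>\<^sub>2 i h)"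
begin

definition "S\<^sub>1 = closed_span \<omega>\<^sub>1 (C - {s})"
definition "S\<^sub>2 = closed_span \<omega>\<^sub>2 (C - {e})"
definition "M\<^sub>1 = closed_span \<omega>\<^sub>1 (C - {e, s})"
definition "M\<^sub>2 = closed_span \<omega>\<^sub>2 (C - {e, s})"
definition "D = S\<^sub>1 \<ominus> M\<^sub>1"
definition "R = S\<^sub>2 \<ominus> M\<^sub>2"

definition "U = (SOME V. isometry_between M\<^sub>1 M\<^sub>2 V \<and> (\<forall>j\<in>C - {e, s}. \<forall>h. V (\<omega>\<^sub>1 j h) = \<omega>\<^sub>2 j h))"

text \<open>\<open>M\<^sub>1\<close> and \<open>M\<^sub>2\<close> are two copies of one space \<open>M\<close>. Relative to \<open>S\<^sub>1 = M \<oplus> D\<close> and \<open>S\<^sub>2 = M \<oplus> R\<close>, this is the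
  operator \<open>1 \<oplus> c\<close>. When \<open>S\<^sub>1\<close> and \<open>S\<^sub>2\<close> lie in a common space, it is the compression to \<open>S\<^sub>1 \<rightarrow> S\<^sub>2\<close> of the
  orthogonal projection onto \<open>S\<^sub>2\<close>.\<close>

definition "W c = (\<lambda>x\<in>S\<^sub>1. U (orth_proj M\<^sub>1 x) + c (x - orth_proj M\<^sub>1 x))"

lemma subspaces:
  shows cS1: "csubspace S\<^sub>1" "closed S\<^sub>1" and cS2: "csubspace S\<^sub>2" "closed S\<^sub>2"
    and cM1: "csubspace M\<^sub>1" "closed M\<^sub>1" and cM2: "csubspace M\<^sub>2" "closed M\<^sub>2"
    and cD: "csubspace D" "closed D" and cR: "csubspace R" "closed R"
proof -
  show *: "csubspace S\<^sub>1" "closed S\<^sub>1" "csubspace S\<^sub>2" "closed S\<^sub>2" "csubspace M\<^sub>1" "closed M\<^sub>1"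
      "csubspace M\<^sub>2" "closed M\<^sub>2"
    unfolding S\<^sub>1_def S\<^sub>2_def M\<^sub>1_def M\<^sub>2_def
    by (rule csubspace_closed_span closed_closed_span; simp add: \<omega>\<^sub>1 \<omega>\<^sub>2)+
  show "csubspace D" "closed D" "csubspace R" "closed R"
    unfolding D_def R_def by (intro csubspace_ominus closed_ominus *)+
qed

lemma M_subset: "M\<^sub>1 \<subseteq> S\<^sub>1" "M\<^sub>2 \<subseteq> S\<^sub>2"
  unfolding S\<^sub>1_def S\<^sub>2_def M\<^sub>1_def M\<^sub>2_def by (rule closed_span_mono; blast)+

lemma U: "isometry_between M\<^sub>1 M\<^sub>2 U" "j \<in> C - {e, s} \<Longrightarrow> U (\<omega>\<^sub>1 j h) = \<omega>\<^sub>2 j h"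
proof -
  have "\<exists>V. isometry_between M\<^sub>1 M\<^sub>2 V \<and> (\<forall>j\<in>C - {e, s}. \<forall>h. V (\<omega>\<^sub>1 j h) = \<omega>\<^sub>2 j h)"
    unfolding M\<^sub>1_def M\<^sub>2_def
    by (rule isometry_exists) (use finite_C \<omega>\<^sub>1 \<omega>\<^sub>2 gram in auto)
  from someI_ex[OF this] show "isometry_between M\<^sub>1 M\<^sub>2 U" "j \<in> C - {e, s} \<Longrightarrow> U (\<omega>\<^sub>1 j h) = \<omega>\<^sub>2 j h"
    by (auto simp: U_def)
qed

lemma U_linear: "linear_between M\<^sub>1 M\<^sub>2 U"
  by (rule isometry_betweenD(1)[OF U(1)])

lemma gen_in:
  "j \<in> C - {s} \<Longrightarrow> \<omega>\<^sub>1 j h \<in> S\<^sub>1" "j \<in> C - {e} \<Longrightarrow> \<omega>\<^sub>2 j h \<in> S\<^sub>2"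
  "j \<in> C - {e, s} \<Longrightarrow> \<omega>\<^sub>1 j h \<in> M\<^sub>1" "j \<in> C - {e, s} \<Longrightarrow> \<omega>\<^sub>2 j h \<in> M\<^sub>2"
  by (auto simp: S\<^sub>1_def S\<^sub>2_def M\<^sub>1_def M\<^sub>2_def intro!: closed_span_base)

lemma proj1:
  shows "orth_proj M\<^sub>1 x \<in> M\<^sub>1" "x \<in> S\<^sub>1 \<Longrightarrow> x - orth_proj M\<^sub>1 x \<in> D"
  using orth_proj_in[OF cM1] orth_proj_orth[OF cM1] csubspaceD(5)[OF cS1(1)] M_subset(1)
  by (auto simp: D_def ominus_def subset_iff)

lemma proj2:
  shows "orth_proj M\<^sub>2 x \<in> M\<^sub>2" "x \<in> S\<^sub>2 \<Longrightarrow> x - orth_proj M\<^sub>2 x \<in> R"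
  using orth_proj_in[OF cM2] orth_proj_orth[OF cM2] csubspaceD(5)[OF cS2(1)] M_subset(2)
  by (auto simp: R_def ominus_def subset_iff)

lemma proj1_add: "orth_proj M\<^sub>1 (x + y) = orth_proj M\<^sub>1 x + orth_proj M\<^sub>1 y"
proof (rule orth_proj_unique[OF cM1])
  show "orth_proj M\<^sub>1 x + orth_proj M\<^sub>1 y \<in> M\<^sub>1" by (intro csubspaceD(4)[OF cM1(1)] proj1)
  have "x + y - (orth_proj M\<^sub>1 x + orth_proj M\<^sub>1 y) = (x - orth_proj M\<^sub>1 x) + (y - orth_proj M\<^sub>1 y)"
    by simp
  thus "cinner (x + y - (orth_proj M\<^sub>1 x + orth_proj M\<^sub>1 y)) z = 0" if "z \<in> M\<^sub>1" for z
    using that orth_proj_orth[OF cM1] by (simp only: cinner_add_left) simp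
qed

lemma proj1_scaleC: "orth_proj M\<^sub>1 (c *\<^sub>C x) = c *\<^sub>C orth_proj M\<^sub>1 x"
proof (rule orth_proj_unique[OF cM1])
  show "c *\<^sub>C orth_proj M\<^sub>1 x \<in> M\<^sub>1" by (intro csubspaceD(3)[OF cM1(1)] proj1)
  show "cinner (c *\<^sub>C x - c *\<^sub>C orth_proj M\<^sub>1 x) z = 0" if "z \<in> M\<^sub>1" for z
    using that orth_proj_orth[OF cM1] by (simp flip: scaleC_diff_right add: cinner_scaleC_left)
qed

lemma W_contraction:
  assumes c: "contraction_between D R c"
  shows "contraction_between S\<^sub>1 S\<^sub>2 (W c)"
proof -
  have cl: "linear_between D R c" using c by (simp add: contraction_between_def)
  note C = linear_betweenD[OF cl] and U' = linear_betweenD[OF U_linear]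
  note S1 = csubspaceD[OF cS1(1)]
  have "W c x \<in> S\<^sub>2" if "x \<in> S\<^sub>1" for x
    using U'(1)[OF proj1(1), of x] C(1)[OF proj1(2)[OF that]] M_subset(2) csubspaceD(4)[OF cS2(1)] that
    by (auto simp: W_def R_def ominus_def)
  moreover have "W c (x + y) = W c x + W c y" if xy: "x \<in> S\<^sub>1" "y \<in> S\<^sub>1" for x y
  proof -
    have "x + y - orth_proj M\<^sub>1 (x + y) = (x - orth_proj M\<^sub>1 x) + (y - orth_proj M\<^sub>1 y)"
      by (simp add: proj1_add)
    hence "c (x + y - orth_proj M\<^sub>1 (x + y)) = c (x - orth_proj M\<^sub>1 x) + c (y - orth_proj M\<^sub>1 y)"
      by (simp only: C(2)[OF proj1(2)[OF xy(1)] proj1(2)[OF xy(2)]])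
    thus ?thesis using xy S1(4)[OF xy]
      by (simp add: W_def) (simp add: proj1_add U'(2)[OF proj1(1) proj1(1)])
  qed
  moreover have "W c (a *\<^sub>C x) = a *\<^sub>C W c x" if x: "x \<in> S\<^sub>1" for a x
    using x S1(3)[OF x]
    by (simp add: W_def proj1_scaleC C(3)[OF proj1(2)] U'(3)[OF proj1(1)] scaleC_add_right
        flip: scaleC_diff_right)
  moreover have "norm (W c x) \<le> norm x" if x: "x \<in> S\<^sub>1" for x
  proof -
    let ?p = "orth_proj M\<^sub>1 x"
    have "cinner (c (x - ?p)) (U ?p) = 0"
      using C(1)[OF proj1(2)[OF x]] U'(1)[OF proj1(1), of x] by (auto simp: R_def ominus_def)
    hence "cinner (U ?p) (c (x - ?p)) = 0" by (simp add: cinner_eq_0_commute)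
    hence "(norm (W c x))\<^sup>2 = (norm (U ?p))\<^sup>2 + (norm (c (x - ?p)))\<^sup>2"
      using x by (simp add: W_def pythagoras)
    also have "\<dots> \<le> (norm ?p)\<^sup>2 + (norm (x - ?p))\<^sup>2"
      using isometry_betweenD(3)[OF U(1) proj1(1)] c proj1(2)[OF x]
      by (intro add_mono power_mono) (auto simp: contraction_between_def)
    also have "\<dots> = (norm (?p + (x - ?p)))\<^sup>2"
      by (rule pythagoras[symmetric])
        (use orth_proj_orth[OF cM1 proj1(1)] in \<open>simp add: cinner_eq_0_commute\<close>)
    finally show ?thesis by (simp add: power2_le_iff_abs_le)
  qed
  ultimately show ?thesis by (simp add: contraction_between_def linear_between_def W_def)
qed

lemma W_M1:
  assumes c: "linear_between D R c" and x: "x \<in> M\<^sub>1"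
  shows "W c x = U x"
proof -
  have "orth_proj M\<^sub>1 x = x" by (rule orth_proj_unique[OF cM1 x]) simp
  thus ?thesis
    using linear_between_0[OF c csubspaceD(2)[OF cD(1)]] x M_subset(1) by (auto simp: W_def)
qed

lemma W_D:
  assumes x: "x \<in> D" shows "W c x = c x"
proof -
  have "orth_proj M\<^sub>1 x = 0"
    by (rule orth_proj_unique[OF cM1 csubspaceD(2)[OF cM1(1)]]) (use x in \<open>auto simp: D_def ominus_def\<close>)
  thus ?thesis
    using linear_between_0[OF U_linear csubspaceD(2)[OF cM1(1)]] x by (auto simp: W_def D_def ominus_def)
qed

lemma W_gen: "linear_between D R c \<Longrightarrow> j \<in> C - {e, s} \<Longrightarrow> W c (\<omega>\<^sub>1 j h) = \<omega>\<^sub>2 j h"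
  by (simp add: W_M1 gen_in U)

lemma cinner_W_gen:
  assumes c: "linear_between D R c" and x: "x \<in> S\<^sub>1" and j: "j \<in> C - {e, s}"
  shows "cinner (W c x) (\<omega>\<^sub>2 j h) = cinner x (\<omega>\<^sub>1 j h)"
proof -
  let ?p = "orth_proj M\<^sub>1 x"
  have "cinner (c (x - ?p)) (\<omega>\<^sub>2 j h) = 0"
    using linear_betweenD(1)[OF c proj1(2)[OF x]] gen_in(4)[OF j] by (auto simp: R_def ominus_def)
  moreover have "cinner (U ?p) (\<omega>\<^sub>2 j h) = cinner ?p (\<omega>\<^sub>1 j h)"
    using cinner_isometry[OF U(1) cM1(1) proj1(1) gen_in(3)[OF j]] by (simp add: U(2)[OF j])
  moreover have "cinner (x - ?p) (\<omega>\<^sub>1 j h) = 0" by (rule orth_proj_orth[OF cM1 gen_in(3)[OF j]])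
  ultimately show ?thesis using x by (simp add: W_def cinner_add_left cinner_diff_left)
qed

text \<open>With \<open>x\<close> the vector that collects the components of \<open>h\<close> outside \<open>s\<close> and \<open>y = \<omega>\<^sub>2 s (h s)\<close>, the quadratic form
  at \<open>h\<close> is \<open>|x|\<^sup>2 + 2 Re \<langle>W c x, y\<rangle> + |y|\<^sup>2\<close>.\<close>

lemma completion_pos_semidef:
  assumes c: "contraction_between D R c"
    and A1: "\<And>i j g h. i \<in> C - {s} \<Longrightarrow> j \<in> C - {s} \<Longrightarrow> cinner (A i j g) h = cinner (\<omega>\<^sub>1 j g) (\<omega>\<^sub>1 i h)"
    and As: "\<And>j g h. j \<in> C - {s} \<Longrightarrow> cinner (A s j g) h = cinner (W c (\<omega>\<^sub>1 j g)) (\<omega>\<^sub>2 s h)"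
      "\<And>j g h. j \<in> C - {s} \<Longrightarrow> cinner (A j s g) h = cinner (\<omega>\<^sub>2 s g) (W c (\<omega>\<^sub>1 j h))"
      "\<And>g h. cinner (A s s g) h = cinner (\<omega>\<^sub>2 s g) (\<omega>\<^sub>2 s h)"
  shows "pos_semidef C A"
  unfolding pos_semidef_def
proof
  fix h
  have W: "contraction_between S\<^sub>1 S\<^sub>2 (W c)" by (rule W_contraction[OF c])
  hence Wl: "linear_between S\<^sub>1 S\<^sub>2 (W c)" by (simp add: contraction_between_def)
  define x where "x = (\<Sum>j\<in>C - {s}. \<omega>\<^sub>1 j (h j))"
  define y where "y = \<omega>\<^sub>2 s (h s)"
  have sum_in: "(\<Sum>j\<in>F. \<omega>\<^sub>1 j (h j)) \<in> S\<^sub>1 \<and> W c (\<Sum>j\<in>F. \<omega>\<^sub>1 j (h j)) = (\<Sum>j\<in>F. W c (\<omega>\<^sub>1 j (h j)))"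
    if "finite F" "F \<subseteq> C - {s}" for F
    using that
  proof (induction F)
    case empty
    show ?case using csubspaceD(2)[OF cS1(1)] linear_between_0[OF Wl] by simp
  next
    case (insert j F)
    thus ?case using gen_in(1)[of j "h j"] csubspaceD(4)[OF cS1(1)] linear_betweenD(2)[OF Wl] by simp
  qed
  have x: "x \<in> S\<^sub>1" and Wx: "W c x = (\<Sum>j\<in>C - {s}. W c (\<omega>\<^sub>1 j (h j)))"
    using sum_in[of "C - {s}"] finite_C by (auto simp: x_def)
  have split: "(\<Sum>i\<in>C. f i) = f s + (\<Sum>i\<in>C - {s}. f i)" for f :: "'i \<Rightarrow> complex"
    using finite_C s_in by (simp add: sum.remove)
  have "(\<Sum>i\<in>C. \<Sum>j\<in>C. cinner (A i j (h j)) (h i)) =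
      cinner y y + (\<Sum>j\<in>C - {s}. cinner (W c (\<omega>\<^sub>1 j (h j))) y) +
      (\<Sum>i\<in>C - {s}. cinner y (W c (\<omega>\<^sub>1 i (h i))) + (\<Sum>j\<in>C - {s}. cinner (\<omega>\<^sub>1 j (h j)) (\<omega>\<^sub>1 i (h i))))"
    unfolding split y_def by (intro arg_cong2[of _ _ _ _ "(+)"] sum.cong refl A1 As)
  also have "\<dots> = cinner y y + cinner (W c x) y + (cinner y (W c x) + cinner x x)"
  proof -
    have "cinner x x = (\<Sum>i\<in>C - {s}. \<Sum>j\<in>C - {s}. cinner (\<omega>\<^sub>1 j (h j)) (\<omega>\<^sub>1 i (h i)))"
      unfolding x_def by (subst cinner_sum_right) (simp only: cinner_sum_left)
    thus ?thesis unfolding Wx by (simp only: sum.distrib cinner_sum_left cinner_sum_right)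
  qed
  also have "cinner y (W c x) = cnj (cinner (W c x) y)" by (rule cinner_commute)
  finally have eq: "(\<Sum>i\<in>C. \<Sum>j\<in>C. cinner (A i j (h j)) (h i)) =
      of_real ((norm y)\<^sup>2 + 2 * Re (cinner (W c x) y) + (norm x)\<^sup>2)"
    by (simp add: cinner_self complex_eq_iff)
  have "norm (cinner (W c x) y) \<le> norm x * norm y"
    using cinner_norm_le[of "W c x" y] W x mult_right_mono[of "norm (W c x)" "norm x" "norm y"]
    by (auto simp: contraction_between_def)
  hence "- (norm x * norm y) \<le> Re (cinner (W c x) y)"
    using abs_Re_le_cmod[of "cinner (W c x) y"] by linarith
  moreover have "0 \<le> (norm y)\<^sup>2 - 2 * (norm x * norm y) + (norm x)\<^sup>2"
    using zero_le_power2[of "norm x - norm y"] by (simp add: power2_diff)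
  ultimately have "0 \<le> (norm y)\<^sup>2 + 2 * Re (cinner (W c x) y) + (norm x)\<^sup>2" by linarith
  thus "(\<Sum>i\<in>C. \<Sum>j\<in>C. cinner (A i j (h j)) (h i)) \<in> \<real> \<and>
      0 \<le> Re (\<Sum>i\<in>C. \<Sum>j\<in>C. cinner (A i j (h j)) (h i))"
    unfolding eq by (simp only: Reals_of_real Re_complex_of_real simp_thms)
qed

end

text \<open>Here the whole matrix is given, realized by \<open>\<omega>\<close> in \<open>Y\<close>, and \<open>V\<^sub>1\<close> and \<open>V\<^sub>2\<close> embed the realization spaces
  of the two submatrices into \<open>Y\<close>.\<close>

locale completed_entry = missing_entry C e s \<omega>\<^sub>1 \<omega>\<^sub>2
  for C :: "'i set" and e s :: 'i
    and \<omega>\<^sub>1 :: "'i \<Rightarrow> 'h::chilbert_space \<Rightarrow> 'k::chilbert_space"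
    and \<omega>\<^sub>2 :: "'i \<Rightarrow> 'h \<Rightarrow> 'l::chilbert_space" +
  fixes \<omega> :: "'i \<Rightarrow> 'h \<Rightarrow> 'm::chilbert_space" and Y V\<^sub>1 V\<^sub>2
  assumes V\<^sub>1: "isometry_between S\<^sub>1 Y V\<^sub>1" "\<And>j h. j \<in> C - {s} \<Longrightarrow> V\<^sub>1 (\<omega>\<^sub>1 j h) = \<omega> j h"
    and V\<^sub>2: "isometry_between S\<^sub>2 Y V\<^sub>2" "\<And>j h. j \<in> C - {e} \<Longrightarrow> V\<^sub>2 (\<omega>\<^sub>2 j h) = \<omega> j h"
begin

lemma cont_linear_V:
  "cont_linear_on S\<^sub>1 V\<^sub>1" "cont_linear_on S\<^sub>2 V\<^sub>2"
  using cont_linear_on_contraction[OF isometry_betweenD(2)[OF V\<^sub>1(1)] cS1(1)]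
    cont_linear_on_contraction[OF isometry_betweenD(2)[OF V\<^sub>2(1)] cS2(1)] by auto

text \<open>Relative to the decompositions \<open>S\<^sub>1 = M \<oplus> D\<close> and \<open>S\<^sub>2 = M \<oplus> R\<close> inside the common space, the spaces \<open>D\<close> and \<open>M\<close>
  are orthogonal, as are \<open>M\<close> and \<open>R\<close>, so that the angle between \<open>D\<close> and \<open>R\<close> is the only freedom.\<close>

lemma compression_eq_W:
  assumes c: "contraction_between D R c"
    and cDR: "\<And>x y. x \<in> D \<Longrightarrow> y \<in> R \<Longrightarrow> cinner (c x) y = cinner (V\<^sub>1 x) (V\<^sub>2 y)"
    and x: "x \<in> S\<^sub>1" and y: "y \<in> S\<^sub>2"
  shows "cinner (V\<^sub>1 x) (V\<^sub>2 y) = cinner (W c x) y"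
proof -
  have cl: "linear_between D R c" using c by (simp add: contraction_between_def)
  have K1: "bounded_operator (\<omega>\<^sub>1 j)" and K2: "bounded_operator (\<omega>\<^sub>2 j)" if "j \<in> C - {e, s}" for j
    using that \<omega>\<^sub>1 \<omega>\<^sub>2 by auto
  have DM: "cinner (V\<^sub>1 d) (V\<^sub>2 k) = 0" if d: "d \<in> D" and k: "k \<in> M\<^sub>2" for d k
  proof (rule eq_on_closed_span[OF K2 cont_linear_on_cinner_right cont_linear_on_const_0 _ k[unfolded M\<^sub>2_def]])
    show "cont_linear_on (closed_span \<omega>\<^sub>2 (C - {e, s})) V\<^sub>2"
      by (rule cont_linear_on_subset[OF cont_linear_V(2)]) (use M_subset in \<open>simp add: M\<^sub>2_def\<close>)
    fix j h assume j: "j \<in> C - {e, s}"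
    have "cinner (V\<^sub>1 d) (V\<^sub>2 (\<omega>\<^sub>2 j h)) = cinner (V\<^sub>1 d) (V\<^sub>1 (\<omega>\<^sub>1 j h))"
      using j by (simp add: V\<^sub>1(2) V\<^sub>2(2))
    also have "\<dots> = cinner d (\<omega>\<^sub>1 j h)"
      by (rule cinner_isometry[OF V\<^sub>1(1) cS1(1)]) (use d j gen_in(1) in \<open>auto simp: D_def ominus_def\<close>)
    also have "\<dots> = 0" using d gen_in(3)[OF j] by (auto simp: D_def ominus_def)
    finally show "cinner (V\<^sub>1 d) (V\<^sub>2 (\<omega>\<^sub>2 j h)) = 0" .
  qed
  have MS: "cinner (V\<^sub>1 k) (V\<^sub>2 y) = cinner (U k) y" if k: "k \<in> M\<^sub>1" for k
  proof (rule eq_on_closed_span[OF K1 cont_linear_on_cinner_left cont_linear_on_cinner_left _ k[unfolded M\<^sub>1_def]])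
    show "cont_linear_on (closed_span \<omega>\<^sub>1 (C - {e, s})) V\<^sub>1"
      by (rule cont_linear_on_subset[OF cont_linear_V(1)]) (use M_subset in \<open>simp add: M\<^sub>1_def\<close>)
    show "cont_linear_on (closed_span \<omega>\<^sub>1 (C - {e, s})) U"
      using cont_linear_on_contraction[OF isometry_betweenD(2)[OF U(1)] cM1(1)] by (simp add: M\<^sub>1_def)
    fix j h assume j: "j \<in> C - {e, s}"
    have "cinner (V\<^sub>1 (\<omega>\<^sub>1 j h)) (V\<^sub>2 y) = cinner (V\<^sub>2 (\<omega>\<^sub>2 j h)) (V\<^sub>2 y)"
      using j by (simp add: V\<^sub>1(2) V\<^sub>2(2))
    also have "\<dots> = cinner (\<omega>\<^sub>2 j h) y"
      by (rule cinner_isometry[OF V\<^sub>2(1) cS2(1) _ y]) (use j gen_in(2) in auto)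
    finally show "cinner (V\<^sub>1 (\<omega>\<^sub>1 j h)) (V\<^sub>2 y) = cinner (U (\<omega>\<^sub>1 j h)) y" using j by (simp add: U(2))
  qed
  define k where "k = orth_proj M\<^sub>1 x"
  define d where "d = x - k"
  define k' where "k' = orth_proj M\<^sub>2 y"
  define r where "r = y - k'"
  have k: "k \<in> M\<^sub>1" "d \<in> D" and k': "k' \<in> M\<^sub>2" "r \<in> R"
    using proj1[of x] proj2[of y] x y by (simp_all add: k_def d_def k'_def r_def)
  have in1: "k \<in> S\<^sub>1" "d \<in> S\<^sub>1" "k' \<in> S\<^sub>2" "r \<in> S\<^sub>2"
    using k k' M_subset by (auto simp: D_def R_def ominus_def)
  have "V\<^sub>1 x = V\<^sub>1 k + V\<^sub>1 d" "V\<^sub>2 y = V\<^sub>2 k' + V\<^sub>2 r"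
    using cont_linear_onD(1)[OF cont_linear_V(1) in1(1,2)] cont_linear_onD(1)[OF cont_linear_V(2) in1(3,4)]
    by (simp_all add: d_def r_def)
  hence "cinner (V\<^sub>1 x) (V\<^sub>2 y) = cinner (V\<^sub>1 k) (V\<^sub>2 y) + (cinner (V\<^sub>1 d) (V\<^sub>2 k') + cinner (V\<^sub>1 d) (V\<^sub>2 r))"
    by (simp only: cinner_add_left cinner_add_right) simp
  also have "\<dots> = cinner (U k) y + cinner (c d) r"
    using DM[OF k(2) k'(1)] MS[OF k(1)] cDR[OF k(2) k'(2)] by simp
  also have "cinner (c d) r = cinner (c d) y"
    using linear_betweenD(1)[OF cl k(2)] k'(1) by (simp add: r_def cinner_diff_right R_def ominus_def)
  finally show ?thesis using x by (simp add: W_def cinner_add_left k_def d_def)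
qed

text \<open>The parameter \<open>\<gamma>\<close> of the completed matrix: the projection onto the copy of \<open>R\<close> in \<open>Y\<close>, restricted to the
  copy of \<open>D\<close>.\<close>

definition "angle = (\<lambda>x\<in>D. inv_into R V\<^sub>2 (orth_proj (V\<^sub>2 ` R) (V\<^sub>1 x)))"

lemma R_subset: "R \<subseteq> S\<^sub>2" and D_subset: "D \<subseteq> S\<^sub>1"
  by (auto simp: R_def D_def ominus_def)

lemma angle_in: "x \<in> D \<Longrightarrow> angle x \<in> R"
  and cinner_angle: "x \<in> D \<Longrightarrow> y \<in> R \<Longrightarrow> cinner (angle x) y = cinner (V\<^sub>1 x) (V\<^sub>2 y)"
proof -
  assume x: "x \<in> D"
  note VR = isometry_image_closed[OF V\<^sub>2(1) cS2(1) R_subset cR]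
  define p where "p = orth_proj (V\<^sub>2 ` R) (V\<^sub>1 x)"
  have p: "p \<in> V\<^sub>2 ` R" unfolding p_def by (rule orth_proj_in[OF VR])
  have ax: "angle x = inv_into R V\<^sub>2 p" using x by (simp add: angle_def p_def)
  show aR: "angle x \<in> R" unfolding ax by (rule inv_into_into[OF p])
  assume y: "y \<in> R"
  have "cinner (angle x) y = cinner (V\<^sub>2 (angle x)) (V\<^sub>2 y)"
    by (rule cinner_isometry[OF V\<^sub>2(1) cS2(1), symmetric]) (use aR y R_subset in auto)
  also have "V\<^sub>2 (angle x) = p" unfolding ax by (rule f_inv_into_f[OF p])
  also have "cinner p (V\<^sub>2 y) = cinner (V\<^sub>1 x) (V\<^sub>2 y)"
    using orth_proj_orth[OF VR, of "V\<^sub>2 y" "V\<^sub>1 x"] y by (simp add: p_def cinner_diff_left)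
  finally show "cinner (angle x) y = cinner (V\<^sub>1 x) (V\<^sub>2 y)" .
qed

lemma R_cancel:
  assumes "x \<in> R" "y \<in> R" "\<And>z. z \<in> R \<Longrightarrow> cinner x z = cinner y z" shows "x = y"
proof -
  have "cinner (x - y) (x - y) = 0"
    using assms(3)[OF csubspaceD(5)[OF cR(1) assms(1,2)]] by (simp only: cinner_diff_left) simp
  thus ?thesis by simp
qed

lemma angle_contraction: "contraction_between D R angle"
proof -
  note V1 = linear_betweenD[OF isometry_betweenD(1)[OF V\<^sub>1(1)]]
  note R' = csubspaceD[OF cR(1)] and D' = csubspaceD[OF cD(1)]
  have "angle (x + y) = angle x + angle y" if xy: "x \<in> D" "y \<in> D" for x y
  proof (rule R_cancel)
    have "V\<^sub>1 (x + y) = V\<^sub>1 x + V\<^sub>1 y" using xy D_subset by (intro V1(2)) auto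
    thus "cinner (angle (x + y)) z = cinner (angle x + angle y) z" if "z \<in> R" for z
      using xy that by (simp add: D'(4) cinner_angle cinner_add_left)
  qed (simp_all add: angle_in R'(4) D'(4) xy)
  moreover have "angle (a *\<^sub>C x) = a *\<^sub>C angle x" if x: "x \<in> D" for a x
  proof (rule R_cancel)
    have "V\<^sub>1 (a *\<^sub>C x) = a *\<^sub>C V\<^sub>1 x" using x D_subset by (intro V1(3)) auto
    thus "cinner (angle (a *\<^sub>C x)) z = cinner (a *\<^sub>C angle x) z" if "z \<in> R" for z
      using x that by (simp add: D'(3) cinner_angle cinner_scaleC_left)
  qed (simp_all add: angle_in R'(3) D'(3) x)
  moreover have "norm (angle x) \<le> norm x" if x: "x \<in> D" for x
  proof -
    have "norm (angle x) * norm (angle x) = norm (cinner (V\<^sub>1 x) (V\<^sub>2 (angle x)))"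
      unfolding cinner_angle[OF x angle_in[OF x], symmetric]
      by (simp add: cinner_self power2_eq_square norm_mult)
    also have "\<dots> \<le> norm (V\<^sub>1 x) * norm (V\<^sub>2 (angle x))" by (rule cinner_norm_le)
    also have "\<dots> = norm x * norm (angle x)"
      by (simp only: isometry_betweenD(3)[OF V\<^sub>1(1) subsetD[OF D_subset x]]
          isometry_betweenD(3)[OF V\<^sub>2(1) subsetD[OF R_subset angle_in[OF x]]])
    finally show ?thesis
      by (cases "angle x = 0") (auto simp: mult_le_cancel_right)
  qed
  moreover have "angle \<in> D \<rightarrow>\<^sub>E R" using angle_in by (auto simp: PiE_iff angle_def[abs_def] extensional_def)
  ultimately show ?thesis by (simp add: contraction_between_def linear_between_def)
qed

text \<open>The entry at \<open>(s, e)\<close> is given by the inner products of the vectors \<open>\<omega>\<^sub>e h\<close> and \<open>\<omega>\<^sub>s g\<close> of \<open>Y\<close>, and these are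
  values of the compression to \<open>S\<^sub>1\<close> and \<open>S\<^sub>2\<close>. Conversely, on all other pairs of generators the compression
  agrees with \<open>W c\<close> by the given entries, so that the entry at \<open>(s, e)\<close> fixes it on the whole spaces, and in
  particular on \<open>D\<close>, where \<open>W c\<close> is \<open>c\<close>.\<close>

lemma angle_eq_iff:
  assumes c: "contraction_between D R c"
  shows "angle = c \<longleftrightarrow> (\<forall>h g. cinner (\<omega> e h) (\<omega> s g) = cinner (W c (\<omega>\<^sub>1 e h)) (\<omega>\<^sub>2 s g))"
proof
  have es: "e \<in> C - {s}" "s \<in> C - {e}" using e_in s_in e_neq_s by auto
  assume "angle = c"
  hence "cinner (V\<^sub>1 (\<omega>\<^sub>1 e h)) (V\<^sub>2 (\<omega>\<^sub>2 s g)) = cinner (W c (\<omega>\<^sub>1 e h)) (\<omega>\<^sub>2 s g)" for h g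
    by (intro compression_eq_W c gen_in es) (use cinner_angle in auto)
  thus "\<forall>h g. cinner (\<omega> e h) (\<omega> s g) = cinner (W c (\<omega>\<^sub>1 e h)) (\<omega>\<^sub>2 s g)"
    by (simp add: V\<^sub>1(2)[OF es(1)] V\<^sub>2(2)[OF es(2)])
next
  assume entry: "\<forall>h g. cinner (\<omega> e h) (\<omega> s g) = cinner (W c (\<omega>\<^sub>1 e h)) (\<omega>\<^sub>2 s g)"
  have cl: "linear_between D R c" using c by (simp add: contraction_between_def)
  have clW: "cont_linear_on S\<^sub>1 (W c)" by (rule cont_linear_on_contraction[OF W_contraction[OF c] cS1(1)])
  have gen: "cinner (V\<^sub>1 (\<omega>\<^sub>1 i h)) (V\<^sub>2 (\<omega>\<^sub>2 j g)) = cinner (W c (\<omega>\<^sub>1 i h)) (\<omega>\<^sub>2 j g)"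
    if i: "i \<in> C - {s}" and j: "j \<in> C - {e}" for i j h g
  proof (cases "i = e")
    case False
    hence i': "i \<in> C - {e, s}" "i \<in> C - {e}" using i by auto
    have "cinner (V\<^sub>1 (\<omega>\<^sub>1 i h)) (V\<^sub>2 (\<omega>\<^sub>2 j g)) = cinner (V\<^sub>2 (\<omega>\<^sub>2 i h)) (V\<^sub>2 (\<omega>\<^sub>2 j g))"
      by (simp only: V\<^sub>1(2)[OF i] V\<^sub>2(2)[OF i'(2)])
    also have "\<dots> = cinner (\<omega>\<^sub>2 i h) (\<omega>\<^sub>2 j g)"
      by (rule cinner_isometry[OF V\<^sub>2(1) cS2(1) gen_in(2)[OF i'(2)] gen_in(2)[OF j]])
    finally show ?thesis by (simp only: W_gen[OF cl i'(1)])
  next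
    case i_e: True
    show ?thesis
    proof (cases "j = s")
      case True
      thus ?thesis using entry i_e V\<^sub>1(2)[OF i] V\<^sub>2(2)[OF j] by simp
    next
      case False
      hence j': "j \<in> C - {e, s}" "j \<in> C - {s}" using j by auto
      have "cinner (V\<^sub>1 (\<omega>\<^sub>1 i h)) (V\<^sub>2 (\<omega>\<^sub>2 j g)) = cinner (V\<^sub>1 (\<omega>\<^sub>1 i h)) (V\<^sub>1 (\<omega>\<^sub>1 j g))"
        by (simp only: V\<^sub>1(2)[OF j'(2)] V\<^sub>2(2)[OF j])
      also have "\<dots> = cinner (\<omega>\<^sub>1 i h) (\<omega>\<^sub>1 j g)"
        by (rule cinner_isometry[OF V\<^sub>1(1) cS1(1) gen_in(1)[OF i] gen_in(1)[OF j'(2)]])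
      also have "\<dots> = cinner (W c (\<omega>\<^sub>1 i h)) (\<omega>\<^sub>2 j g)"
        by (rule cinner_W_gen[OF cl gen_in(1)[OF i] j'(1), symmetric])
      finally show ?thesis .
    qed
  qed
  have gen2: "cinner (V\<^sub>1 (\<omega>\<^sub>1 i h)) (V\<^sub>2 y) = cinner (W c (\<omega>\<^sub>1 i h)) y"
    if i: "i \<in> C - {s}" and y: "y \<in> S\<^sub>2" for i h y
  proof (rule eq_on_closed_span[of "C - {e}" \<omega>\<^sub>2 "\<lambda>y. cinner (V\<^sub>1 (\<omega>\<^sub>1 i h)) (V\<^sub>2 y)" "\<lambda>y. cinner (W c (\<omega>\<^sub>1 i h)) y"])
    show "y \<in> closed_span \<omega>\<^sub>2 (C - {e})" using y by (simp add: S\<^sub>2_def)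
  qed (simp_all add: \<omega>\<^sub>2 gen[OF i] cont_linear_on_cinner_right cont_linear_on_id cont_linear_V(2)[unfolded S\<^sub>2_def])
  have all: "cinner (V\<^sub>1 x) (V\<^sub>2 y) = cinner (W c x) y" if x: "x \<in> S\<^sub>1" and y: "y \<in> S\<^sub>2" for x y
  proof (rule eq_on_closed_span[of "C - {s}" \<omega>\<^sub>1 "\<lambda>x. cinner (V\<^sub>1 x) (V\<^sub>2 y)" "\<lambda>x. cinner (W c x) y"])
    show "x \<in> closed_span \<omega>\<^sub>1 (C - {s})" using x by (simp add: S\<^sub>1_def)
  qed (simp_all add: \<omega>\<^sub>1 gen2[OF _ y] cont_linear_on_cinner_left cont_linear_V(1)[unfolded S\<^sub>1_def]
      clW[unfolded S\<^sub>1_def])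
  show "angle = c"
  proof (rule extensionalityI)
    show "angle \<in> extensional D" "c \<in> extensional D"
      using linear_betweenD(5)[OF cl] by (auto simp: angle_def)
    fix x assume x: "x \<in> D"
    show "angle x = c x"
    proof (rule R_cancel)
      show "angle x \<in> R" "c x \<in> R" using angle_in[OF x] linear_betweenD(1)[OF cl x] by auto
      show "cinner (angle x) y = cinner (c x) y" if y: "y \<in> R" for y
        using cinner_angle[OF x y] all[of x y] x y R_subset D_subset W_D[OF x, of c] by auto
    qed
  qed
qed

end

section \<open>Words and lexicographic orders on the free group\<close>

lemma free_group_right_inverse: "s * inverse s = (1 :: 'a free_group)"
  by (metis free_group_left_inverse mult.assoc mult.left_neutral)

lemma free_group_cancel [simp]:
  fixes s t :: "'a free_group"
  shows "inverse s * (s * t) = t" "s * (inverse s * t) = t" "inverse s * s = 1" "s * inverse s = 1"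
  by (simp_all add: free_group_left_inverse free_group_right_inverse flip: mult.assoc)

lemma free_group_inverse_unique: "s * t = (1 :: 'a free_group) \<Longrightarrow> inverse s = t"
  by (metis free_group_cancel(1) mult.right_neutral)

lemma free_group_inverse_inverse [simp]: "inverse (inverse s) = (s :: 'a free_group)"
  by (rule free_group_inverse_unique) simp

lemma free_group_inverse_mult: "inverse (s * t) = inverse t * inverse (s :: 'a free_group)"
  by (rule free_group_inverse_unique) (simp add: mult.assoc)

lemma free_group_inverse_one [simp]: "inverse 1 = (1 :: 'a free_group)"
  by (rule free_group_inverse_unique) simp

lemma free_group_inverse_mult_eq_one: "inverse s * t = 1 \<longleftrightarrow> s = (t :: 'a free_group)"
  by (metis free_group_cancel(2,3) mult.right_neutral)

abbreviation inv_word :: "'a letter list \<Rightarrow> 'a letter list" where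
  "inv_word w \<equiv> rev (map inv_letter w)"

lemma reduced_word_of [simp]: "reduced (word_of s)"
  using word_of[of s] by simp

lemma word_of_inverse: "word_of (inverse s) = inv_word (word_of s)"
  by (rule inverse_free_group.rep_eq)

lemma word_of_1 [simp]: "word_of 1 = []"
  by (rule one_free_group.rep_eq)

lemma word_of_eq_Nil [simp]: "word_of s = [] \<longleftrightarrow> s = 1"
  by (metis word_of_1 word_of_inject)

lemma word_length_inverse [simp]: "word_length (inverse s) = word_length s"
  by (simp add: word_length_def word_of_inverse)

lemma reduced_append:
  "reduced (u @ v) \<longleftrightarrow> reduced u \<and> reduced v \<and> (u = [] \<or> v = [] \<or> hd v \<noteq> inv_letter (last u))"
  by (auto simp: reduced_def successively_append_iff)

lemma foldr_push_append: "reduced (u @ v) \<Longrightarrow> foldr push u v = u @ v"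
proof (induction u)
  case (Cons x u)
  thus ?case using reduced_Cons[of x "u @ v"] push_Cons[of x "u @ v"] by simp
qed simp

lemma length_push: "length (push x w) \<le> Suc (length w)" "length (push x w) = Suc (length w) \<Longrightarrow> push x w = x # w"
  by (cases w; simp split: if_splits)+

lemma length_foldr_push:
  "length (foldr push u v) \<le> length u + length v"
  "length (foldr push u v) = length u + length v \<Longrightarrow> foldr push u v = u @ v"
proof (induction u)
  case (Cons x u)
  show "length (foldr push (x # u) v) \<le> length (x # u) + length v"
    using Cons(1) length_push(1)[of x "foldr push u v"] by simp
  assume a: "length (foldr push (x # u) v) = length (x # u) + length v"
  hence "length (foldr push u v) = length u + length v"
    using Cons(1) length_push(1)[of x "foldr push u v"] by simp
  thus "foldr push (x # u) v = (x # u) @ v"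
    using Cons(2) a length_push(2)[of x "foldr push u v"] by simp
qed simp_all

lemma word_of_times_prefix:
  assumes "word_of s = u @ a" "word_of t = u @ b"
  shows "word_of (inverse s * t) = foldr push (inv_word a) b"
    and "a = [] \<or> b = [] \<or> hd a \<noteq> hd b \<Longrightarrow> word_of (inverse s * t) = inv_word a @ b"
proof -
  have r: "reduced (u @ a)" "reduced (u @ b)" using assms by (metis reduced_word_of)+
  have *: "foldr push (inv_word u) (u @ b) = b"
    using r(2)
  proof (induction u)
    case (Cons x u)
    thus ?case using reduced_Cons[of x "u @ b"] by simp
  qed simp
  have "word_of (inverse s * t) = foldr push (inv_word (u @ a)) (u @ b)"
    by (simp only: times_free_group.rep_eq word_of_inverse assms)
  thus 1: "word_of (inverse s * t) = foldr push (inv_word a) b"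
    using * by (simp only: map_append rev_append foldr_append)
  assume h: "a = [] \<or> b = [] \<or> hd a \<noteq> hd b"
  have "reduced (inv_word a @ b)"
    using r h reduced_inv[of a] by (auto simp: reduced_append last_rev hd_map)
  thus "word_of (inverse s * t) = inv_word a @ b" unfolding 1 by (rule foldr_push_append)
qed

text \<open>If \<open>w\<close> and its inverse share at least their first half, then the letters of \<open>w\<close> in positions symmetric to
  the middle are inverse to each other. For odd length the middle letter would be its own inverse,
  and for even length the two middle letters would cancel.\<close>

lemma prefix_inv_word_less_half:
  assumes w: "reduced w" "w \<noteq> []" and k: "take k w = take k (inv_word w)" "k \<le> length w"
  shows "2 * k < length w"
proof (rule ccontr)
  assume "\<not> 2 * k < length w"
  hence k2: "length w \<le> 2 * k" by simp
  define n where "n = length w"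
  have sym: "w ! i = inv_letter (w ! (n - 1 - i))" if "i < k" for i
  proof -
    have "w ! i = inv_word w ! i" using that k by (metis nth_take)
    also have "\<dots> = inv_letter (w ! (n - 1 - i))" using that k(2) by (simp add: rev_nth n_def)
    finally show ?thesis .
  qed
  have n0: "0 < n" using w(2) by (simp add: n_def)
  show False
  proof (cases "even n")
    case True
    then obtain b where b: "n = 2 * b" by (elim evenE)
    define i where "i = b - 1"
    have i: "i < k" "n - 1 - i = Suc i" "Suc i < length w"
      using b n0 k2 by (auto simp: i_def n_def[symmetric])
    have "w ! Suc i \<noteq> inv_letter (w ! i)"
      using w(1) i(3) by (simp add: reduced_def successively_conv_nth)
    thus False using sym[OF i(1)] i(2) by simp
  next
    case False
    then obtain i where b: "n = 2 * i + 1" by (elim oddE)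
    have i: "i < k" "n - 1 - i = i" using b k2 by (auto simp: n_def[symmetric])
    show False using sym[OF i(1)] i(2) inv_letter_neq by metis
  qed
qed

lemma common_prefix_decomposition:
  obtains u a b where "v = u @ a" "w = u @ b" "a = [] \<or> b = [] \<or> hd a \<noteq> hd b"
proof -
  have "\<exists>u a b. v = u @ a \<and> w = u @ b \<and> (a = [] \<or> b = [] \<or> hd a \<noteq> hd b)"
  proof (induction v arbitrary: w)
    case (Cons x v)
    show ?case
    proof (cases "w \<noteq> [] \<and> hd w = x")
      case True
      then obtain w' where w: "w = x # w'" by (cases w) auto
      from Cons[of w'] obtain u a b
        where "v = u @ a \<and> w' = u @ b \<and> (a = [] \<or> b = [] \<or> hd a \<noteq> hd b)" by blast
      thus ?thesis unfolding w by (intro exI[of _ "x # u"] exI[of _ a] exI[of _ b]) simp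
    next
      case False
      thus ?thesis by (intro exI[of _ "[]"] exI[of _ "x # v"] exI[of _ w]) auto
    qed
  qed simp
  thus ?thesis using that by blast
qed

text \<open>The cancellation in \<open>s s = (s\<^sup>-\<^sup>1)\<^sup>-\<^sup>1 s\<close> is the common beginning of \<open>s\<^sup>-\<^sup>1\<close> and \<open>s\<close>, which is
  shorter than half of \<open>s\<close>.\<close>

lemma word_length_square:
  assumes "s \<noteq> 1" shows "word_length s < word_length (s * s)"
proof -
  obtain u a b where a: "inv_word (word_of s) = u @ a" and b: "word_of s = u @ b"
    and ab: "a = [] \<or> b = [] \<or> hd a \<noteq> hd b"
    by (rule common_prefix_decomposition)
  have "2 * length u < length (word_of s)"
  proof (rule prefix_inv_word_less_half)
    show "word_of s \<noteq> []" using assms by simp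
    show "length u \<le> length (word_of s)" by (simp add: b)
    show "take (length u) (word_of s) = take (length u) (inv_word (word_of s))"
      unfolding a by (simp only: b) simp
  qed simp
  moreover have "word_of (inverse (inverse s) * s) = inv_word a @ b"
    by (rule word_of_times_prefix(2)[OF _ b ab]) (simp add: word_of_inverse a)
  moreover have "length a = length b" using arg_cong[OF a, of length] arg_cong[OF b, of length] by simp
  ultimately show ?thesis using b by (simp add: word_length_def)
qed

locale lexicographic =
  fixes le :: "'a::finite free_group \<Rightarrow> 'a free_group \<Rightarrow> bool"
  assumes lex: "lexicographic_order le"
begin

lemma le_refl: "le s s" and le_trans: "le s t \<Longrightarrow> le t u \<Longrightarrow> le s u"
  and le_antisym: "le s t \<Longrightarrow> le t s \<Longrightarrow> s = t" and le_total: "le s t \<or> le t s"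
proof -
  have "linear_order {(s, t). le s t}" using lex by (simp only: lexicographic_order_def)
  hence lo: "refl {(s, t). le s t}" "trans {(s, t). le s t}" "antisym {(s, t). le s t}"
      "total {(s, t). le s t}"
    unfolding linear_order_on_def partial_order_on_def preorder_on_def by blast+
  show refl: "le s s" using reflD[OF lo(1), of s] by simp
  show "le s t \<Longrightarrow> le t u \<Longrightarrow> le s u" using transD[OF lo(2), of s t u] by simp
  show "le s t \<Longrightarrow> le t s \<Longrightarrow> s = t" using antisymD[OF lo(3), of s t] by simp
  show "le s t \<or> le t s" using lo(4)[unfolded total_on_def] refl by (cases "s = t") auto
qed

lemma le_shorter: "word_length s < word_length t \<Longrightarrow> le s t"
  using lex unfolding lexicographic_order_def by blast

lemma le_length: "le s t \<Longrightarrow> word_length s \<le> word_length t"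
  using le_shorter le_antisym by (metis linorder_not_less order_less_imp_le)

lemma le_iff_first_difference:
  assumes s: "word_of s = u @ x # a" and t: "word_of t = u @ y # b" and "x \<noteq> y"
    and len: "length a = length b"
  shows "le s t \<longleftrightarrow> le (of_letter x) (of_letter y)"
proof -
  have imp: "le s t" if s: "word_of s = u @ x # a" and t: "word_of t = u @ y # b" and xy: "x \<noteq> y"
    and len: "length a = length b" and l: "le (of_letter x) (of_letter y)" for s t x y a b
  proof -
    have cb: "word_of (common_beginning s t) = u"
    proof -
      have "longest_common_prefix (u @ x # a) (u @ y # b) = u"
        using xy by (induction u) auto
      thus ?thesis by (simp add: common_beginning.rep_eq s t)
    qed
    have "word_of (inverse (common_beginning s t) * s) = inv_word [] @ (x # a)"
      "word_of (inverse (common_beginning s t) * t) = inv_word [] @ (y # b)"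
      by (rule word_of_times_prefix(2)[of _ u]; simp add: cb s t)+
    hence "first_letter (inverse (common_beginning s t) * s) = of_letter x"
      "first_letter (inverse (common_beginning s t) * t) = of_letter y"
      by (simp_all add: first_letter_def)
    moreover have "s \<noteq> t" "word_length s = word_length t" using s t xy len by (auto simp: word_length_def)
    ultimately show ?thesis using lex[unfolded lexicographic_order_def Let_def] l by metis
  qed
  show ?thesis
  proof
    assume st: "le s t"
    show "le (of_letter x) (of_letter y)"
    proof (rule ccontr)
      assume "\<not> le (of_letter x) (of_letter y)"
      hence "le t s" using le_total imp[OF t s] \<open>x \<noteq> y\<close> len by metis
      hence "s = t" using st le_antisym by blast
      thus False using s t \<open>x \<noteq> y\<close> by simp
    qed
  qed (rule imp[OF assms])
qed

text \<open>The comparison is decided at the first difference, which lies within \<open>p\<close> and \<open>q\<close>.\<close>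

lemma le_depends_on_prefix:
  assumes "word_of s = p @ a" "word_of t = q @ b" "word_of s' = p @ a'" "word_of t' = q @ b'"
    and "length p = length q" "p \<noteq> q" "length a = length b" "length a' = length b'"
    and "le s t"
  shows "le s' t'"
proof -
  obtain u c d where c: "p = u @ c" and d: "q = u @ d" and cd': "c = [] \<or> d = [] \<or> hd c \<noteq> hd d"
    by (rule common_prefix_decomposition)
  have cd: "length c = length d" "c \<noteq> d" using assms(5,6) c d by auto
  then obtain x c' y d' where c': "c = x # c'" and d': "d = y # d'"
    by (metis length_0_conv neq_Nil_conv)
  have "x \<noteq> y" using cd' c' d' by simp
  hence "le s t \<longleftrightarrow> le (of_letter x) (of_letter y)" "le s' t' \<longleftrightarrow> le (of_letter x) (of_letter y)"
    using cd assms le_iff_first_difference[of s u x "c' @ a" t y "d' @ b", OF _ _ \<open>x \<noteq> y\<close>]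
      le_iff_first_difference[of s' u x "c' @ a'" t' y "d' @ b'", OF _ _ \<open>x \<noteq> y\<close>]
    by (simp_all add: c d c' d')
  thus ?thesis using assms(9) by simp
qed

lemma finite_below: "finite {t. le t s}"
proof -
  have "finite {w :: 'a letter list. set w \<subseteq> UNIV \<and> length w \<le> word_length s}"
    by (rule finite_lists_length_le) simp
  hence "finite (word_of -` {w :: 'a letter list. set w \<subseteq> UNIV \<and> length w \<le> word_length s})"
    by (rule finite_vimageI) (simp add: inj_def word_of_inject)
  thus ?thesis by (rule rev_finite_subset) (auto dest: le_length simp: word_length_def)
qed

section \<open>The order on the classes\<close>

definition rep :: "'a free_group \<Rightarrow> 'a free_group" where
  "rep s = (if le s (inverse s) then s else inverse s)"

lemma min_rep_inv_class: "min_rep le (inv_class s) = rep s"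
  unfolding min_rep_def
proof (rule the_equality)
  show *: "rep s \<in> inv_class s \<and> (\<forall>t\<in>inv_class s. le (rep s) t)"
    using le_refl le_total[of s "inverse s"] by (auto simp: rep_def inv_class_def)
  show "t = rep s" if "t \<in> inv_class s \<and> (\<forall>u\<in>inv_class s. le t u)" for t
    using * that le_antisym by blast
qed

lemma rep_cases: "rep s = s \<or> rep s = inverse s" by (simp add: rep_def)

lemma rep_le: "le (rep s) s" "le (rep s) (inverse s)"
  using le_refl le_total[of s "inverse s"] by (auto simp: rep_def)

lemma rep_inverse [simp]: "rep (inverse s) = rep s"
  using le_antisym le_total[of s "inverse s"] by (auto simp: rep_def)

lemma rep_length [simp]: "word_length (rep s) = word_length s"
  by (simp add: rep_def)

lemma rep_eq_iff: "rep s = rep t \<longleftrightarrow> t = s \<or> t = inverse s"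
  using rep_cases[of s] rep_cases[of t] by (metis free_group_inverse_inverse rep_inverse)

lemma rep_rep [simp]: "rep (rep s) = rep s"
  using rep_cases[of s] by (metis rep_inverse)

lemma rep_1 [simp]: "rep 1 = 1" using rep_cases[of 1] by auto

lemma le_1: "le 1 s"
  by (cases "s = 1") (auto intro: le_refl le_shorter simp: word_length_def)

lemma inv_class_eq_iff: "inv_class s = inv_class t \<longleftrightarrow> rep s = rep t"
proof
  show "inv_class s = inv_class t \<Longrightarrow> rep s = rep t" by (metis min_rep_inv_class)
  show "rep s = rep t \<Longrightarrow> inv_class s = inv_class t" by (auto simp: rep_eq_iff inv_class_def)
qed

lemma class_le_iff: "class_le le (inv_class s) (inv_class t) \<longleftrightarrow> le (rep s) (rep t)"
  by (simp add: class_le_def min_rep_inv_class)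

lemma class_less_iff: "class_less le (inv_class s) (inv_class t) \<longleftrightarrow> le (rep s) (rep t) \<and> rep s \<noteq> rep t"
  by (simp add: class_less_def class_le_iff inv_class_eq_iff)

lemma mem_class: "\<mu> \<in> inv_classes \<Longrightarrow> s \<in> \<mu> \<longleftrightarrow> inv_class s = \<mu>"
  by (auto simp: inv_classes_def inv_class_def)

lemma Sigma_upto_iff: "s \<in> Sigma_upto le (inv_class t) \<longleftrightarrow> le (rep s) (rep t)"
proof -
  have "s \<in> Sigma_upto le (inv_class t) \<longleftrightarrow> (\<exists>\<mu>\<in>inv_classes. class_le le \<mu> (inv_class t) \<and> s \<in> \<mu>)"
    by (auto simp: Sigma_upto_def)
  also have "\<dots> \<longleftrightarrow> class_le le (inv_class s) (inv_class t)"
    using mem_class by (metis inv_classes_def rangeI)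
  finally show ?thesis by (simp add: class_le_iff)
qed

lemma finite_max:
  assumes "finite B" "B \<noteq> {}" shows "\<exists>t\<in>B. \<forall>u\<in>B. le u t"
  using assms
proof (induction B rule: finite_ne_induct)
  case (singleton x)
  show ?case by (simp add: le_refl)
next
  case (insert x F)
  then obtain t where t: "t \<in> F" "\<forall>u\<in>F. le u t" by blast
  show ?case
  proof (cases "le t x")
    case True
    thus ?thesis using t le_trans le_refl by blast
  next
    case False
    thus ?thesis using t le_total by blast
  qed
qed

lemma rep_induct [consumes 1, case_names less]:
  assumes "rep s = s"
    and step: "\<And>s. rep s = s \<Longrightarrow> (\<And>t. rep t = t \<Longrightarrow> le t s \<Longrightarrow> t \<noteq> s \<Longrightarrow> P t) \<Longrightarrow> P s"
  shows "P s"
  using assms(1)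
proof (induction "card {t. le t s}" arbitrary: s rule: less_induct)
  case (less s)
  show ?case
  proof (rule step[OF less.prems])
    fix t assume t: "rep t = t" "le t s" "t \<noteq> s"
    have "{u. le u t} \<subset> {u. le u s}"
      using t le_trans[of _ t s] le_antisym[of s t] le_refl[of s] by blast
    hence "card {u. le u t} < card {u. le u s}" by (intro psubset_card_mono finite_below)
    thus "P t" using less.hyps t(1) by blast
  qed
qed

lemma classes_eq: "inv_classes = inv_class ` {s. rep s = s}"
proof -
  have "inv_class s \<in> inv_class ` {s. rep s = s}" for s
    by (rule image_eqI[of _ _ "rep s"]) (simp_all add: inv_class_eq_iff)
  thus ?thesis by (auto simp: inv_classes_def)
qed

lemma nontrivial_classes_eq: "nontrivial_classes = inv_class ` {s. rep s = s \<and> s \<noteq> 1}"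
proof -
  have "{1} = inv_class (1 :: 'a free_group)" by (simp add: inv_class_def)
  thus ?thesis by (auto simp: nontrivial_classes_def classes_eq inv_class_eq_iff)
qed

lemma predecessor:
  assumes s: "rep s = s" "s \<noteq> 1"
  shows "\<exists>t. rep t = t \<and> pred_class le (inv_class s) = inv_class t \<and>
    (\<forall>x. le (rep x) t \<longleftrightarrow> le (rep x) s \<and> rep x \<noteq> s)"
proof -
  define B where "B = {t. rep t = t \<and> le t s \<and> t \<noteq> s}"
  have "finite B" by (rule finite_subset[OF _ finite_below[of s]]) (auto simp: B_def)
  moreover have "1 \<in> B" using s le_1 by (simp add: B_def)
  ultimately have "\<exists>t\<in>B. \<forall>u\<in>B. le u t" by (intro finite_max) auto
  then obtain t where t: "t \<in> B" "\<forall>u\<in>B. le u t" by (elim bexE)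
  have t': "rep t = t" "le t s" "t \<noteq> s" using t(1) by (auto simp: B_def)
  have "pred_class le (inv_class s) = inv_class t"
    unfolding pred_class_def
  proof (rule the_equality)
    have "class_le le \<kappa> (inv_class t)" if \<kappa>: "\<kappa> \<in> inv_classes" "class_less le \<kappa> (inv_class s)" for \<kappa>
    proof -
      obtain u where u: "\<kappa> = inv_class u" "rep u = u" using \<kappa>(1) by (auto simp: classes_eq)
      have "u \<in> B" using \<kappa>(2) u s(1) by (simp add: class_less_iff B_def)
      thus ?thesis using t(2) u t'(1) by (simp add: class_le_iff)
    qed
    thus "inv_class t \<in> inv_classes \<and> class_less le (inv_class t) (inv_class s) \<and>
        (\<forall>\<kappa>\<in>inv_classes. class_less le \<kappa> (inv_class s) \<longrightarrow> class_le le \<kappa> (inv_class t))"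
      using t' s(1) by (simp add: class_less_iff inv_classes_def)
    fix \<nu> assume \<nu>: "\<nu> \<in> inv_classes \<and> class_less le \<nu> (inv_class s) \<and>
        (\<forall>\<kappa>\<in>inv_classes. class_less le \<kappa> (inv_class s) \<longrightarrow> class_le le \<kappa> \<nu>)"
    then obtain u where u: "\<nu> = inv_class u" "rep u = u" by (auto simp: classes_eq)
    have "u \<in> B" using \<nu> u s(1) by (simp add: class_less_iff B_def)
    moreover have "class_less le (inv_class t) (inv_class s)" using t' s(1) by (simp add: class_less_iff)
    hence "class_le le (inv_class t) \<nu>" using \<nu> by (simp add: inv_classes_def)
    hence "le t u" using u t'(1) by (simp add: class_le_iff)
    ultimately show "\<nu> = inv_class t" using t(2) le_antisym[of t u] u(1) by simp
  qed
  moreover have "le (rep x) t \<longleftrightarrow> le (rep x) s \<and> rep x \<noteq> s" for x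
  proof
    assume x: "le (rep x) t"
    show "le (rep x) s \<and> rep x \<noteq> s" using x t' le_trans le_antisym by metis
  next
    assume "le (rep x) s \<and> rep x \<noteq> s"
    hence "rep x \<in> B" by (simp add: B_def)
    thus "le (rep x) t" using t(2) by simp
  qed
  ultimately show ?thesis using t'(1) by blast
qed

lemma Sigma_pred_iff:
  assumes s: "rep s = s" "s \<noteq> 1"
  shows "x \<in> Sigma_upto le (pred_class le (inv_class s)) \<longleftrightarrow> le (rep x) s \<and> rep x \<noteq> s"
  using predecessor[OF s] by (metis Sigma_upto_iff)

section \<open>The clique completed at one step\<close>

text \<open>Here \<open>u\<close> is the common beginning of \<open>s\<close> and \<open>y\<close>, and \<open>x\<close> follows \<open>s\<close> at least that long. The lengths alone give
  \<open>|y\<^sup>-\<^sup>1 x| \<le> |s|\<close>; this is the four-point condition in the Cayley tree. In the case of equality \<open>|z| = |u|\<close>,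
  \<open>|u| \<le> |r| = |r'|\<close>, and \<open>y\<^sup>-\<^sup>1 x = z\<^sup>-\<^sup>1 r'\<close> precedes \<open>s = u r\<close> if \<open>y\<^sup>-\<^sup>1 s = z\<^sup>-\<^sup>1 r\<close> does. The other
  possibility is that \<open>s\<^sup>-\<^sup>1 y = r\<^sup>-\<^sup>1 z\<close> precedes \<open>s\<close>, which in turn precedes \<open>s\<^sup>-\<^sup>1 = r\<^sup>-\<^sup>1 u\<^sup>-\<^sup>1\<close>. Then \<open>s\<close> begins
  with \<open>r\<^sup>-\<^sup>1\<close>, that is, \<open>s\<close> and \<open>s\<^sup>-\<^sup>1\<close> share at least half of their letters, which is impossible.\<close>

lemma common_neighbours_close_aux:
  assumes s: "rep s = s" and y: "y \<noteq> 1"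
    and le: "le (rep y) s" "le (rep x) s" "le (rep (inverse y * s)) s"
    and w: "word_of s = u @ r" "word_of y = u @ z" "word_of x = u @ r'"
    and rz: "r = [] \<or> z = [] \<or> hd r \<noteq> hd z"
  shows "le (rep (inverse y * x)) s \<and> rep (inverse y * x) \<noteq> s"
proof -
  define n where "n = word_length s"
  have len: "word_length y \<le> n" "word_length x \<le> n" "word_length (inverse y * s) \<le> n"
    using le[THEN le_length] by (simp_all add: n_def)
  have n: "n = length u + length r" by (simp add: n_def word_length_def w)
  have ys: "word_of (inverse y * s) = inv_word z @ r"
    by (rule word_of_times_prefix(2)[OF w(2,1)]) (use rz in auto)
  have yx: "word_of (inverse y * x) = foldr push (inv_word z) r'"
    by (rule word_of_times_prefix(1)[OF w(2,3)])
  have zu: "length z \<le> length u" using len(3) ys n by (simp add: word_length_def)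
  have r': "length u + length r' \<le> n" using len(2) by (simp add: word_length_def w)
  have l: "word_length (inverse y * x) \<le> length z + length r'"
    using length_foldr_push(1)[of "inv_word z" r'] by (simp add: word_length_def yx)
  show ?thesis
  proof (cases "word_length (inverse y * x) < n")
    case True
    hence "word_length (rep (inverse y * x)) < word_length s" by (simp add: n_def)
    thus ?thesis using le_shorter by auto
  next
    case False
    hence eq: "length z = length u" "length r' = length r" "word_length (inverse y * x) = length z + length r'"
      using l zu r' n by linarith+
    have yx': "word_of (inverse y * x) = inv_word z @ r'"
      unfolding yx by (rule length_foldr_push(2)) (use eq(3) yx in \<open>simp add: word_length_def\<close>)
    have ne: "u \<noteq> []" "z \<noteq> []" using y eq(1) w(2) by auto
    have "hd z \<noteq> inv_letter (last u)"
      using ne reduced_word_of[of y] by (simp add: w(2) reduced_append)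
    hence uz: "u \<noteq> inv_word z" using ne(2) by (auto simp: last_rev hd_map)
    have ur: "length u \<le> length r" using len(1) eq(1) n by (simp add: word_length_def w)
    have "le (inverse y * s) s \<or> le (inverse (inverse y * s)) s"
      using rep_cases[of "inverse y * s"] le(3) by metis
    thus ?thesis
    proof
      assume "le (inverse y * s) s"
      hence "le (inverse y * x) s"
        by (rule le_depends_on_prefix[OF ys w(1) yx' w(1), rotated -1])
          (use eq uz in auto)
      moreover have "inverse y * x \<noteq> s"
      proof
        assume "inverse y * x = s"
        hence "inv_word z @ r' = u @ r" using yx' w(1) by metis
        thus False using uz eq(1) by (simp add: append_eq_append_conv)
      qed
      ultimately show ?thesis using rep_le(1)[of "inverse y * x"] le_trans le_antisym by metis
    next
      assume l2: "le (inverse (inverse y * s)) s"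
      have w2: "word_of (inverse (inverse y * s)) = inv_word r @ z"
        by (simp add: word_of_inverse ys rev_map comp_def)
      have w3: "word_of (inverse s) = inv_word r @ inv_word u" by (simp add: word_of_inverse w)
      define p where "p = take (length r) (u @ r)"
      define q where "q = drop (length r) (u @ r)"
      have w4: "word_of s = p @ q" by (simp only: p_def q_def w append_take_drop_id)
      have lp: "length p = length r" "length q = length u" by (simp_all add: p_def q_def)
      have "p = inv_word r"
      proof (rule ccontr)
        assume pr: "p \<noteq> inv_word r"
        have "le (inverse s) s"
          by (rule le_depends_on_prefix[OF w2 w4 w3 w4]) (use lp pr eq(1) l2 in auto)
        moreover have "le s (inverse s)" using rep_le(2)[of s] s by simp
        ultimately have "inverse s = s" using le_antisym by blast
        hence "inv_word r @ inv_word u = p @ q" using w3 w4 by metis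
        thus False using pr lp(1) by (simp add: append_eq_append_conv)
      qed
      hence "take (length r) (word_of s) = take (length r) (inv_word (word_of s))"
        by (simp add: p_def w)
      from prefix_inv_word_less_half[OF reduced_word_of _ this] have "2 * length r < length (word_of s)"
        using ne by (simp add: w)
      thus ?thesis using ur by (simp add: w)
    qed
  qed
qed

text \<open>The two neighbours enter symmetrically, and the one that leaves the path from \<open>1\<close> to \<open>s\<close> first takes the
  place of \<open>y\<close> in the preceding lemma.\<close>

lemma common_neighbours_close:
  assumes s: "rep s = s" and x: "x \<noteq> 1" "le (rep x) s" "le (rep (inverse x * s)) s"
    and y: "y \<noteq> 1" "le (rep y) s" "le (rep (inverse y * s)) s"
  shows "le (rep (inverse x * y)) s \<and> rep (inverse x * y) \<noteq> s"
proof -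
  have sym: "rep (inverse y * x) = rep (inverse x * y)"
    using rep_inverse[of "inverse y * x"] by (simp add: free_group_inverse_mult)
  obtain u r z where u: "word_of s = u @ r" "word_of y = u @ z" "r = [] \<or> z = [] \<or> hd r \<noteq> hd z"
    by (rule common_prefix_decomposition)
  obtain v r' z' where v: "word_of s = v @ r'" "word_of x = v @ z'" "r' = [] \<or> z' = [] \<or> hd r' \<noteq> hd z'"
    by (rule common_prefix_decomposition)
  have "(\<exists>a. v = u @ a) \<or> (\<exists>a. u = v @ a)"
    using u(1) v(1) by (metis append_eq_append_conv2)
  thus ?thesis
  proof (elim disjE exE)
    fix a assume "v = u @ a"
    thus ?thesis
      using common_neighbours_close_aux[OF s y(1,2) x(2) y(3) u(1,2) _ u(3), of "a @ z'"] v(2) sym by simp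
  next
    fix a assume "u = v @ a"
    thus ?thesis
      using common_neighbours_close_aux[OF s x(1,2) y(2) x(3) v(1,2) _ v(3), of "a @ z"] u(2) by simp
  qed
qed

text \<open>An edge of the class of \<open>s\<close> from \<open>x\<close> to \<open>1\<close> or \<open>s\<close> would force \<open>x = s\<^sup>-\<^sup>1\<close> or \<open>x = s\<^sup>2\<close>, and \<open>s\<^sup>2\<close> is longer
  than \<open>s\<close>.\<close>

lemma neighbour_edges_smaller:
  assumes s: "rep s = s" "s \<noteq> 1" and x: "x \<noteq> 1" "x \<noteq> s" "le (rep x) s" "le (rep (inverse x * s)) s"
  shows "rep x \<noteq> s" "rep (inverse x * s) \<noteq> s"
proof -
  have ss: "\<not> le (rep (s * s)) s"
    using le_length[of "rep (s * s)" s] word_length_square[OF s(2)] by auto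
  show "rep x \<noteq> s"
  proof
    assume "rep x = s"
    hence "x = s \<or> x = inverse s" using rep_eq_iff[of s x] s by simp
    hence "inverse x * s = s * s" using x(2) by auto
    thus False using x(4) ss by simp
  qed
  show "rep (inverse x * s) \<noteq> s"
  proof
    assume "rep (inverse x * s) = s"
    hence "inverse x * s = s \<or> inverse x * s = inverse s" using rep_eq_iff[of s "inverse x * s"] s by simp
    hence "s = x * s \<or> s = x * inverse s" by (metis free_group_cancel(2))
    hence "s * inverse s = (x * s) * inverse s \<or> s * s = (x * inverse s) * s" by auto
    hence "x = 1 \<or> s * s = x" by (simp add: mult.assoc)
    thus False using x(1,3) ss by auto
  qed
qed

definition clique_of :: "'a free_group \<Rightarrow> 'a free_group set" where
  "clique_of s = {1, s} \<union> {x. x \<noteq> 1 \<and> x \<noteq> s \<and> le (rep x) s \<and> le (rep (inverse x * s)) s}"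

lemma clique_of_edges:
  assumes s: "rep s = s" "s \<noteq> 1" and ij: "i \<in> clique_of s" "j \<in> clique_of s" "{i, j} \<noteq> {1, s}"
  shows "le (rep (inverse i * j)) s" "rep (inverse i * j) \<noteq> s"
proof -
  have sym: "rep (inverse j * i) = rep (inverse i * j)" for i j
    using rep_inverse[of "inverse j * i"] by (simp add: free_group_inverse_mult)
  have *: "le (rep (inverse i * j)) s \<and> rep (inverse i * j) \<noteq> s"
    if "i = j \<or> i \<in> clique_of s - {1, s} \<and> j \<in> clique_of s" for i j
  proof (cases "i = j")
    case True
    thus ?thesis using s le_1 by simp
  next
    case False
    hence i: "i \<noteq> 1" "i \<noteq> s" "le (rep i) s" "le (rep (inverse i * s)) s" and j: "j \<in> clique_of s"
      using that by (auto simp: clique_of_def)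
    consider "j = 1" | "j = s" | "j \<noteq> 1" "le (rep j) s" "le (rep (inverse j * s)) s"
      using j by (auto simp: clique_of_def)
    thus ?thesis
    proof cases
      case 1
      thus ?thesis using i neighbour_edges_smaller[OF s i] by simp
    next
      case 2
      thus ?thesis using i neighbour_edges_smaller[OF s i] by simp
    next
      case 3
      show ?thesis by (rule common_neighbours_close[OF s(1) i(1,3,4) 3])
    qed
  qed
  have "i = j \<or> i \<in> clique_of s - {1, s} \<or> j \<in> clique_of s - {1, s}" using ij by auto
  hence "le (rep (inverse i * j)) s \<and> rep (inverse i * j) \<noteq> s"
    using *[of i j] *[of j i] ij sym[of i j] by auto
  thus "le (rep (inverse i * j)) s" "rep (inverse i * j) \<noteq> s" by auto
qed

lemma clique_of_edges_le:
  assumes s: "rep s = s" "s \<noteq> 1" and ij: "i \<in> clique_of s" "j \<in> clique_of s"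
  shows "le (rep (inverse i * j)) s"
proof (cases "{i, j} = {1, s}")
  case True
  thus ?thesis using s rep_inverse[of s] by (auto simp: doubleton_eq_iff le_refl)
qed (rule clique_of_edges(1)[OF s ij])

lemma adjacent_iff: "rep s = s \<Longrightarrow> adjacent le (inv_class s) x y \<longleftrightarrow> x \<noteq> y \<and> le (rep (inverse x * y)) s"
  by (simp add: adjacent_def class_le_iff)

lemma the_clique_eq:
  assumes s: "rep s = s" "s \<noteq> 1"
  shows "the_clique le (inv_class s) = clique_of s"
proof -
  have min: "min_rep le (inv_class s) = s" by (simp add: min_rep_inv_class s)
  have cl: "clique le (inv_class s) (clique_of s)"
    using clique_of_edges_le[OF s] by (auto simp: clique_def adjacent_iff[OF s(1)])
  have sub: "C \<subseteq> clique_of s" if C: "clique le (inv_class s) C" "1 \<in> C" "s \<in> C" for C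
  proof
    fix x assume x: "x \<in> C"
    have "le (rep x) s \<and> le (rep (inverse x * s)) s" if "x \<noteq> 1" "x \<noteq> s"
    proof -
      have "adjacent le (inv_class s) 1 x" "adjacent le (inv_class s) x s"
        using C x that unfolding clique_def by metis+
      thus ?thesis by (simp add: adjacent_iff[OF s(1)])
    qed
    thus "x \<in> clique_of s" by (auto simp: clique_of_def)
  qed
  show ?thesis
    unfolding the_clique_def min
  proof (rule the_equality)
    show "maximal_clique le (inv_class s) (clique_of s) \<and> 1 \<in> clique_of s \<and> s \<in> clique_of s"
      using cl sub by (auto simp: maximal_clique_def clique_of_def)
    show "C = clique_of s" if "maximal_clique le (inv_class s) C \<and> 1 \<in> C \<and> s \<in> C" for C
      using that sub[of C] cl by (auto simp: maximal_clique_def)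
  qed
qed

lemma finite_clique_of: "finite (clique_of s)"
proof -
  have "x \<in> {t. le t s} \<union> inverse ` {t. le t s}" if "le (rep x) s" for x
    using rep_cases[of x] that by (metis UnI1 UnI2 free_group_inverse_inverse imageI mem_Collect_eq)
  hence "clique_of s \<subseteq> {1, s} \<union> ({t. le t s} \<union> inverse ` {t. le t s})" by (auto simp: clique_of_def)
  thus ?thesis by (rule finite_subset) (simp add: finite_below)
qed

lemma clique_of_basic: "1 \<in> clique_of s" "s \<in> clique_of s"
  by (auto simp: clique_of_def)

text \<open>A translation moves the new edge to \<open>{1, s}\<close>, and every other point of the clique to a common neighbour
  of \<open>1\<close> and \<open>s\<close>.\<close>

lemma new_clique_translates:
  assumes s: "rep s = s" "s \<noteq> 1"
    and S: "\<And>x y. x \<in> S \<Longrightarrow> y \<in> S \<Longrightarrow> le (rep (inverse x * y)) s"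
    and new: "a \<in> S" "b \<in> S" "rep (inverse a * b) = s"
  shows "\<exists>g. \<forall>x\<in>S. g * x \<in> clique_of s"
proof -
  have *: "\<forall>x\<in>S. inverse a * x \<in> clique_of s" if ab: "a \<in> S" "b \<in> S" "inverse a * b = s" for a b
  proof
    fix x assume x: "x \<in> S"
    have "le (rep (inverse a * x)) s" using S[OF ab(1) x] .
    moreover have "inverse (inverse a * x) * s = inverse x * b"
      by (simp add: ab(3)[symmetric] free_group_inverse_mult mult.assoc)
    hence "le (rep (inverse (inverse a * x) * s)) s" using S[OF x ab(2)] by simp
    ultimately show "inverse a * x \<in> clique_of s" by (auto simp: clique_of_def)
  qed
  have "inverse a * b = s \<or> inverse b * a = s"
    using rep_eq_iff[of s "inverse a * b"] s(1) new(3)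
    by (metis free_group_inverse_inverse free_group_inverse_mult)
  thus ?thesis using *[of a b] *[of b a] new(1,2) by blast
qed

end

section \<open>Positive definite functions and translates of cliques\<close>

lemma unital_pd_functionsD:
  assumes "\<phi> \<in> unital_pd_functions \<Sigma>"
  shows "x \<in> \<Sigma> \<Longrightarrow> bounded_operator (\<phi> x)" "\<phi> \<in> extensional \<Sigma>" "positive_definite \<Sigma> \<phi>" "\<phi> 1 = id"
  using assms by (auto simp: unital_pd_functions_def PiE_iff)

lemma pos_semidef_reindex:
  assumes f: "bij_betw f I J"
  shows "pos_semidef J A \<longleftrightarrow> pos_semidef I (\<lambda>i j. A (f i) (f j))"
proof -
  have inj: "inj_on f I" using f by (simp add: bij_betw_def)
  have sum: "(\<Sum>i\<in>I. \<Sum>j\<in>I. cinner (A (f i) (f j) (h (f j))) (h (f i))) =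
      (\<Sum>i\<in>J. \<Sum>j\<in>J. cinner (A i j (h j)) (h i))" for h
    by (simp add: sum.reindex_bij_betw[OF f, of "\<lambda>j. cinner (A _ j (h j)) (h _)"]
        sum.reindex_bij_betw[OF f, of "\<lambda>i. \<Sum>j\<in>J. cinner (A i j (h j)) (h i)"])
  show ?thesis
    unfolding pos_semidef_def
  proof (intro iffI allI)
    fix h
    assume *: "\<forall>h. (\<Sum>i\<in>J. \<Sum>j\<in>J. cinner (A i j (h j)) (h i)) \<in> \<real> \<and>
      0 \<le> Re (\<Sum>i\<in>J. \<Sum>j\<in>J. cinner (A i j (h j)) (h i))"
    have "(\<Sum>i\<in>I. \<Sum>j\<in>I. cinner (A (f i) (f j) (h j)) (h i)) =
        (\<Sum>i\<in>I. \<Sum>j\<in>I. cinner (A (f i) (f j) (h (inv_into I f (f j)))) (h (inv_into I f (f i))))"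
      by (intro sum.cong refl) (simp add: inv_into_f_f[OF inj])
    also have "\<dots> = (\<Sum>i\<in>J. \<Sum>j\<in>J. cinner (A i j (h (inv_into I f j))) (h (inv_into I f i)))"
      by (rule sum)
    finally show "(\<Sum>i\<in>I. \<Sum>j\<in>I. cinner (A (f i) (f j) (h j)) (h i)) \<in> \<real> \<and>
      0 \<le> Re (\<Sum>i\<in>I. \<Sum>j\<in>I. cinner (A (f i) (f j) (h j)) (h i))"
      using *[rule_format, of "\<lambda>j. h (inv_into I f j)"] by simp
  next
    fix h
    assume "\<forall>h. (\<Sum>i\<in>I. \<Sum>j\<in>I. cinner (A (f i) (f j) (h j)) (h i)) \<in> \<real> \<and>
      0 \<le> Re (\<Sum>i\<in>I. \<Sum>j\<in>I. cinner (A (f i) (f j) (h j)) (h i))"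
    from this[rule_format, of "\<lambda>i. h (f i)"]
    show "(\<Sum>i\<in>J. \<Sum>j\<in>J. cinner (A i j (h j)) (h i)) \<in> \<real> \<and>
      0 \<le> Re (\<Sum>i\<in>J. \<Sum>j\<in>J. cinner (A i j (h j)) (h i))" unfolding sum .
  qed
qed

lemma positive_definite_imp_pos_semidef:
  assumes pd: "positive_definite \<Sigma> \<phi>" and fin: "finite S" and S: "\<And>s t. s \<in> S \<Longrightarrow> t \<in> S \<Longrightarrow> inverse s * t \<in> \<Sigma>"
  shows "pos_semidef S (\<lambda>s t. \<phi> (inverse s * t))"
proof -
  obtain f where f: "bij_betw f {0..<card S} S" using ex_bij_betw_nat_finite[OF fin] by blast
  hence f': "bij_betw f {..<card S} S" by (simp add: atLeast0LessThan)
  have "f i \<in> S" if "i < card S" for i using f' that by (auto simp: bij_betw_def)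
  hence "pos_semidef {..<card S} (\<lambda>i j. \<phi> (inverse (f i) * f j))"
    using pd S by (simp add: positive_definite_def)
  thus ?thesis using pos_semidef_reindex[OF f', of "\<lambda>s t. \<phi> (inverse s * t)"] by simp
qed

text \<open>Repetitions among the points of a finite family are removed by adding up the vectors at equal points.\<close>

lemma positive_definiteI:
  assumes bdd: "\<And>x. x \<in> \<Sigma> \<Longrightarrow> bounded_operator (\<phi> x)"
    and psd: "\<And>S. finite S \<Longrightarrow> (\<And>s t. s \<in> S \<Longrightarrow> t \<in> S \<Longrightarrow> inverse s * t \<in> \<Sigma>) \<Longrightarrow>
      pos_semidef S (\<lambda>s t. \<phi> (inverse s * t))"
  shows "positive_definite \<Sigma> \<phi>"
  unfolding positive_definite_def
proof (intro allI impI)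
  fix k :: nat and s assume s: "\<forall>i<k. \<forall>j<k. inverse (s i) * s j \<in> \<Sigma>"
  let ?I = "{..<k}"
  define S where "S = s ` ?I"
  define F where "F t = {i \<in> ?I. s i = t}" for t
  have S: "inverse t * u \<in> \<Sigma>" if "t \<in> S" "u \<in> S" for t u using s that by (auto simp: S_def)
  have "pos_semidef S (\<lambda>t u. \<phi> (inverse t * u))" by (rule psd) (use S in \<open>auto simp: S_def\<close>)
  moreover have "(\<Sum>i\<in>?I. \<Sum>j\<in>?I. cinner (\<phi> (inverse (s i) * s j) (h j)) (h i)) =
      (\<Sum>t\<in>S. \<Sum>u\<in>S. cinner (\<phi> (inverse t * u) (\<Sum>j\<in>F u. h j)) (\<Sum>i\<in>F t. h i))" for h
  proof -
    have img: "sum g ?I = (\<Sum>t\<in>S. \<Sum>i\<in>F t. g i)" for g :: "nat \<Rightarrow> complex"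
      unfolding S_def F_def by (rule sum.image_gen) simp
    have "(\<Sum>i\<in>?I. \<Sum>j\<in>?I. cinner (\<phi> (inverse (s i) * s j) (h j)) (h i)) =
        (\<Sum>t\<in>S. \<Sum>i\<in>F t. \<Sum>u\<in>S. \<Sum>j\<in>F u. cinner (\<phi> (inverse t * u) (h j)) (h i))"
      unfolding img by (intro sum.cong refl) (auto simp: F_def)
    also have "\<dots> = (\<Sum>t\<in>S. \<Sum>u\<in>S. \<Sum>i\<in>F t. \<Sum>j\<in>F u. cinner (\<phi> (inverse t * u) (h j)) (h i))"
      by (intro sum.cong refl sum.swap)
    also have "\<dots> = (\<Sum>t\<in>S. \<Sum>u\<in>S. cinner (\<phi> (inverse t * u) (\<Sum>j\<in>F u. h j)) (\<Sum>i\<in>F t. h i))"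
      by (intro sum.cong refl)
        (simp only: bounded_operatorD(6)[OF bdd[OF S]] cinner_sum_left cinner_sum_right)
    finally show ?thesis .
  qed
  ultimately show "pos_semidef ?I (\<lambda>i j. \<phi> (inverse (s i) * s j))"
    unfolding pos_semidef_def by simp
qed

lemma positive_definite_adjoint:
  assumes \<phi>: "\<phi> \<in> unital_pd_functions \<Sigma>" and x: "x \<in> \<Sigma>" "inverse x \<in> \<Sigma>" "1 \<in> \<Sigma>"
  shows "cinner (\<phi> x g) h = cinner g (\<phi> (inverse x) h)"
proof -
  note D = unital_pd_functionsD[OF \<phi>]
  let ?A = "\<lambda>s t. \<phi> (inverse s * t)"
  have in\<Sigma>: "inverse s * t \<in> \<Sigma>" if "s \<in> {1, x}" "t \<in> {1, x}" for s t using that x by auto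
  have "realizes {1, x} ?A (realization {1, x} ?A)"
    by (rule realization_exists)
      (use in\<Sigma> D(1) in \<open>auto intro!: positive_definite_imp_pos_semidef[OF D(3)]\<close>)
  hence gram: "cinner (realization {1, x} ?A j g) (realization {1, x} ?A i h) = cinner (?A i j g) h"
    if "i \<in> {1, x}" "j \<in> {1, x}" for i j g h
    using that unfolding realizes_def by blast
  have "cinner (\<phi> x g) h = cinner (realization {1, x} ?A x g) (realization {1, x} ?A 1 h)"
    by (subst gram) auto
  also have "\<dots> = cnj (cinner (realization {1, x} ?A 1 h) (realization {1, x} ?A x g))"
    by (rule cinner_commute)
  also have "\<dots> = cnj (cinner (\<phi> (inverse x) h) g)" by (subst gram) auto
  also have "\<dots> = cinner g (\<phi> (inverse x) h)" by (rule cinner_commute[symmetric])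
  finally show ?thesis .
qed

lemma restrict_unital_pd:
  assumes \<phi>: "\<phi> \<in> unital_pd_functions \<Sigma>" and sub: "\<Sigma>' \<subseteq> \<Sigma>" "1 \<in> \<Sigma>'"
  shows "restrict \<phi> \<Sigma>' \<in> unital_pd_functions \<Sigma>'"
proof -
  note D = unital_pd_functionsD[OF \<phi>]
  have "positive_definite \<Sigma>' (restrict \<phi> \<Sigma>')"
    unfolding positive_definite_def
  proof (intro allI impI)
    fix k :: nat and s assume s: "\<forall>i<k. \<forall>j<k. inverse (s i) * s j \<in> \<Sigma>'"
    hence "pos_semidef {..<k} (\<lambda>i j. \<phi> (inverse (s i) * s j))"
      using D(3) sub(1) by (simp add: positive_definite_def subset_iff)
    thus "pos_semidef {..<k} (\<lambda>i j. restrict \<phi> \<Sigma>' (inverse (s i) * s j))"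
      by (rule pos_semidef_cong[THEN iffD1, rotated]) (use s in simp)
  qed
  thus ?thesis using D sub by (auto simp: unital_pd_functions_def)
qed

text \<open>Left translation does not change \<open>s\<^sup>-\<^sup>1 t\<close>.\<close>

lemma pos_semidef_translate:
  fixes \<phi> :: "'a free_group \<Rightarrow> 'h::chilbert_space \<Rightarrow> 'h"
  assumes psd: "pos_semidef C (\<lambda>s t. \<phi> (inverse s * t))" and fin: "finite C"
    and bdd: "\<And>s t. s \<in> C \<Longrightarrow> t \<in> C \<Longrightarrow> bounded_operator (\<phi> (inverse s * t))"
    and S: "\<And>x. x \<in> S \<Longrightarrow> g * x \<in> C"
  shows "pos_semidef S (\<lambda>s t. \<phi> (inverse s * t))"
proof -
  have "inj_on ((*) g) S" by (rule inj_on_inverseI[of _ "(*) (inverse g)"]) simp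
  hence bij: "bij_betw ((*) g) S ((*) g ` S)" by (rule inj_on_imp_bij_betw)
  have "pos_semidef ((*) g ` S) (\<lambda>s t. \<phi> (inverse s * t))"
    by (rule pos_semidef_subset[OF fin psd]) (use S bdd in auto)
  thus ?thesis unfolding pos_semidef_reindex[OF bij]
    by (simp add: free_group_inverse_mult mult.assoc)
qed

lemma group_matrix_apply: "s \<in> S \<Longrightarrow> t \<in> S \<Longrightarrow> group_matrix \<phi> S s t = \<phi> (inverse s * t)"
  by (simp add: group_matrix_def)

lemma group_matrix_cong:
  assumes "\<And>s t. s \<in> S \<Longrightarrow> t \<in> S \<Longrightarrow> \<phi> (inverse s * t) = \<psi> (inverse s * t)"
  shows "group_matrix \<phi> S = group_matrix \<psi> S"
  using assms by (auto simp: group_matrix_def fun_eq_iff restrict_def)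

lemma submatrix_group_matrix: "J \<subseteq> S \<Longrightarrow> submatrix (group_matrix \<phi> S) J = group_matrix \<phi> J"
  by (auto simp: group_matrix_def submatrix_def fun_eq_iff restrict_def subset_iff)

lemma group_matrix_psd:
  assumes \<phi>: "\<phi> \<in> unital_pd_functions \<Sigma>" and fin: "finite S"
    and S: "\<And>s t. s \<in> S \<Longrightarrow> t \<in> S \<Longrightarrow> inverse s * t \<in> \<Sigma>"
  shows "pos_semidef S (group_matrix \<phi> S)"
    and "s \<in> S \<Longrightarrow> t \<in> S \<Longrightarrow> bounded_operator (group_matrix \<phi> S s t)"
    and "realizes S (group_matrix \<phi> S) (realization S (group_matrix \<phi> S))"
proof -
  note D = unital_pd_functionsD[OF \<phi>]
  have "pos_semidef S (\<lambda>s t. \<phi> (inverse s * t))"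
    by (rule positive_definite_imp_pos_semidef[OF D(3) fin S])
  thus 1: "pos_semidef S (group_matrix \<phi> S)"
    by (rule pos_semidef_cong[THEN iffD1, rotated]) (simp add: group_matrix_apply)
  show 2: "bounded_operator (group_matrix \<phi> S s t)" if "s \<in> S" "t \<in> S" for s t
    using D(1) S that by (simp add: group_matrix_apply)
  show "realizes S (group_matrix \<phi> S) (realization S (group_matrix \<phi> S))"
    by (rule realization_exists[OF fin 1 2])
qed

section \<open>One step of the extension\<close>

context lexicographic
begin

text \<open>For \<open>s\<close> the least element of the class \<open>\<mu>\<close> these are \<open>\<Sigma>\<^sub>\<mu>\<close> and \<open>\<Sigma>\<close> of the predecessor, and \<open>omega1\<close> and \<open>omega2\<close> realize the
  parts of the matrix over \<open>C\<^sub>\<mu>\<close> that omit \<open>s\<close> and \<open>1\<close>.\<close>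

abbreviation Sigma_le :: "'a free_group \<Rightarrow> 'a free_group set" where
  "Sigma_le s \<equiv> Sigma_upto le (inv_class s)"

abbreviation Sigma_less :: "'a free_group \<Rightarrow> 'a free_group set" where
  "Sigma_less s \<equiv> Sigma_upto le (pred_class le (inv_class s))"

definition omega1 :: "'a free_group \<Rightarrow> ('a free_group \<Rightarrow> 'h::chilbert_space \<Rightarrow> 'h) \<Rightarrow>
    'a free_group \<Rightarrow> 'h \<Rightarrow> ('a free_group, 'h) ell2" where
  "omega1 s \<psi> = realization (clique_of s - {s}) (group_matrix \<psi> (clique_of s - {s}))"

definition omega2 :: "'a free_group \<Rightarrow> ('a free_group \<Rightarrow> 'h::chilbert_space \<Rightarrow> 'h) \<Rightarrow>
    'a free_group \<Rightarrow> 'h \<Rightarrow> ('a free_group, 'h) ell2" where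
  "omega2 s \<psi> = realization (clique_of s - {1}) (group_matrix \<psi> (clique_of s - {1}))"

lemma Sigma_le_split:
  assumes s: "rep s = s" "s \<noteq> 1"
  shows "Sigma_le s = Sigma_less s \<union> {s, inverse s}" "s \<notin> Sigma_less s" "inverse s \<notin> Sigma_less s" "1 \<in> Sigma_less s"
proof -
  have *: "rep x = s \<longleftrightarrow> x = s \<or> x = inverse s" for x using rep_eq_iff[of s x] s(1) by auto
  have "x \<in> Sigma_le s \<longleftrightarrow> x \<in> Sigma_less s \<union> {s, inverse s}" for x
    unfolding Sigma_upto_iff Un_iff Sigma_pred_iff[OF s] using *[of x] s(1) le_refl[of s] by auto
  thus "Sigma_le s = Sigma_less s \<union> {s, inverse s}" by blast
  show "s \<notin> Sigma_less s" "inverse s \<notin> Sigma_less s" "1 \<in> Sigma_less s"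
    using s le_1 by (auto simp: Sigma_pred_iff[OF s])
qed

lemma clique_of_mem:
  assumes s: "rep s = s" "s \<noteq> 1" and ij: "i \<in> clique_of s" "j \<in> clique_of s"
  shows "inverse i * j \<in> Sigma_le s" "{i, j} \<noteq> {1, s} \<Longrightarrow> inverse i * j \<in> Sigma_less s"
  using clique_of_edges_le[OF s ij] clique_of_edges[OF s ij] s by (auto simp: Sigma_upto_iff Sigma_pred_iff[OF s])

lemma not_self_inverse: "s \<noteq> 1 \<Longrightarrow> s \<noteq> inverse (s :: 'a free_group)"
proof
  assume "s \<noteq> 1" "s = inverse s"
  hence "s * s = 1" by (metis free_group_cancel(4))
  thus False using word_length_square[OF \<open>s \<noteq> 1\<close>] by (simp add: word_length_def)
qed

context
  fixes s :: "'a free_group" and \<psi> :: "'a free_group \<Rightarrow> 'h::chilbert_space \<Rightarrow> 'h"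
  assumes s: "rep s = s" "s \<noteq> 1" and \<psi>: "\<psi> \<in> unital_pd_functions (Sigma_less s)"
begin

lemma clique_of_minus_mem:
  "i \<in> clique_of s - {s} \<Longrightarrow> j \<in> clique_of s - {s} \<Longrightarrow> inverse i * j \<in> Sigma_less s"
  "i \<in> clique_of s - {1} \<Longrightarrow> j \<in> clique_of s - {1} \<Longrightarrow> inverse i * j \<in> Sigma_less s"
  by (rule clique_of_mem(2)[OF s]; use s in \<open>auto simp: doubleton_eq_iff\<close>)+

lemma omega_realizes:
  "realizes (clique_of s - {s}) (group_matrix \<psi> (clique_of s - {s})) (omega1 s \<psi>)"
  "realizes (clique_of s - {1}) (group_matrix \<psi> (clique_of s - {1})) (omega2 s \<psi>)"
  unfolding omega1_def omega2_def
  by (rule group_matrix_psd(3)[OF \<psi>]; use finite_clique_of clique_of_minus_mem in auto)+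

lemma cinner_omega1:
  "i \<in> clique_of s - {s} \<Longrightarrow> j \<in> clique_of s - {s} \<Longrightarrow> cinner (omega1 s \<psi> j g) (omega1 s \<psi> i h) = cinner (\<psi> (inverse i * j) g) h"
  using omega_realizes(1) by (simp add: realizes_def group_matrix_apply)

lemma cinner_omega2:
  "i \<in> clique_of s - {1} \<Longrightarrow> j \<in> clique_of s - {1} \<Longrightarrow> cinner (omega2 s \<psi> j g) (omega2 s \<psi> i h) = cinner (\<psi> (inverse i * j) g) h"
  using omega_realizes(2) by (simp add: realizes_def group_matrix_apply)

lemma missing: "missing_entry (clique_of s) 1 s (omega1 s \<psi>) (omega2 s \<psi>)"
proof
  show "bounded_operator (omega1 s \<psi> j)" if "j \<in> clique_of s - {s}" for j
    using omega_realizes(1) that by (simp add: realizes_def)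
  show "bounded_operator (omega2 s \<psi> j)" if "j \<in> clique_of s - {1}" for j
    using omega_realizes(2) that by (simp add: realizes_def)
  show "cinner (omega1 s \<psi> j g) (omega1 s \<psi> i h) = cinner (omega2 s \<psi> j g) (omega2 s \<psi> i h)"
    if "i \<in> clique_of s - {1, s}" "j \<in> clique_of s - {1, s}" for i j g h
    using that by (simp add: cinner_omega1 cinner_omega2)
qed (use s finite_clique_of clique_of_basic in auto)

interpretation missing_entry "clique_of s" 1 s "omega1 s \<psi>" "omega2 s \<psi>"
  by (rule missing)

lemma D_space_eq: "D_space le (inv_class s) \<psi> = D"
  unfolding D_def S\<^sub>1_def M\<^sub>1_def
  by (simp add: D_space_def the_clique_eq[OF s] min_rep_inv_class s Let_def realization_space_def omega1_def)

lemma R_space_eq: "R_space le (inv_class s) \<psi> = R"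
  unfolding R_def S\<^sub>2_def M\<^sub>2_def
  by (simp add: R_space_def the_clique_eq[OF s] min_rep_inv_class s Let_def realization_space_def omega2_def)

text \<open>The inner product \<open>\<langle>\<psi>' (s\<^sup>-\<^sup>1) h, g\<rangle>\<close> for the extension \<open>\<psi>'\<close> of \<open>\<psi>\<close> with parameter \<open>c\<close>.\<close>

definition "new_entry c h g = cinner (W c (omega1 s \<psi> 1 h)) (omega2 s \<psi> s g)"

text \<open>Under the identifications, the matrix of \<open>\<phi>\<close> over \<open>C\<^sub>\<mu>\<close> is a completion of the matrix given by \<open>\<psi>\<close>, and \<open>gamma\<close> is its
  angle operator.\<close>

lemma gamma_step:
  fixes \<phi> :: "'a free_group \<Rightarrow> 'h \<Rightarrow> 'h"
  assumes \<phi>: "\<phi> \<in> unital_pd_functions \<Sigma>" and sub: "Sigma_le s \<subseteq> \<Sigma>" and res: "restrict \<phi> (Sigma_less s) = \<psi>"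
  shows "contraction_between (D_space le (inv_class s) \<psi>) (R_space le (inv_class s) \<psi>) (gamma le (inv_class s) \<phi>)"
    and "contraction_between (D_space le (inv_class s) \<psi>) (R_space le (inv_class s) \<psi>) c \<Longrightarrow>
      gamma le (inv_class s) \<phi> = c \<longleftrightarrow> (\<forall>h g. cinner (\<phi> (inverse s) h) g = new_entry c h g)"
proof -
  let ?A = "group_matrix \<phi> (clique_of s)"
  have mem: "inverse i * j \<in> \<Sigma>" if "i \<in> clique_of s" "j \<in> clique_of s" for i j
    using clique_of_mem(1)[OF s that] sub by auto
  have gm: "pos_semidef (clique_of s) ?A" "realizes (clique_of s) ?A (realization (clique_of s) ?A)"
    "\<And>i j. i \<in> clique_of s \<Longrightarrow> j \<in> clique_of s \<Longrightarrow> bounded_operator (?A i j)"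
    using group_matrix_psd[OF \<phi> finite_clique_of[of s] mem] by auto
  have sub1: "submatrix ?A (clique_of s - {s}) = group_matrix \<psi> (clique_of s - {s})"
    unfolding submatrix_group_matrix[OF Diff_subset]
    by (rule group_matrix_cong) (simp only: res[symmetric] restrict_apply' clique_of_minus_mem)
  have sub2: "submatrix ?A (clique_of s - {1}) = group_matrix \<psi> (clique_of s - {1})"
    unfolding submatrix_group_matrix[OF Diff_subset]
    by (rule group_matrix_cong) (simp only: res[symmetric] restrict_apply' clique_of_minus_mem)
  note id1 = identification[OF finite_clique_of gm(1) Diff_subset[of "clique_of s" "{s}"] gm(3), unfolded sub1]
  note id2 = identification[OF finite_clique_of gm(1) Diff_subset[of "clique_of s" "{1}"] gm(3), unfolded sub2]
  interpret ce: completed_entry "clique_of s" 1 s "omega1 s \<psi>" "omega2 s \<psi>" "realization (clique_of s) ?A"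
    "realization_space (clique_of s) ?A" "identification (clique_of s) ?A (clique_of s - {s})"
    "identification (clique_of s) ?A (clique_of s - {1})"
  proof
    show "isometry_between S\<^sub>1 (realization_space (clique_of s) ?A) (identification (clique_of s) ?A (clique_of s - {s}))"
      using id1(1) unfolding S\<^sub>1_def by (simp add: omega1_def realization_space_def)
    show "isometry_between S\<^sub>2 (realization_space (clique_of s) ?A) (identification (clique_of s) ?A (clique_of s - {1}))"
      using id2(1) unfolding S\<^sub>2_def by (simp add: omega2_def realization_space_def)
  qed (use id1(2) id2(2) in \<open>auto simp: omega1_def omega2_def\<close>)
  have angle: "gamma le (inv_class s) \<phi> = ce.angle"
    by (simp add: gamma_def the_clique_eq[OF s] min_rep_inv_class s Let_def res D_space_eq R_space_eq
        ce.angle_def)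
  show "contraction_between (D_space le (inv_class s) \<psi>) (R_space le (inv_class s) \<psi>) (gamma le (inv_class s) \<phi>)"
    unfolding angle D_space_eq R_space_eq by (rule ce.angle_contraction)
  assume "contraction_between (D_space le (inv_class s) \<psi>) (R_space le (inv_class s) \<psi>) c"
  hence c: "contraction_between D R c" by (simp add: D_space_eq R_space_eq)
  have "cinner (realization (clique_of s) ?A 1 h) (realization (clique_of s) ?A s g) = cinner (\<phi> (inverse s) h) g" for h g
    using gm(2) clique_of_basic[of s] by (simp add: realizes_def group_matrix_apply)
  thus "gamma le (inv_class s) \<phi> = c \<longleftrightarrow> (\<forall>h g. cinner (\<phi> (inverse s) h) g = new_entry c h g)"
    unfolding angle ce.angle_eq_iff[OF c] new_entry_def by simp
qed

text \<open>The missing entries \<open>\<psi>' s\<close> and \<open>\<psi>' (s\<^sup>-\<^sup>1)\<close> are read off from the compression \<open>W c\<close> with the help of adjoints.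
  Completing the single matrix over \<open>C\<^sub>\<mu>\<close> suffices, because a finite set with differences in \<open>\<Sigma>\<^sub>\<mu>\<close> has
  all its differences in the smaller set or is a translate of a part of \<open>C\<^sub>\<mu>\<close>.\<close>

lemma extension_exists:
  assumes c': "contraction_between (D_space le (inv_class s) \<psi>) (R_space le (inv_class s) \<psi>) c"
  shows "\<exists>\<psi>'. \<psi>' \<in> unital_pd_functions (Sigma_le s) \<and> restrict \<psi>' (Sigma_less s) = \<psi> \<and> gamma le (inv_class s) \<psi>' = c"
proof -
  note P = unital_pd_functionsD[OF \<psi>]
  have c: "contraction_between D R c" using c' by (simp add: D_space_eq R_space_eq)
  hence cl: "linear_between D R c" by (simp add: contraction_between_def)
  note Wc = W_contraction[OF c]
  hence Wl: "linear_between S\<^sub>1 S\<^sub>2 (W c)" by (simp add: contraction_between_def)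
  have es: "1 \<in> clique_of s - {s}" "s \<in> clique_of s - {1}" using s clique_of_basic by auto
  define B where "B h = W c (omega1 s \<psi> 1 h)" for h
  have B: "bounded_operator B"
  proof -
    note o = bounded_operatorD[OF \<omega>\<^sub>1[OF es(1)]]
    obtain K where K: "\<And>h. norm (omega1 s \<psi> 1 h) \<le> norm h * K"
      using bounded_linear.bounded[OF o(1)] by blast
    have "norm (B h) \<le> norm h * K" for h
      using K[of h] Wc gen_in(1)[OF es(1), of h] by (auto simp: B_def contraction_between_def intro: order.trans)
    thus ?thesis
      using linear_betweenD[OF Wl] gen_in(1)[OF es(1)] by (intro bounded_operatorI[of B K]) (simp_all add: B_def o)
  qed
  obtain B' where B': "bounded_operator B'" "\<And>x y. cinner (B x) y = cinner x (B' y)"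
    using adjoint_exists[OF B] by blast
  obtain O' where O': "bounded_operator O'" "\<And>x y. cinner (omega2 s \<psi> s x) y = cinner x (O' y)"
    using adjoint_exists[OF \<omega>\<^sub>2[OF es(2)]] by blast
  define \<psi>' where "\<psi>' x = (if x = s then \<lambda>g. B' (omega2 s \<psi> s g) else if x = inverse s then \<lambda>h. O' (B h) else \<psi> x)" for x
  note S = Sigma_le_split[OF s]
  have old: "\<psi>' x = \<psi> x" if "x \<in> Sigma_less s" for x using that S by (auto simp: \<psi>'_def)
  have new: "cinner (\<psi>' s g) h = cinner (omega2 s \<psi> s g) (B h)" "cinner (\<psi>' (inverse s) h) g = cinner (B h) (omega2 s \<psi> s g)" for g h
  proof -
    show "cinner (\<psi>' s g) h = cinner (omega2 s \<psi> s g) (B h)"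
      using cinner_flip[OF B'(2)] by (simp add: \<psi>'_def)
    show "cinner (\<psi>' (inverse s) h) g = cinner (B h) (omega2 s \<psi> s g)"
      using cinner_flip[OF O'(2)] not_self_inverse[OF s(2)] by (simp add: \<psi>'_def)
  qed
  have bdd: "bounded_operator (\<psi>' x)" if "x \<in> Sigma_le s" for x
    using that S(1) P(1) bounded_operator_compose[OF B'(1) \<omega>\<^sub>2[OF es(2)]] bounded_operator_compose[OF O'(1) B]
    by (auto simp: \<psi>'_def)
  have psdC: "pos_semidef (clique_of s) (\<lambda>i j. \<psi>' (inverse i * j))"
  proof (rule completion_pos_semidef[OF c])
    show "cinner (\<psi>' (inverse i * j) g) h = cinner (omega1 s \<psi> j g) (omega1 s \<psi> i h)"
      if "i \<in> clique_of s - {s}" "j \<in> clique_of s - {s}" for i j g h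
      using that by (simp only: old[OF clique_of_minus_mem(1)] cinner_omega1)
    have omega2: "cinner (\<psi>' (inverse i * j) g) h = cinner (omega2 s \<psi> j g) (omega2 s \<psi> i h)"
      if "i \<in> clique_of s - {1}" "j \<in> clique_of s - {1}" for i j g h
      using that by (simp only: old[OF clique_of_minus_mem(2)] cinner_omega2)
    show "cinner (\<psi>' (inverse s * s) g) h = cinner (omega2 s \<psi> s g) (omega2 s \<psi> s h)" for g h
      by (rule omega2[OF es(2) es(2)])
    fix j g h assume j: "j \<in> clique_of s - {s}"
    show "cinner (\<psi>' (inverse s * j) g) h = cinner (W c (omega1 s \<psi> j g)) (omega2 s \<psi> s h)"
    proof (cases "j = 1")
      case False
      thus ?thesis using j omega2[OF es(2), of j] W_gen[OF cl, of j] by simp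
    qed (simp add: new B_def)
    show "cinner (\<psi>' (inverse j * s) g) h = cinner (omega2 s \<psi> s g) (W c (omega1 s \<psi> j h))"
    proof (cases "j = 1")
      case False
      thus ?thesis using j omega2[OF _ es(2), of j] W_gen[OF cl, of j] by simp
    qed (simp add: new B_def)
  qed
  have "positive_definite (Sigma_le s) \<psi>'"
  proof (rule positive_definiteI[OF bdd])
    fix T assume fin: "finite T" and T: "\<And>x y. x \<in> T \<Longrightarrow> y \<in> T \<Longrightarrow> inverse x * y \<in> Sigma_le s"
    show "pos_semidef T (\<lambda>x y. \<psi>' (inverse x * y))"
    proof (cases "\<forall>x\<in>T. \<forall>y\<in>T. inverse x * y \<in> Sigma_less s")
      case True
      have "pos_semidef T (\<lambda>x y. \<psi> (inverse x * y))"
        by (rule positive_definite_imp_pos_semidef[OF P(3) fin]) (use True in auto)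
      thus ?thesis by (rule pos_semidef_cong[THEN iffD1, rotated]) (use True old in auto)
    next
      case False
      then obtain a b where ab: "a \<in> T" "b \<in> T" "inverse a * b \<notin> Sigma_less s" by blast
      have T': "le (rep (inverse x * y)) s" if "x \<in> T" "y \<in> T" for x y
        using T[OF that] s by (simp add: Sigma_upto_iff)
      hence "rep (inverse a * b) = s" using ab by (simp add: Sigma_pred_iff[OF s])
      then obtain g where "\<forall>x\<in>T. g * x \<in> clique_of s" using new_clique_translates[OF s T' ab(1,2)] by blast
      thus ?thesis
        by (intro pos_semidef_translate[OF psdC finite_clique_of bdd[OF clique_of_mem(1)[OF s]]]) auto
    qed
  qed
  moreover have "\<psi>' \<in> extensional (Sigma_le s)"
    using P(2) S(1) by (auto simp: extensional_def \<psi>'_def)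
  ultimately have U: "\<psi>' \<in> unital_pd_functions (Sigma_le s)"
    using bdd old[OF S(4)] P(4) by (simp add: unital_pd_functions_def PiE_iff)
  have res: "restrict \<psi>' (Sigma_less s) = \<psi>"
    by (rule extensionalityI[of _ "Sigma_less s"]) (use P(2) old in auto)
  have "gamma le (inv_class s) \<psi>' = c"
    unfolding gamma_step(2)[OF U subset_refl res c'] new_entry_def by (simp add: new B_def)
  thus ?thesis using U res by blast
qed

end

text \<open>The parameter determines the value at \<open>s\<^sup>-\<^sup>1\<close>, and the value at \<open>s\<close> is its adjoint.\<close>

lemma extension_unique:
  fixes \<phi> \<phi>' :: "'a free_group \<Rightarrow> 'h::chilbert_space \<Rightarrow> 'h"
  assumes s: "rep s = s" "s \<noteq> 1"
    and \<phi>: "\<phi> \<in> unital_pd_functions \<Sigma>" "Sigma_le s \<subseteq> \<Sigma>" and \<phi>': "\<phi>' \<in> unital_pd_functions \<Sigma>'" "Sigma_le s \<subseteq> \<Sigma>'"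
    and res: "restrict \<phi> (Sigma_less s) = restrict \<phi>' (Sigma_less s)"
    and gam: "gamma le (inv_class s) \<phi> = gamma le (inv_class s) \<phi>'"
  shows "restrict \<phi> (Sigma_le s) = restrict \<phi>' (Sigma_le s)"
proof -
  note S = Sigma_le_split[OF s]
  define \<psi> where "\<psi> = restrict \<phi> (Sigma_less s)"
  have \<psi>: "\<psi> \<in> unital_pd_functions (Sigma_less s)"
    unfolding \<psi>_def by (rule restrict_unital_pd[OF \<phi>(1)]) (use S \<phi>(2) in auto)
  note g = gamma_step[OF s \<psi> \<phi> \<psi>_def[symmetric]]
  have res': "restrict \<phi>' (Sigma_less s) = \<psi>" using res by (simp add: \<psi>_def)
  have "cinner (\<phi> (inverse s) h) k = cinner (\<phi>' (inverse s) h) k" for h k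
    using g(2)[OF g(1)] gamma_step(2)[OF s \<psi> \<phi>' res' g(1)] gam by simp
  hence inv: "\<phi> (inverse s) = \<phi>' (inverse s)" by (rule ext[OF cinner_left_cancel])
  have mem: "s \<in> Sigma_le s" "inverse s \<in> Sigma_le s" "1 \<in> Sigma_le s" using S by auto
  have "cinner (\<phi> s h) k = cinner (\<phi>' s h) k" for h k
    using positive_definite_adjoint[OF \<phi>(1) mem[THEN subsetD[OF \<phi>(2)]]]
      positive_definite_adjoint[OF \<phi>'(1) mem[THEN subsetD[OF \<phi>'(2)]]] inv by simp
  hence s_eq: "\<phi> s = \<phi>' s" by (rule ext[OF cinner_left_cancel])
  have "\<phi> x = \<phi>' x" if "x \<in> Sigma_le s" for x
  proof -
    have "x = s \<or> x = inverse s \<or> x \<in> Sigma_less s" using that S(1) by auto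
    moreover have "\<phi> x = \<phi>' x" if "x \<in> Sigma_less s" using fun_cong[OF res, of x] that by simp
    ultimately show ?thesis using s_eq inv by auto
  qed
  thus ?thesis by (auto simp: restrict_def fun_eq_iff)
qed

section \<open>The correspondence\<close>

lemma Sigma_le_mono: "rep s = s \<Longrightarrow> rep t = t \<Longrightarrow> le s t \<Longrightarrow> Sigma_le s \<subseteq> Sigma_le t"
  using le_trans by (auto simp: Sigma_upto_iff)

lemma Sigma_le_1: "Sigma_le 1 = {1}"
proof -
  have *: "le (rep x) 1 \<longleftrightarrow> x = 1" for x
  proof
    assume "le (rep x) 1"
    hence "rep x = rep 1" using le_1 le_antisym by simp
    thus "x = 1" using rep_eq_iff[of 1 x] by auto
  qed (simp add: le_refl)
  show ?thesis by (rule set_eqI) (simp add: Sigma_upto_iff *)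
qed

lemma gamma_restrict:
  assumes s: "rep s = s" "s \<noteq> 1" and sub: "Sigma_le s \<subseteq> T"
  shows "gamma le (inv_class s) (restrict \<phi> T) = gamma le (inv_class s) \<phi>"
proof -
  have "group_matrix (restrict \<phi> T) (clique_of s) = group_matrix \<phi> (clique_of s)"
    by (rule group_matrix_cong) (use clique_of_mem(1)[OF s] sub in auto)
  moreover have "restrict (restrict \<phi> T) (Sigma_less s) = restrict \<phi> (Sigma_less s)"
    using Sigma_le_split(1)[OF s] sub by (auto simp: restrict_def fun_eq_iff)
  ultimately show ?thesis by (simp add: gamma_def the_clique_eq[OF s] Let_def)
qed

lemma determined_by_parameters:
  fixes \<phi> \<phi>' :: "'a free_group \<Rightarrow> 'h::chilbert_space \<Rightarrow> 'h"
  assumes t: "rep t = t"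
    and \<phi>: "\<phi> \<in> unital_pd_functions \<Sigma>" "Sigma_le t \<subseteq> \<Sigma>" and \<phi>': "\<phi>' \<in> unital_pd_functions \<Sigma>'" "Sigma_le t \<subseteq> \<Sigma>'"
    and gam: "\<And>s. rep s = s \<Longrightarrow> s \<noteq> 1 \<Longrightarrow> le s t \<Longrightarrow> gamma le (inv_class s) \<phi> = gamma le (inv_class s) \<phi>'"
  shows "restrict \<phi> (Sigma_le t) = restrict \<phi>' (Sigma_le t)"
  using t \<phi>(2) \<phi>'(2) gam
proof (induction t rule: rep_induct)
  case (less t)
  show ?case
  proof (cases "t = 1")
    case True
    thus ?thesis
      using unital_pd_functionsD(4)[OF \<phi>(1)] unital_pd_functionsD(4)[OF \<phi>'(1)]
      by (auto simp: Sigma_le_1 restrict_def fun_eq_iff)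
  next
    case False
    note t = less.hyps False
    obtain p where p: "rep p = p" "pred_class le (inv_class t) = inv_class p"
        "\<And>x. le (rep x) p \<longleftrightarrow> le (rep x) t \<and> rep x \<noteq> t"
      using predecessor[OF t] by (elim exE conjE) simp
    have pt: "le p t" "p \<noteq> t" using p(3)[of p] p(1) le_refl by auto
    have sub: "Sigma_le p \<subseteq> Sigma_le t" by (rule Sigma_le_mono[OF p(1) less.hyps pt(1)])
    have "restrict \<phi> (Sigma_le p) = restrict \<phi>' (Sigma_le p)"
      by (rule less.IH[OF p(1) pt]) (use less.prems sub le_trans pt in blast)+
    thus ?thesis
      by (intro extension_unique[OF t \<phi>(1) less.prems(1) \<phi>'(1) less.prems(2)])
        (simp_all add: p(2) less.prems(3) t le_refl)
  qed
qed

lemma trivial_function: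
  "(\<lambda>x\<in>{1}. id :: 'h::chilbert_space \<Rightarrow> 'h) \<in> unital_pd_functions {1 :: 'a free_group}"
proof -
  have "positive_definite {1} (\<lambda>x\<in>{1 :: 'a free_group}. id :: 'h \<Rightarrow> 'h)"
  proof (rule positive_definiteI)
    show "bounded_operator ((\<lambda>x\<in>{1}. id :: 'h \<Rightarrow> 'h) x)" if "x \<in> {1}" for x
      using that by (simp add: bounded_operator_def id_def)
    fix S :: "'a free_group set" assume "finite S" and S: "\<And>s t. s \<in> S \<Longrightarrow> t \<in> S \<Longrightarrow> inverse s * t \<in> {1}"
    hence "S = {} \<or> (\<exists>a. S = {a})" by (metis empty_iff free_group_inverse_mult_eq_one is_singletonI' is_singleton_def singletonD)
    thus "pos_semidef S (\<lambda>s t. (\<lambda>x\<in>{1}. id :: 'h \<Rightarrow> 'h) (inverse s * t))"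
      by (auto simp: pos_semidef_def cinner_self simp del: of_real_power)
  qed
  thus ?thesis by (auto simp: unital_pd_functions_def bounded_operator_def id_def)
qed

lemma partial_function_exists:
  fixes c :: "'a free_group set \<Rightarrow> ('a free_group, 'h::chilbert_space) ell2 \<Rightarrow> ('a free_group, 'h) ell2"
  assumes c: "c \<in> contraction_sequences le" and t: "rep t = t"
  shows "\<exists>\<psi> \<in> unital_pd_functions (Sigma_le t). \<forall>s. rep s = s \<and> s \<noteq> 1 \<and> le s t \<longrightarrow> gamma le (inv_class s) \<psi> = c (inv_class s)"
  using t
proof (induction t rule: rep_induct)
  case (less t)
  show ?case
  proof (cases "t = 1")
    case True
    have "\<not> (rep s = s \<and> s \<noteq> 1 \<and> le s t)" for s using True le_1 le_antisym by metis
    thus ?thesis using trivial_function True by (auto simp: Sigma_le_1)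
  next
    case False
    note t = less.hyps False
    obtain p where p: "rep p = p" "pred_class le (inv_class t) = inv_class p"
        "\<And>x. le (rep x) p \<longleftrightarrow> le (rep x) t \<and> rep x \<noteq> t"
      using predecessor[OF t] by (elim exE conjE) simp
    have pt: "le p t" "p \<noteq> t" using p(3)[of p] p(1) le_refl by auto
    obtain \<psi> :: "'a free_group \<Rightarrow> 'h \<Rightarrow> 'h" where \<psi>: "\<psi> \<in> unital_pd_functions (Sigma_le p)"
        "\<And>s. rep s = s \<Longrightarrow> s \<noteq> 1 \<Longrightarrow> le s p \<Longrightarrow> gamma le (inv_class s) \<psi> = c (inv_class s)"
      using less.IH[OF p(1) pt] by blast
    have "gamma le \<mu> \<psi> = c \<mu>" if \<mu>: "\<mu> \<in> nontrivial_classes" "class_less le \<mu> (inv_class t)" for \<mu>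
    proof -
      obtain s where s: "\<mu> = inv_class s" "rep s = s" "s \<noteq> 1" using \<mu>(1) by (auto simp: nontrivial_classes_eq)
      hence "le s p" using \<mu>(2) p(3)[of s] t by (simp add: class_less_iff)
      thus ?thesis using \<psi>(2) s by blast
    qed
    moreover have "inv_class t \<in> nontrivial_classes" using t by (auto simp: nontrivial_classes_eq)
    ultimately have con: "contraction_between (D_space le (inv_class t) \<psi>) (R_space le (inv_class t) \<psi>) (c (inv_class t))"
      using c \<psi>(1) by (simp add: contraction_sequences_def p(2))
    obtain \<psi>' where \<psi>': "\<psi>' \<in> unital_pd_functions (Sigma_le t)" "restrict \<psi>' (Sigma_le p) = \<psi>"
        "gamma le (inv_class t) \<psi>' = c (inv_class t)"
      using extension_exists[OF t _ con] \<psi>(1) unfolding p(2) by blast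
    have "gamma le (inv_class s) \<psi>' = c (inv_class s)" if s: "rep s = s" "s \<noteq> 1" "le s t" for s
    proof (cases "s = t")
      case False
      hence sp: "le s p" using p(3)[of s] s by simp
      have "gamma le (inv_class s) \<psi>' = gamma le (inv_class s) \<psi>"
        unfolding \<psi>'(2)[symmetric] by (rule gamma_restrict[OF s(1,2) Sigma_le_mono[OF s(1) p(1) sp], symmetric])
      thus ?thesis using \<psi>(2)[OF s(1,2) sp] by simp
    qed (simp add: \<psi>'(3))
    thus ?thesis using \<psi>'(1) by blast
  qed
qed

text \<open>The functions on the sets \<open>\<Sigma>\<^sub>\<mu>\<close> with the given parameters are restrictions of each other by uniqueness. Their
  union is positive definite since finitely many group elements lie in a common \<open>\<Sigma>\<^sub>\<mu>\<close>.\<close>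

lemma parameters_surjective:
  fixes c :: "'a free_group set \<Rightarrow> ('a free_group, 'h::chilbert_space) ell2 \<Rightarrow> ('a free_group, 'h) ell2"
  assumes c: "c \<in> contraction_sequences le"
  shows "\<exists>\<Phi> \<in> unital_pd_functions UNIV. parameters le \<Phi> = c"
proof -
  have "\<forall>t. \<exists>\<psi>. rep t = t \<longrightarrow> \<psi> \<in> unital_pd_functions (Sigma_le t) \<and>
      (\<forall>s. rep s = s \<and> s \<noteq> 1 \<and> le s t \<longrightarrow> gamma le (inv_class s) \<psi> = c (inv_class s))"
    using partial_function_exists[OF c] by blast
  from choice[OF this] obtain \<Psi> :: "'a free_group \<Rightarrow> 'a free_group \<Rightarrow> 'h \<Rightarrow> 'h" where
    all: "\<forall>t. rep t = t \<longrightarrow> \<Psi> t \<in> unital_pd_functions (Sigma_le t) \<and>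
      (\<forall>s. rep s = s \<and> s \<noteq> 1 \<and> le s t \<longrightarrow> gamma le (inv_class s) (\<Psi> t) = c (inv_class s))"
    by (elim exE)
  have \<Psi>: "\<Psi> t \<in> unital_pd_functions (Sigma_le t)" if "rep t = t" for t using all that by simp
  have \<Psi>c: "gamma le (inv_class s) (\<Psi> t) = c (inv_class s)" if "rep t = t" "rep s = s" "s \<noteq> 1" "le s t" for s t
    using all that by simp
  define \<Phi> where "\<Phi> x = \<Psi> (rep x) x" for x
  have glue: "\<Phi> x = \<Psi> t x" if t: "rep t = t" and x: "x \<in> Sigma_le t" for t x
  proof -
    have xt: "le (rep x) t" using x t by (simp add: Sigma_upto_iff)
    have "restrict (\<Psi> (rep x)) (Sigma_le (rep x)) = restrict (\<Psi> t) (Sigma_le (rep x))"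
    proof (rule determined_by_parameters[OF rep_rep \<Psi>[OF rep_rep] subset_refl \<Psi>[OF t] Sigma_le_mono[OF rep_rep t xt]])
      fix s assume s: "rep s = s" "s \<noteq> 1" "le s (rep x)"
      thus "gamma le (inv_class s) (\<Psi> (rep x)) = gamma le (inv_class s) (\<Psi> t)"
        using \<Psi>c[OF rep_rep s] \<Psi>c[OF t s(1,2) le_trans[OF s(3) xt]] by simp
    qed
    moreover have "x \<in> Sigma_le (rep x)" by (simp add: Sigma_upto_iff le_refl)
    ultimately show ?thesis by (metis \<Phi>_def restrict_apply')
  qed
  have bdd: "bounded_operator (\<Phi> x)" for x
    using unital_pd_functionsD(1)[OF \<Psi>[OF rep_rep], of x x] by (simp add: \<Phi>_def Sigma_upto_iff le_refl)
  have "positive_definite UNIV \<Phi>"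
  proof (rule positive_definiteI[OF bdd])
    fix S :: "'a free_group set" assume fin: "finite S"
    define B where "B = insert 1 ((\<lambda>(x, y). rep (inverse x * y)) ` (S \<times> S))"
    have "\<exists>t\<in>B. \<forall>u\<in>B. le u t" by (rule finite_max) (use fin in \<open>auto simp: B_def\<close>)
    then obtain t where t: "t \<in> B" "\<forall>u\<in>B. le u t" by (elim bexE)
    have mt: "rep t = t" using t(1) by (auto simp: B_def)
    have mem: "inverse x * y \<in> Sigma_le t" if "x \<in> S" "y \<in> S" for x y
    proof -
      have "rep (inverse x * y) \<in> B" using that by (auto simp: B_def)
      thus ?thesis using t(2) mt by (simp add: Sigma_upto_iff)
    qed
    have "pos_semidef S (\<lambda>x y. \<Psi> t (inverse x * y))"
      by (rule positive_definite_imp_pos_semidef[OF unital_pd_functionsD(3)[OF \<Psi>[OF mt]] fin mem])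
    thus "pos_semidef S (\<lambda>x y. \<Phi> (inverse x * y))"
      by (rule pos_semidef_cong[THEN iffD1, rotated]) (simp add: glue[OF mt mem])
  qed
  moreover have "\<Phi> 1 = id" using unital_pd_functionsD(4)[OF \<Psi>[of 1]] by (simp add: \<Phi>_def)
  ultimately have U: "\<Phi> \<in> unital_pd_functions UNIV" using bdd by (simp add: unital_pd_functions_def PiE_iff)
  have "parameters le \<Phi> = c"
  proof (rule extensionalityI[of _ nontrivial_classes])
    show "parameters le \<Phi> \<in> extensional nontrivial_classes" by (simp add: parameters_def)
    show "c \<in> extensional nontrivial_classes" using c by (simp add: contraction_sequences_def)
    fix \<mu> :: "'a free_group set" assume \<mu>: "\<mu> \<in> nontrivial_classes"
    then obtain s where s: "\<mu> = inv_class s" "rep s = s" "s \<noteq> 1" by (auto simp: nontrivial_classes_eq)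
    have "restrict \<Phi> (Sigma_le s) = restrict (\<Psi> s) (Sigma_le s)" using glue[OF s(2)] by (auto simp: restrict_def fun_eq_iff)
    hence "gamma le (inv_class s) \<Phi> = gamma le (inv_class s) (\<Psi> s)"
      using gamma_restrict[OF s(2,3) subset_refl, of \<Phi>] gamma_restrict[OF s(2,3) subset_refl, of "\<Psi> s"] by simp
    thus "parameters le \<Phi> \<mu> = c \<mu>" using \<mu> \<Psi>c[OF s(2,2,3) le_refl] by (simp add: parameters_def s(1))
  qed
  thus ?thesis using U by blast
qed

lemma parameters_in_contraction_sequences:
  fixes \<Phi> :: "'a free_group \<Rightarrow> 'h::chilbert_space \<Rightarrow> 'h"
  assumes \<Phi>: "\<Phi> \<in> unital_pd_functions UNIV"
  shows "parameters le \<Phi> \<in> contraction_sequences le"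
proof -
  have "contraction_between (D_space le \<mu> \<psi>) (R_space le \<mu> \<psi>) (parameters le \<Phi> \<mu>)"
    if \<mu>: "\<mu> \<in> nontrivial_classes" and \<psi>: "\<psi> \<in> unital_pd_functions (Sigma_upto le (pred_class le \<mu>))"
      and eq: "\<And>\<mu>'. \<mu>' \<in> nontrivial_classes \<Longrightarrow> class_less le \<mu>' \<mu> \<Longrightarrow> gamma le \<mu>' \<psi> = parameters le \<Phi> \<mu>'" for \<mu> \<psi>
  proof -
    obtain t where t: "\<mu> = inv_class t" "rep t = t" "t \<noteq> 1" using \<mu> by (auto simp: nontrivial_classes_eq)
    obtain p where p: "rep p = p" "pred_class le (inv_class t) = inv_class p"
        "\<And>x. le (rep x) p \<longleftrightarrow> le (rep x) t \<and> rep x \<noteq> t"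
      using predecessor[OF t(2,3)] by blast
    have \<psi>': "\<psi> \<in> unital_pd_functions (Sigma_le p)" using \<psi> by (simp add: t(1) p(2))
    have "restrict \<psi> (Sigma_le p) = restrict \<Phi> (Sigma_le p)"
    proof (rule determined_by_parameters[OF p(1) \<psi>' subset_refl \<Phi> subset_UNIV])
      fix s assume s: "rep s = s" "s \<noteq> 1" "le s p"
      hence "inv_class s \<in> nontrivial_classes" by (auto simp: nontrivial_classes_eq)
      moreover have "class_less le (inv_class s) \<mu>"
        using p(3)[of s] s t by (simp add: class_less_iff)
      ultimately show "gamma le (inv_class s) \<psi> = gamma le (inv_class s) \<Phi>"
        using eq[of "inv_class s"] by (simp add: parameters_def)
    qed
    moreover have "restrict \<psi> (Sigma_le p) = \<psi>"
      by (rule extensional_restrict[OF unital_pd_functionsD(2)[OF \<psi>']])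
    ultimately have res: "restrict \<Phi> (Sigma_less t) = \<psi>" by (simp add: p(2))
    have "contraction_between (D_space le (inv_class t) \<psi>) (R_space le (inv_class t) \<psi>) (gamma le (inv_class t) \<Phi>)"
      by (rule gamma_step(1)[OF t(2,3) _ \<Phi> subset_UNIV res]) (use \<psi> t(1) in simp)
    thus ?thesis using \<mu> by (simp add: parameters_def t(1))
  qed
  thus ?thesis by (auto simp: contraction_sequences_def parameters_def)
qed

end

theorem theorem4p5:
  fixes le :: "'a::finite free_group \<Rightarrow> 'a free_group \<Rightarrow> bool"
  assumes "lexicographic_order le"
  shows
    "bij_betw (parameters le)
       (unital_pd_functions UNIV :: ('a free_group \<Rightarrow> 'h::chilbert_space \<Rightarrow> 'h) set)
       (contraction_sequences le)
     \<and> (\<forall>\<Phi> \<in> unital_pd_functions UNIV. \<forall>\<Phi>' \<in> unital_pd_functions UNIV. \<forall>\<mu> \<in> inv_classes.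
          (\<forall>\<mu>' \<in> nontrivial_classes. class_le le \<mu>' \<mu> \<longrightarrow>
             gamma le \<mu>' (\<Phi> :: 'a free_group \<Rightarrow> 'h \<Rightarrow> 'h) = gamma le \<mu>' \<Phi>') \<longrightarrow>
          restrict \<Phi> (Sigma_upto le \<mu>) = restrict \<Phi>' (Sigma_upto le \<mu>))
     \<and> (\<forall>\<mu> \<in> nontrivial_classes.
          \<forall>\<psi> \<in> unital_pd_functions (Sigma_upto le (pred_class le \<mu>)) :: ('a free_group \<Rightarrow> 'h \<Rightarrow> 'h) set.
          \<forall>c. contraction_between (D_space le \<mu> \<psi>) (R_space le \<mu> \<psi>) c \<longrightarrow>
            (\<exists>!\<psi>'. \<psi>' \<in> unital_pd_functions (Sigma_upto le \<mu>) \<and>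
               restrict \<psi>' (Sigma_upto le (pred_class le \<mu>)) = \<psi> \<and> gamma le \<mu> \<psi>' = c))"
proof -
  interpret lexicographic le by standard (rule assms)
  have determined: "restrict \<Phi> (Sigma_upto le \<mu>) = restrict \<Phi>' (Sigma_upto le \<mu>)"
    if \<Phi>: "\<Phi> \<in> unital_pd_functions UNIV" "\<Phi>' \<in> unital_pd_functions UNIV" and \<mu>: "\<mu> \<in> inv_classes"
      and gam: "\<And>\<mu>'. \<mu>' \<in> nontrivial_classes \<Longrightarrow> class_le le \<mu>' \<mu> \<Longrightarrow> gamma le \<mu>' \<Phi> = gamma le \<mu>' \<Phi>'"
    for \<Phi> \<Phi>' :: "'a free_group \<Rightarrow> 'h \<Rightarrow> 'h" and \<mu>
  proof -
    obtain t where t: "\<mu> = inv_class t" "rep t = t" using \<mu> by (auto simp: classes_eq)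
    show ?thesis
      unfolding t(1)
    proof (rule determined_by_parameters[OF t(2) \<Phi>(1) subset_UNIV \<Phi>(2) subset_UNIV])
      fix s assume "rep s = s" "s \<noteq> 1" "le s t"
      thus "gamma le (inv_class s) \<Phi> = gamma le (inv_class s) \<Phi>'"
        by (intro gam) (auto simp: nontrivial_classes_eq t class_le_iff)
    qed
  qed
  have "inj_on (parameters le) (unital_pd_functions UNIV :: ('a free_group \<Rightarrow> 'h \<Rightarrow> 'h) set)"
  proof (rule inj_onI)
    fix \<Phi> \<Phi>' :: "'a free_group \<Rightarrow> 'h \<Rightarrow> 'h"
    assume \<Phi>: "\<Phi> \<in> unital_pd_functions UNIV" "\<Phi>' \<in> unital_pd_functions UNIV"
      and eq: "parameters le \<Phi> = parameters le \<Phi>'"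
    have "gamma le \<mu> \<Phi> = gamma le \<mu> \<Phi>'" if "\<mu> \<in> nontrivial_classes" for \<mu>
      using fun_cong[OF eq, of \<mu>] that by (simp add: parameters_def)
    hence "restrict \<Phi> (Sigma_le x) = restrict \<Phi>' (Sigma_le x)" for x
      by (intro determined \<Phi>) (auto simp: inv_classes_def)
    moreover have "x \<in> Sigma_le x" for x by (simp add: Sigma_upto_iff le_refl)
    ultimately show "\<Phi> = \<Phi>'" by (metis ext restrict_apply')
  qed
  moreover have "parameters le ` unital_pd_functions UNIV =
      (contraction_sequences le :: ('a free_group set \<Rightarrow> ('a free_group, 'h) ell2 \<Rightarrow> _) set)"
    using parameters_in_contraction_sequences parameters_surjective by blast
  moreover have "\<exists>!\<psi>'. \<psi>' \<in> unital_pd_functions (Sigma_upto le \<mu>) \<and>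
      restrict \<psi>' (Sigma_upto le (pred_class le \<mu>)) = \<psi> \<and> gamma le \<mu> \<psi>' = c"
    if \<mu>: "\<mu> \<in> nontrivial_classes" and \<psi>: "\<psi> \<in> unital_pd_functions (Sigma_upto le (pred_class le \<mu>))"
      and c: "contraction_between (D_space le \<mu> \<psi>) (R_space le \<mu> \<psi>) c"
    for \<mu> c and \<psi> :: "'a free_group \<Rightarrow> 'h \<Rightarrow> 'h"
  proof -
    obtain s where s: "\<mu> = inv_class s" "rep s = s" "s \<noteq> 1" using \<mu> by (auto simp: nontrivial_classes_eq)
    show ?thesis
    proof (rule ex_ex1I)
      show "\<exists>\<psi>'. \<psi>' \<in> unital_pd_functions (Sigma_upto le \<mu>) \<and>
          restrict \<psi>' (Sigma_upto le (pred_class le \<mu>)) = \<psi> \<and> gamma le \<mu> \<psi>' = c"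
        using extension_exists[OF s(2,3) \<psi>[unfolded s(1)] c[unfolded s(1)]] unfolding s(1) .
      fix \<phi> \<phi>' :: "'a free_group \<Rightarrow> 'h \<Rightarrow> 'h"
      assume 1: "\<phi> \<in> unital_pd_functions (Sigma_upto le \<mu>) \<and>
          restrict \<phi> (Sigma_upto le (pred_class le \<mu>)) = \<psi> \<and> gamma le \<mu> \<phi> = c"
        and 2: "\<phi>' \<in> unital_pd_functions (Sigma_upto le \<mu>) \<and>
          restrict \<phi>' (Sigma_upto le (pred_class le \<mu>)) = \<psi> \<and> gamma le \<mu> \<phi>' = c"
      have "restrict \<phi> (Sigma_upto le \<mu>) = restrict \<phi>' (Sigma_upto le \<mu>)"
        unfolding s(1)
        by (rule extension_unique[OF s(2,3) _ subset_refl _ subset_refl]) (use 1 2 s(1) in auto)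
      thus "\<phi> = \<phi>'"
        using 1 2 unital_pd_functionsD(2) by (metis extensional_restrict)
    qed
  qed
  ultimately show ?thesis using determined unfolding bij_betw_def by blast
qed

end
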